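(* For $n\in\mathbb{N}$, $1\le i\le n$, let triangular arrays of random variables $Y_{i,n}$ and of stochastic processes $\{R_{i,n}(t):t\in[0,1]\}$ and $\{\delta_{i,n}(t):t\in[0,1]\}$ with continuous paths be given, such that for each $n$ the triples $(Y_{i,n},R_{i,n},\delta_{i,n})$, $1\le i\le n$, are i.i.d. Suppose the following. (1) The $Y_{i,n}$ are identically distributed random variables (for all $i,n$) satisfying $$\mathbb{P}(Y_{1,1}>u)=(1+o(1))K u^{\beta}e^{-cu},\qquad u\to\infty,$$ with constants $K,c>0$, $\beta\in\mathbb{R}$. Set $X_{i,n}=a_n^{-1}(Y_{i,n}-b_n)$ with $$a_n=c^{-1},\qquad b_n=c^{-1}\left(\ln n+\beta\ln(c^{-1}\ln n)+\ln K\right)$$ (for $n$ large enough that this is defined), so that $\lim_{n\to\infty}n\mathbb{P}(X_{1,n}>s)=e^{-s}$ for all $s\in\mathbb{R}$. Assume further that for all large $r$ and any $p>0$ $$\limsup_{n\to\infty}\ n\int_{-b_n/(2a_n)}^{-r}e^{-x^2/p}\,\mathbb{P}(X_{i,n}\in dx)<\infty .$$ (2) The vector $(X_{i,n},R_{i,n}(\cdot))$ has the same distribution as $(X_{i,n},\phi_{i,n}W_{i,n}(\cdot))$, where the $W_{i,n}$ are standard Brownian motions on $[0,1]$ independent of the $X_{i,n}$, and the $\phi_{i,n}$ are positive random variables, independent of $W_{i,n}$, such that for some $q>0$ $$\lim_{n\to\infty}n\mathbb{P}(\phi_{1,n}>q)=0,$$ and, for any compact set $Q\subset\mathbb{R}$,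 $$\lim_{n\to\infty}\mathbb{P}\left(|1-\phi_{1,n}|>\epsilon\,\middle|\,X_{1,n}\in Q\right)=0\qquad\text{for all }\epsilon>0.$$ (3) The processes $\delta_{i,n}$ are independent of $X_{i,n}$ and satisfy $$\lim_{n\to\infty}\mathbb{P}(\|\delta_{1,n}\|>\epsilon)=0\ \text{ for all }\epsilon>0,\qquad \lim_{n\to\infty}n\mathbb{P}(\|\delta_{1,n}\|>C)=0\ \text{ for some }C>0.$$ Then, as $n\to\infty$, $$\eta_n(t):=\max_{i=1,\dots,n}\zeta_{i,n}(t):=\max_{i=1,\dots,n}\Bigl(X_{i,n}+R_{i,n}(t)-t/2+\delta_{i,n}(t)\Bigr)\ \stackrel{d}{\to}\ M_B(t),\qquad t\in[0,1],$$ weakly on the function space $C[0,1]$, where $M_B$ is the original Brown-Resnick process.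
   Context: $C[0,1]$ is the space of real-valued continuous functions on $[0,1]$ with the topology of uniform convergence, and $\|g\|=\sup_{t\in[0,1]}|g(t)|$. Weak convergence means weak convergence of the laws of the processes as random elements of $C[0,1]$. The original Brown-Resnick process $M_B$ is defined as follows: let $\{X_i, i\in\mathbb{N}\}$ be the points of a Poisson point process on $\mathbb{R}$ with intensity measure $e^{-x}\,dx$, and let $\{B_i,i\in\mathbb{N}\}$ be independent standard Brownian motions on $[0,\infty)$, independent of $\{X_i,i\in\mathbb{N}\}$; then $M_B(t)=\max_{i\in\mathbb{N}}\bigl(X_i+B_i(t)-t/2\bigr)$, $t\ge 0$. *)

theory Defs
  imports "HOL-Probability.Probability"
begin

text \<open>The interval \<open>[0,1]\<close> is made a metric space of its own, so that the library type of
  bounded continuous functions on it, with its supremum norm, is \<open>C[0,1]\<close>. By compactness the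
  boundedness requirement is void, see \<open>continuous_bcontfun_unit\<close> below.\<close>

typedef unit_interval = "{0..1::real}"
  morphisms real_of_unit to_unit
  by (rule exI[of _ 0]) simp

instantiation unit_interval :: metric_space
begin

definition dist_unit_interval :: "unit_interval \<Rightarrow> unit_interval \<Rightarrow> real"
  where "dist_unit_interval s t = dist (real_of_unit s) (real_of_unit t)"

definition uniformity_unit_interval :: "(unit_interval \<times> unit_interval) filter"
  where "uniformity_unit_interval = (INF e\<in>{0 <..}. principal {(s, t). dist s t < e})"

definition open_unit_interval :: "unit_interval set \<Rightarrow> bool"
  where "open_unit_interval S = (\<forall>s\<in>S. \<forall>\<^sub>F (s', t) in uniformity. s' = s \<longrightarrow> t \<in> S)"

instance
proof
  fix s t u :: unit_interval
  show "dist s t = 0 \<longleftrightarrow> s = t"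
    by (simp add: dist_unit_interval_def real_of_unit_inject)
  show "dist s t \<le> dist s u + dist t u"
    unfolding dist_unit_interval_def by (rule dist_triangle2)
qed (rule open_unit_interval_def uniformity_unit_interval_def)+

end

type_synonym C01 = "unit_interval \<Rightarrow>\<^sub>C real"

lemma continuous_on_real_of_unit: "continuous_on S real_of_unit"
  unfolding continuous_on_iff dist_unit_interval_def by auto

lemma continuous_on_to_unit: "continuous_on {0..1} to_unit"
  unfolding continuous_on_iff dist_unit_interval_def by (auto simp: to_unit_inverse)

lemma compact_UNIV_unit_interval: "compact (UNIV :: unit_interval set)"
proof -
  have "to_unit ` {0..1} = UNIV"
  proof (intro set_eqI iffI UNIV_I)
    fix t :: unit_interval
    show "t \<in> to_unit ` {0..1}"
      by (rule image_eqI[OF _ real_of_unit[of t]]) (simp add: real_of_unit_inverse)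
  qed
  then show ?thesis
    using compact_continuous_image[OF continuous_on_to_unit compact_Icc] by simp
qed

lemma continuous_bcontfun_unit:
  fixes f :: "unit_interval \<Rightarrow> real"
  assumes "continuous_on UNIV f"
  shows "f \<in> bcontfun"
  using assms compact_imp_bounded[OF compact_continuous_image[OF assms compact_UNIV_unit_interval]]
  by (simp add: bcontfun_def)

lemma norm_C01: "norm (g :: C01) = (SUP t. \<bar>g t\<bar>)"
  by (simp add: norm_bcontfun_def dist_bcontfun.rep_eq dist_real_def zero_bcontfun.rep_eq)

definition row_max_process ::
  "nat \<Rightarrow> (nat \<Rightarrow> real) \<Rightarrow> (nat \<Rightarrow> C01) \<Rightarrow> (nat \<Rightarrow> C01) \<Rightarrow> C01" where
  "row_max_process n x r d =
    Bcontfun (\<lambda>t. MAX i\<in>{1..n}. x i + r i t - real_of_unit t / 2 + d i t)"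

lemma continuous_on_MAX:
  fixes f :: "'i \<Rightarrow> 'x::topological_space \<Rightarrow> real"
  assumes "finite I" "I \<noteq> {}" "\<And>i. i \<in> I \<Longrightarrow> continuous_on S (f i)"
  shows "continuous_on S (\<lambda>t. MAX i\<in>I. f i t)"
  using assms
proof (induction I rule: finite_ne_induct)
  case (insert i I)
  have "(\<lambda>t. MAX j\<in>insert i I. f j t) = (\<lambda>t. max (f i t) (MAX j\<in>I. f j t))"
    using insert.hyps by simp
  then show ?case
    using insert by (auto intro!: continuous_on_max)
qed simp

lemma row_max_process_apply:
  assumes "n \<ge> 1"
  shows "row_max_process n x r d t = (MAX i\<in>{1..n}. x i + r i t - real_of_unit t / 2 + d i t)"
proof -
  have "continuous_on UNIV (\<lambda>t. MAX i\<in>{1..n}. x i + r i t - real_of_unit t / 2 + d i t)"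
    using assms
    by (intro continuous_on_MAX) (auto intro!: continuous_intros continuous_on_real_of_unit)
  then show ?thesis
    unfolding row_max_process_def by (simp add: Bcontfun_inverse continuous_bcontfun_unit)
qed

text \<open>The library's \<open>indep_var\<close> asks both random variables to have values in the same type;
  this is the same notion for different types.\<close>

definition indep_rv ::
  "'a measure \<Rightarrow> 'b measure \<Rightarrow> ('a \<Rightarrow> 'b) \<Rightarrow> 'c measure \<Rightarrow> ('a \<Rightarrow> 'c) \<Rightarrow> bool" where
  "indep_rv M S U T V \<longleftrightarrow>
    U \<in> measurable M S \<and> V \<in> measurable M T \<and>
    prob_space.indep_set M {U -` A \<inter> space M | A. A \<in> sets S} {V -` A \<inter> space M | A. A \<in> sets T}"

lemma (in prob_space) indep_rv_iff_indep_var: "indep_rv M S U T V \<longleftrightarrow> indep_var S U T V"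
proof -
  have "(\<lambda>i. {(case i of True \<Rightarrow> U | False \<Rightarrow> V) -` A \<inter> space M | A.
      A \<in> sets (case i of True \<Rightarrow> S | False \<Rightarrow> T)}) =
    case_bool {U -` A \<inter> space M | A. A \<in> sets S} {V -` A \<inter> space M | A. A \<in> sets T}"
    by (rule ext) (simp split: bool.split)
  then show ?thesis
    unfolding indep_rv_def indep_var_def indep_vars_def2 indep_set_def by (auto simp: UNIV_bool)
qed

definition standard_brownian_motion ::
  "'a measure \<Rightarrow> real set \<Rightarrow> (real \<Rightarrow> 'a \<Rightarrow> real) \<Rightarrow> bool" where
  "standard_brownian_motion M T W \<longleftrightarrow>
    (\<forall>t\<in>T. W t \<in> borel_measurable M) \<and>
    (AE \<omega> in M. W 0 \<omega> = 0) \<and>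
    (AE \<omega> in M. continuous_on T (\<lambda>t. W t \<omega>)) \<and>
    (\<forall>s\<in>T. \<forall>t\<in>T. s < t \<longrightarrow>
      distributed M lborel (\<lambda>\<omega>. W t \<omega> - W s \<omega>) (\<lambda>x. ennreal (normal_density 0 (sqrt (t - s)) x))) \<and>
    (\<forall>k. \<forall>t :: nat \<Rightarrow> real. (\<forall>j\<le>k. t j \<in> T) \<and> (\<forall>j<k. t j \<le> t (Suc j)) \<longrightarrow>
      prob_space.indep_vars M (\<lambda>_. borel) (\<lambda>j \<omega>. W (t (Suc j)) \<omega> - W (t j) \<omega>) {..<k})"

definition point_count :: "(nat \<Rightarrow> 'a \<Rightarrow> real) \<Rightarrow> real set \<Rightarrow> 'a \<Rightarrow> ennreal" where
  "point_count X A \<omega> = (\<Sum>i. indicator A (X i \<omega>))"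

text \<open>The sequence \<open>X\<close> enumerates, with multiplicity, the points of a Poisson point process on the
  real line with infinite intensity measure \<open>\<mu>\<close>.\<close>

definition poisson_points :: "'a measure \<Rightarrow> real measure \<Rightarrow> (nat \<Rightarrow> 'a \<Rightarrow> real) \<Rightarrow> bool" where
  "poisson_points M \<mu> X \<longleftrightarrow>
    (\<forall>i. X i \<in> borel_measurable M) \<and>
    (\<forall>A\<in>sets borel. emeasure \<mu> A < \<infinity> \<longrightarrow> (\<forall>k::nat.
      \<P>(\<omega> in M. point_count X A \<omega> = of_nat k) = measure \<mu> A ^ k / fact k * exp (- measure \<mu> A))) \<and>
    (\<forall>A\<in>sets borel. emeasure \<mu> A = \<infinity> \<longrightarrow> (AE \<omega> in M. point_count X A \<omega> = \<infinity>)) \<and>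
    (\<forall>k. \<forall>A :: nat \<Rightarrow> real set. (\<forall>j<k. A j \<in> sets borel) \<and> disjoint_family_on A {..<k} \<longrightarrow>
      prob_space.indep_vars M (\<lambda>_. borel) (\<lambda>j. point_count X (A j)) {..<k})"

definition converges_in_distribution ::
  "'a measure \<Rightarrow> (nat \<Rightarrow> 'a \<Rightarrow> 'c::topological_space) \<Rightarrow> 'b measure \<Rightarrow> ('b \<Rightarrow> 'c) \<Rightarrow> bool" where
  "converges_in_distribution M Z N L \<longleftrightarrow>
    (\<forall>n. Z n \<in> borel_measurable M) \<and> L \<in> borel_measurable N \<and>
    (\<forall>f :: 'c \<Rightarrow>\<^sub>C real.
      (\<lambda>n. \<integral>z. f z \<partial>distr M borel (Z n)) \<longlonglongrightarrow> (\<integral>z. f z \<partial>distr N borel L))"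

definition brown_resnick_ingredients ::
  "'b measure \<Rightarrow> (nat \<Rightarrow> 'b \<Rightarrow> real) \<Rightarrow> (nat \<Rightarrow> real \<Rightarrow> 'b \<Rightarrow> real) \<Rightarrow> bool" where
  "brown_resnick_ingredients N X B \<longleftrightarrow>
    prob_space N \<and>
    poisson_points N (density lborel (\<lambda>x. ennreal (exp (- x)))) X \<and>
    (\<forall>i. standard_brownian_motion N {0..} (B i)) \<and>
    prob_space.indep_vars N (\<lambda>_. \<Pi>\<^sub>M t\<in>{0..}. borel) (\<lambda>i \<omega>. \<lambda>t\<in>{0..}. B i t \<omega>) UNIV \<and>
    indep_rv N
      (\<Pi>\<^sub>M i\<in>UNIV. borel) (\<lambda>\<omega> i. X i \<omega>)
      (\<Pi>\<^sub>M i\<in>UNIV. \<Pi>\<^sub>M t\<in>{0..}. borel) (\<lambda>\<omega> i. \<lambda>t\<in>{0..}. B i t \<omega>)"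

text \<open>\<open>Z\<close> is, up to a null set, the restriction to \<open>[0,1]\<close> of the process
  \<open>t \<mapsto> max\<^sub>i (X\<^sub>i + B\<^sub>i(t) - t/2)\<close>. As the maximum is over an infinite family, it is expressed as an
  attained upper bound; it exists, and is continuous in \<open>t\<close>, only almost surely.\<close>

definition brown_resnick_on_unit ::
  "'b measure \<Rightarrow> (nat \<Rightarrow> 'b \<Rightarrow> real) \<Rightarrow> (nat \<Rightarrow> real \<Rightarrow> 'b \<Rightarrow> real) \<Rightarrow> ('b \<Rightarrow> C01) \<Rightarrow> bool" where
  "brown_resnick_on_unit N X B Z \<longleftrightarrow>
    Z \<in> borel_measurable N \<and>
    (AE \<omega> in N. \<forall>t\<in>{0..1}.
      (\<exists>i. Z \<omega> (to_unit t) = X i \<omega> + B i t \<omega> - t / 2) \<and>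
      (\<forall>i. X i \<omega> + B i t \<omega> - t / 2 \<le> Z \<omega> (to_unit t)))"

end

theory Submission
  imports Defs "HOL-Real_Asymp.Real_Asymp"
begin

text \<open>Why the theorem holds. A member of row \<open>n\<close> starts at \<open>X\<close> and moves like \<open>W t - t/2\<close>. Let \<open>y\<close> be levels
  at finitely many times \<open>t\<^sub>k\<close> and let \<open>T\<close> be the maximum over \<open>k\<close> of \<open>W t\<^sub>k - t\<^sub>k/2 - y\<^sub>k\<close>. The member exceeds
  one of the levels iff \<open>X > - T\<close>. Since \<open>n * P(X > s)\<close> tends to \<open>exp (- s)\<close> and \<open>W\<close> is independent of \<open>X\<close>, the
  expected number of members that exceed the levels tends to \<open>\<Lambda> = E exp T\<close> (\<open>excess_rate\<close>). Hence the
  maximum of the row, whose members are independent, stays below the levels with a probability that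
  tends to \<open>exp (- \<Lambda>)\<close>. For the Brown-Resnick process the same number appears as the void
  probability of a Poisson process with intensity \<open>exp (- x) dx\<close> and independent marks
  distributed like \<open>T\<close> (\<open>void_probability\<close>, a consequence of the Laplace functional). So the joint
  distribution functions at dyadic times converge to those of the limit (\<open>rows_converge\<close>).

  Two things have to be controlled. First, limit and expectation may be interchanged only if
  points far to the left do not contribute: a path that starts at \<open>x \<le> - r\<close> must climb about \<open>\<bar>x\<bar>\<close>, and
  the norm of a Brownian path has a Gaussian tail (\<open>bm_norm_tail\<close>, by chaining over dyadic
  increments), which is weighed against the Gaussian moment of the left tail of \<open>X\<close>
  (\<open>left_points_negligible\<close>). Above \<open>- r\<close> the scaling \<open>\<phi>\<close> and the error \<open>\<delta>\<close> disappear in the limit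
  (\<open>sandwich\<close>). Secondly, the maxima must not oscillate: some path stays high throughout
  (\<open>good_point_exists\<close>), so only the paths that start above \<open>- r\<close> take part in the maximum, their
  expected number stays bounded, and each is as regular as a Brownian path
  (\<open>large_oscillation_negligible\<close>).

  Convergence of distribution functions at dyadic times together with small oscillations
  implies weak convergence on \<open>C[0,1]\<close> (\<open>weak_convergence_criterion\<close>): a path is close to an interpolation
  of finitely many of its values, and bounded Lipschitz test functions suffice. The same
  interpolation shows that all Brownian motions have the same law on \<open>C[0,1]\<close> (\<open>bm_law_unique\<close>), which
  identifies the limits that arise from the rows with those that arise from the
  Brown-Resnick process.\<close>

section \<open>Paths on the unit interval and their dyadic interpolation\<close>

text \<open>A path is recovered from its values at the dyadic points \<open>k / 2^m\<close> by means of the partition of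
  unity that is obtained from the tent functions around these points by normalisation. This replaces
  piecewise linear interpolation: what matters is only that the weights are non-negative, add up to
  one and vanish at distance more than \<open>1 / 2^m\<close> from their node.\<close>

definition node :: "nat \<Rightarrow> nat \<Rightarrow> unit_interval" where
  "node m k = to_unit (real k / 2 ^ m)"

definition tent :: "nat \<Rightarrow> nat \<Rightarrow> unit_interval \<Rightarrow> real" where
  "tent m k t = max 0 (1 - \<bar>2 ^ m * real_of_unit t - real k\<bar>)"

definition hat :: "nat \<Rightarrow> nat \<Rightarrow> C01" where
  "hat m k = Bcontfun (\<lambda>t. tent m k t / (\<Sum>j\<le>2^m. tent m j t))"

definition interp :: "nat \<Rightarrow> (nat \<Rightarrow> real) \<Rightarrow> C01" where
  "interp m v = (\<Sum>k\<le>2^m. v k *\<^sub>R hat m k)"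

definition project :: "nat \<Rightarrow> C01 \<Rightarrow> C01" where
  "project m z = interp m (\<lambda>k. z (node m k))"

lemma real_of_unit_range: "0 \<le> real_of_unit t" "real_of_unit t \<le> 1"
  using real_of_unit[of t] by auto

lemma real_of_node: "k \<le> 2 ^ m \<Longrightarrow> real_of_unit (node m k) = real k / 2 ^ m"
  unfolding node_def
proof (rule to_unit_inverse)
  assume "k \<le> 2 ^ m"
  then have "real k \<le> 2 ^ m" by (metis of_nat_le_iff of_nat_numeral of_nat_power)
  then show "real k / 2 ^ m \<in> {0..1}" by simp
qed

lemma tent_nonneg: "0 \<le> tent m k t"
  by (simp add: tent_def)

lemma tent_sum_pos: "0 < (\<Sum>j\<le>2^m. tent m j t)"
proof -
  define k where "k = nat \<lfloor>2 ^ m * real_of_unit t\<rfloor>"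
  have nn: "0 \<le> 2 ^ m * real_of_unit t" using real_of_unit_range by simp
  have "2 ^ m * real_of_unit t \<le> 2 ^ m * 1"
    using real_of_unit_range by (intro mult_left_mono) auto
  then have "\<lfloor>2 ^ m * real_of_unit t\<rfloor> \<le> 2 ^ m"
    using floor_mono[of "2 ^ m * real_of_unit t" "2 ^ m"] by (simp add: floor_power)
  then have k: "k \<le> 2 ^ m" unfolding k_def
    by (metis nat_le_iff of_nat_numeral of_nat_power)
  have "real k \<le> 2 ^ m * real_of_unit t" "2 ^ m * real_of_unit t < real k + 1"
    using nn unfolding k_def by linarith+
  then have "0 < tent m k t" by (simp add: tent_def)
  then show ?thesis
    using k by (intro sum_pos2[where i=k]) (auto simp: tent_nonneg)
qed

lemma tent_dist: "tent m k t \<noteq> 0 \<Longrightarrow> k \<le> 2 ^ m \<Longrightarrow> dist t (node m k) \<le> 1 / 2 ^ m"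
proof -
  assume a: "tent m k t \<noteq> 0" "k \<le> 2 ^ m"
  then have "\<bar>2 ^ m * real_of_unit t - real k\<bar> < 1"
    by (auto simp: tent_def max_def split: if_splits)
  then have "\<bar>2 ^ m * (real_of_unit t - real k / 2 ^ m)\<bar> < 1"
    by (simp add: algebra_simps)
  then have "2 ^ m * \<bar>real_of_unit t - real k / 2 ^ m\<bar> < 1"
    by (simp add: abs_mult)
  then have "\<bar>real_of_unit t - real k / 2 ^ m\<bar> \<le> 1 / 2 ^ m"
    by (simp add: pos_le_divide_eq mult.commute)
  then show ?thesis
    using real_of_node[OF a(2)] by (simp add: dist_unit_interval_def dist_real_def)
qed

lemma hat_apply: "hat m k t = tent m k t / (\<Sum>j\<le>2^m. tent m j t)"
proof -
  have c: "continuous_on UNIV (tent m j)" for j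
    unfolding tent_def by (intro continuous_intros continuous_on_real_of_unit)
  have "continuous_on UNIV (\<lambda>t. tent m k t / (\<Sum>j\<le>2^m. tent m j t))"
    by (intro continuous_intros c) (metis tent_sum_pos less_irrefl)
  then show ?thesis
    unfolding hat_def by (subst Bcontfun_inverse) (auto intro: continuous_bcontfun_unit)
qed

lemma apply_sum_C01: "(\<Sum>i\<in>I. f i :: C01) t = (\<Sum>i\<in>I. f i t)"
  by (induction I rule: infinite_finite_induct) auto

lemma interp_apply: "interp m v t = (\<Sum>k\<le>2^m. v k * hat m k t)"
  by (simp add: interp_def apply_sum_C01)

lemma hat_nonneg: "0 \<le> hat m k t"
  by (simp add: hat_apply tent_nonneg sum_nonneg)

lemma hat_sum: "(\<Sum>k\<le>2^m. hat m k t) = 1"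
  using tent_sum_pos[of m t] by (simp add: hat_apply sum_divide_distrib[symmetric])

text \<open>The value at \<open>t\<close> is a weighted mean of the data at the nodes near \<open>t\<close>.\<close>

lemma interp_close:
  assumes "\<And>k. k \<le> 2 ^ m \<Longrightarrow> hat m k t \<noteq> 0 \<Longrightarrow> \<bar>x - v k\<bar> \<le> e"
  shows "\<bar>x - interp m v t\<bar> \<le> e"
proof -
  have "x - interp m v t = (\<Sum>k\<le>2^m. (x - v k) * hat m k t)"
    by (simp add: interp_apply left_diff_distrib sum_subtractf sum_distrib_left[symmetric] hat_sum)
  also have "\<bar>\<dots>\<bar> \<le> (\<Sum>k\<le>2^m. \<bar>(x - v k) * hat m k t\<bar>)"
    by (rule sum_abs)
  also have "\<dots> \<le> (\<Sum>k\<le>2^m. e * hat m k t)"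
  proof (rule sum_mono)
    fix k :: nat assume k: "k \<in> {..2^m}"
    show "\<bar>(x - v k) * hat m k t\<bar> \<le> e * hat m k t"
    proof (cases "hat m k t = 0")
      case False
      then show ?thesis
        using assms[of k] k hat_nonneg[of m k t] by (simp add: abs_mult mult_right_mono)
    qed simp
  qed
  also have "\<dots> = e" by (simp add: sum_distrib_left[symmetric] hat_sum)
  finally show ?thesis .
qed

lemma dist_interp_le:
  assumes "\<And>k. k \<le> 2 ^ m \<Longrightarrow> \<bar>v k - v' k\<bar> \<le> e"
  shows "dist (interp m v) (interp m v') \<le> e"
proof (rule dist_bound)
  fix t
  have "interp m v t - interp m v' t = - (0 - interp m (\<lambda>k. v k - v' k) t)"
    by (simp add: interp_apply left_diff_distrib sum_subtractf)
  also have "\<bar>\<dots>\<bar> \<le> e"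
    by (subst abs_minus, rule interp_close) (use assms in \<open>simp add: abs_minus_commute\<close>)
  finally show "dist (interp m v t) (interp m v' t) \<le> e" by (simp add: dist_real_def)
qed

lemma dist_project_le:
  fixes z :: C01
  assumes "\<And>s t. dist s t \<le> 1 / 2 ^ m \<Longrightarrow> \<bar>z s - z t\<bar> \<le> e"
  shows "dist z (project m z) \<le> e"
proof (rule dist_bound)
  fix t
  show "dist (z t) (project m z t) \<le> e"
    unfolding dist_real_def project_def
  proof (rule interp_close)
    fix k :: nat assume "k \<le> 2 ^ m" "hat m k t \<noteq> 0"
    then have "dist t (node m k) \<le> 1 / 2 ^ m"
      by (intro tent_dist) (auto simp: hat_apply)
    then show "\<bar>z t - z (node m k)\<bar> \<le> e" by (rule assms)
  qed
qed

lemma C01_uniformly_continuous: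
  fixes z :: C01
  assumes "0 < e"
  obtains m0 where "\<And>m s t. m0 \<le> m \<Longrightarrow> dist s t \<le> 1 / 2 ^ m \<Longrightarrow> \<bar>z s - z t\<bar> \<le> e"
proof -
  have "uniformly_continuous_on UNIV (apply_bcontfun z)"
    by (rule compact_uniformly_continuous[OF _ compact_UNIV_unit_interval]) simp
  then obtain d where d: "d > 0" "\<And>s t :: unit_interval. dist s t < d \<Longrightarrow> dist (z s) (z t) < e"
    using assms unfolding uniformly_continuous_on_def by (metis UNIV_I)
  obtain m0 where m0: "(1/2) ^ m0 < d"
    using real_arch_pow_inv[of d "1/2"] d(1) by auto
  show ?thesis
  proof (rule that)
    fix m and s t :: unit_interval assume m: "m0 \<le> m" and st: "dist s t \<le> 1 / 2 ^ m"
    have "(1/2::real) ^ m \<le> (1/2) ^ m0" using m by (intro power_decreasing) auto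
    then have "dist s t < d" using st m0 by (simp add: power_divide)
    then have "dist (z s) (z t) < e" by (rule d(2))
    then show "\<bar>z s - z t\<bar> \<le> e" by (simp add: dist_real_def)
  qed
qed

lemma project_tendsto: "(\<lambda>m. project m z) \<longlonglongrightarrow> z"
proof (rule tendstoI)
  fix e :: real assume "0 < e"
  then have "0 < e / 2" by simp
  from C01_uniformly_continuous[OF this, of z]
  obtain m0 where "\<And>m s t. m0 \<le> m \<Longrightarrow> dist s t \<le> 1 / 2 ^ m \<Longrightarrow> \<bar>z s - z t\<bar> \<le> e / 2"
    by blast
  then have "dist z (project m z) \<le> e / 2" if "m0 \<le> m" for m
    using that by (intro dist_project_le) auto
  then show "\<forall>\<^sub>F m in sequentially. dist (project m z) z < e"
    using \<open>0 < e\<close> by (intro eventually_sequentiallyI[of m0]) (fastforce simp: dist_commute)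
qed

text \<open>Every value is a limit of weighted means of values at nodes.\<close>

lemma node_dense:
  fixes z :: C01
  assumes "\<And>m k. k \<le> 2 ^ m \<Longrightarrow> z (node m k) \<le> u"
  shows "z t \<le> u"
proof (rule LIMSEQ_le_const2)
  show "(\<lambda>m. project m z t) \<longlonglongrightarrow> z t"
    using tendsto_bcontfun_uniform_limit[OF project_tendsto[of z]]
    by (rule tendsto_uniform_limitI) simp
  have "project m z t \<le> u" for m
  proof -
    have "project m z t \<le> (\<Sum>k\<le>2^m. u * hat m k t)"
      unfolding project_def interp_apply
      using assms by (intro sum_mono mult_right_mono hat_nonneg) auto
    then show ?thesis by (simp add: sum_distrib_left[symmetric] hat_sum)
  qed
  then show "\<exists>N. \<forall>m\<ge>N. project m z t \<le> u" by blast
qed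

lemma continuous_on_eval_C01: "continuous_on UNIV (\<lambda>z::C01. z t)"
  unfolding continuous_on_iff using dist_bounded le_less_trans by blast

lemma measurable_eval_C01 [measurable]:
  "(\<lambda>z::C01. z t) \<in> borel_measurable borel"
  by (rule borel_measurable_continuous_onI[OF continuous_on_eval_C01])

lemma continuous_on_interp: "continuous_on UNIV (interp m)"
  unfolding interp_def
  by (intro continuous_on_sum continuous_on_scaleR continuous_on_product_coordinates
      continuous_on_const)

text \<open>Measurability into \<open>C[0,1]\<close> is a matter of coordinates: a path is the limit of the images of its
  dyadic values under the continuous maps \<open>interp m\<close>, and limits of measurable maps into a metric
  space are measurable.\<close>

lemma measurable_C01I:
  fixes V :: "'a \<Rightarrow> C01"
  assumes "\<And>t. (\<lambda>\<omega>. V \<omega> t) \<in> borel_measurable M"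
  shows "V \<in> borel_measurable M"
proof (rule borel_measurable_LIMSEQ_metric)
  fix m
  have "(\<lambda>\<omega> k. V \<omega> (node m k)) \<in> borel_measurable M"
    by (rule measurable_coordinatewise_then_product) (rule assms)
  then show "(\<lambda>\<omega>. project m (V \<omega>)) \<in> borel_measurable M"
    unfolding project_def
    by (rule measurable_compose[OF _ borel_measurable_continuous_onI[OF continuous_on_interp]])
qed (rule project_tendsto)

lemma measurable_interp:
  assumes "\<And>k. k \<le> 2 ^ m \<Longrightarrow> (\<lambda>\<omega>. v \<omega> k) \<in> borel_measurable M"
  shows "(\<lambda>\<omega>. interp m (v \<omega>)) \<in> borel_measurable M"
  by (rule measurable_C01I) (auto simp: interp_apply intro!: borel_measurable_sum borel_measurable_times assms)

lemma measurable_eval_comp [measurable (raw)]: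
  fixes V :: "'a \<Rightarrow> C01"
  shows "V \<in> borel_measurable M \<Longrightarrow> (\<lambda>\<omega>. V \<omega> t) \<in> borel_measurable M"
  by (rule measurable_compose[OF _ measurable_eval_C01])

lemma project_measurable [measurable]: "project m \<in> borel_measurable borel"
  unfolding project_def by (rule measurable_interp) simp

section \<open>Bounded Lipschitz test functions\<close>

definition bounded_lipschitz :: "('a::metric_space \<Rightarrow> real) \<Rightarrow> bool" where
  "bounded_lipschitz F \<longleftrightarrow>
    (\<exists>L b. (\<forall>x y. \<bar>F x - F y\<bar> \<le> L * dist x y) \<and> (\<forall>x. \<bar>F x\<bar> \<le> b))"

lemma bounded_lipschitzE:
  assumes "bounded_lipschitz F"
  obtains L b where "L > 0" "b > 0" "\<And>x y. \<bar>F x - F y\<bar> \<le> L * dist x y" "\<And>x. \<bar>F x\<bar> \<le> b"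
proof -
  obtain L b where L: "\<And>x y. \<bar>F x - F y\<bar> \<le> L * dist x y" and b: "\<And>x. \<bar>F x\<bar> \<le> b"
    using assms unfolding bounded_lipschitz_def by blast
  have "\<bar>F x - F y\<bar> \<le> max L 1 * dist x y" for x y
    by (rule order_trans[OF L]) (auto intro: mult_right_mono)
  moreover have "\<bar>F x\<bar> \<le> max b 1" for x using b[of x] by simp
  ultimately show ?thesis by (intro that[of "max L 1" "max b 1"]) auto
qed

lemma bounded_lipschitz_continuous:
  assumes "bounded_lipschitz F"
  shows "continuous_on UNIV F"
proof -
  obtain L b where L: "L > 0" "\<And>x y. \<bar>F x - F y\<bar> \<le> L * dist x y"
    using bounded_lipschitzE[OF assms] by metis
  have "dist (F y) (F x) < e" if "dist y x < e / L" "0 < e" for x y e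
    using that L(1) le_less_trans[OF L(2)[of y x], of e]
    by (simp add: dist_real_def pos_less_divide_eq mult.commute)
  then show ?thesis
    unfolding continuous_on_iff using L(1) by (metis divide_pos_pos)
qed

lemma bounded_lipschitz_measurable:
  "bounded_lipschitz F \<Longrightarrow> F \<in> borel_measurable borel"
  by (intro borel_measurable_continuous_onI bounded_lipschitz_continuous)

lemma integrable_bounded_lipschitz:
  assumes "bounded_lipschitz F" "prob_space \<mu>" "sets \<mu> = sets borel"
  shows "integrable \<mu> F"
proof -
  interpret prob_space \<mu> by fact
  obtain b where b: "\<And>x. \<bar>F x\<bar> \<le> b"
    using bounded_lipschitzE[OF assms(1)] by metis
  have "F \<in> borel_measurable \<mu>"
    using bounded_lipschitz_measurable[OF assms(1)] assms(3) by (simp cong: measurable_cong_sets)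
  then show ?thesis
    by (rule integrable_const_bound[rotated, of _ b]) (simp add: b)
qed

text \<open>A bounded continuous function is the pointwise increasing limit of its inf-convolutions with
  multiples of the metric, and these are Lipschitz.\<close>

lemma inf_convolution:
  fixes f :: "'a::metric_space \<Rightarrow>\<^sub>C real"
  defines "g \<equiv> \<lambda>(k::nat) x. INF y. f y + real k * dist x y"
  shows "bounded_lipschitz (g k)" and "g k x \<le> f x" and "\<bar>g k x\<bar> \<le> norm f"
    and "(\<lambda>k. g k x) \<longlonglongrightarrow> f x"
proof -
  have fb: "- norm f \<le> f y" "f y \<le> norm f" for y
    using norm_bounded[of f y] by (auto simp: abs_le_iff)
  have lb: "- norm f \<le> f y + real k * dist x y" for k x y
    using fb[of y] by (simp add: add_increasing2)
  have bdd: "bdd_below (range (\<lambda>y. f y + real k * dist x y))" for k x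
    using lb by (intro bdd_belowI[of _ "- norm f"]) auto
  have gl: "g k x \<le> f y + real k * dist x y" for k x y
    unfolding g_def by (rule cINF_lower[OF bdd]) simp
  have gg: "c \<le> g k x" if "\<And>y. c \<le> f y + real k * dist x y" for c k x
    unfolding g_def by (rule cINF_greatest) (use that in auto)
  show le: "g k x \<le> f x" for k x using gl[of k x x] by simp
  have ge: "- norm f \<le> g k x" for k x by (rule gg) (rule lb)
  show bd: "\<bar>g k x\<bar> \<le> norm f" for k x
    using ge[of k x] le[of k x] fb[of x] by linarith
  have lip: "g k x \<le> g k x' + real k * dist x x'" for k x x'
  proof -
    have "g k x - real k * dist x x' \<le> g k x'"
    proof (rule gg)
      fix y
      have "real k * dist x y \<le> real k * (dist x x' + dist x' y)"
        by (intro mult_left_mono dist_triangle) auto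
      then show "g k x - real k * dist x x' \<le> f y + real k * dist x' y"
        using gl[of k x y] by (simp add: distrib_left)
    qed
    then show ?thesis by simp
  qed
  have "\<bar>g k x - g k x'\<bar> \<le> real k * dist x x'" for x x'
    using lip[of k x x'] lip[of k x' x] by (simp add: dist_commute abs_le_iff)
  then show "bounded_lipschitz (g k)"
    unfolding bounded_lipschitz_def using bd[of k] by blast
  show "(\<lambda>k. g k x) \<longlonglongrightarrow> f x"
  proof (rule tendstoI)
    fix e :: real assume e: "0 < e"
    have "\<exists>d>0. \<forall>y. dist y x < d \<longrightarrow> dist (f y) (f x) < e / 2"
      using continuous_on_apply_bcontfun[of UNIV f] e half_gt_zero[OF e]
      unfolding continuous_on_iff by (metis UNIV_I)
    then obtain d where d: "d > 0" "\<And>y. dist x y < d \<Longrightarrow> dist (f y) (f x) < e / 2"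
      by (auto simp: dist_commute)
    obtain k0 :: nat where k0: "2 * norm f / d \<le> real k0" using real_arch_simple by blast
    have "f x - e / 2 \<le> g k x" if k: "k0 \<le> k" for k
    proof (rule gg)
      fix y
      show "f x - e / 2 \<le> f y + real k * dist x y"
      proof (cases "dist x y < d")
        case True
        have "0 \<le> real k * dist x y" by simp
        with d(2)[OF True] show ?thesis unfolding dist_real_def by linarith
      next
        case False
        have "2 * norm f \<le> real k * d"
          using k0 k d(1) by (simp add: pos_divide_le_eq)
            (meson mult_right_mono of_nat_mono order_trans less_imp_le)
        also have "\<dots> \<le> real k * dist x y" using False by (intro mult_left_mono) auto
        finally show ?thesis using fb[of x] fb[of y] e by linarith
      qed
    qed
    then show "\<forall>\<^sub>F k in sequentially. dist (g k x) (f x) < e"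
      using le e by (intro eventually_sequentiallyI[of k0]) (smt (verit) dist_real_def field_sum_of_halves)
  qed
qed

text \<open>The inf-convolutions bound \<open>f\<close> from below, so convergence on Lipschitz functions gives the lower
  half \<open>liminf \<integral>f d\<mu>\<^sub>n \<ge> \<integral>f d\<nu>\<close>; the upper half is the lower half for \<open>- f\<close>.\<close>

lemma lipschitz_portmanteau:
  fixes \<mu> :: "nat \<Rightarrow> 'a::metric_space measure"
    and f :: "'a \<Rightarrow>\<^sub>C real"
  assumes \<mu>: "\<And>n. prob_space (\<mu> n)" "\<And>n. sets (\<mu> n) = sets borel"
    and \<nu>: "prob_space \<nu>" "sets \<nu> = sets borel"
    and lim: "\<And>F. bounded_lipschitz F \<Longrightarrow> (\<lambda>n. \<integral>x. F x \<partial>\<mu> n) \<longlonglongrightarrow> (\<integral>x. F x \<partial>\<nu>)"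
  shows "(\<lambda>n. \<integral>x. f x \<partial>\<mu> n) \<longlonglongrightarrow> (\<integral>x. f x \<partial>\<nu>)"
proof -
  have int: "integrable \<rho> f" if "prob_space \<rho>" "sets \<rho> = sets borel" for \<rho> and f :: "'a \<Rightarrow>\<^sub>C real"
  proof -
    interpret prob_space \<rho> by fact
    have "apply_bcontfun f \<in> borel_measurable \<rho>"
      using that(2) borel_measurable_continuous_onI[of "apply_bcontfun f"]
      by (simp cong: measurable_cong_sets)
    then show ?thesis
      by (rule integrable_const_bound[rotated, of _ "norm f"]) (use norm_bounded[of f] in simp)
  qed
  have half: "\<forall>\<^sub>F n in sequentially. (\<integral>x. f x \<partial>\<nu>) - e < (\<integral>x. f x \<partial>\<mu> n)"
    if "0 < e" for e and f :: "'a \<Rightarrow>\<^sub>C real"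
  proof -
    define g where "g = (\<lambda>(k::nat) x. INF y. f y + real k * dist x y)"
    have g: "bounded_lipschitz (g k)" "g k x \<le> f x" "\<bar>g k x\<bar> \<le> norm f"
      "(\<lambda>k. g k x) \<longlonglongrightarrow> f x" for k x
      unfolding g_def by (rule inf_convolution)+
    interpret prob_space \<nu> by fact
    have "(\<lambda>k. \<integral>x. g k x \<partial>\<nu>) \<longlonglongrightarrow> (\<integral>x. f x \<partial>\<nu>)"
      by (rule integral_dominated_convergence[where w="\<lambda>_. norm f"])
        (use g int[OF \<nu>, of f] integrable_bounded_lipschitz[OF g(1) \<nu>] in auto)
    then have "\<forall>\<^sub>F k in sequentially. (\<integral>x. f x \<partial>\<nu>) - e < (\<integral>x. g k x \<partial>\<nu>)"
      by (rule order_tendstoD) (use that in auto)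
    then obtain k where k: "(\<integral>x. f x \<partial>\<nu>) - e < (\<integral>x. g k x \<partial>\<nu>)"
      by (auto simp: eventually_sequentially)
    have "\<forall>\<^sub>F n in sequentially. (\<integral>x. f x \<partial>\<nu>) - e < (\<integral>x. g k x \<partial>\<mu> n)"
      by (rule order_tendstoD[OF lim[OF g(1)]]) (rule k)
    moreover have "(\<integral>x. g k x \<partial>\<mu> n) \<le> (\<integral>x. f x \<partial>\<mu> n)" for n
      by (rule integral_mono[OF integrable_bounded_lipschitz[OF g(1) \<mu>] int[OF \<mu>] g(2)])
    ultimately show ?thesis by (auto elim!: eventually_mono intro: less_le_trans)
  qed
  show ?thesis
  proof (rule tendstoI)
    fix e :: real assume e: "0 < e"
    from half[OF e, of f] half[OF e, of "- f"]
    show "\<forall>\<^sub>F n in sequentially. dist (\<integral>x. f x \<partial>\<mu> n) (\<integral>x. f x \<partial>\<nu>) < e"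
      by eventually_elim (simp add: dist_real_def abs_less_iff)
  qed
qed

text \<open>The indicator of a closed set is the decreasing limit of the Lipschitz functions
  \<open>max 0 (1 - k * infdist x S)\<close>, and the closed sets generate the Borel sets.\<close>

lemma measure_eq_by_bounded_lipschitz:
  fixes \<mu> \<nu> :: "'a::metric_space measure"
  assumes \<mu>: "prob_space \<mu>" "sets \<mu> = sets borel" and \<nu>: "prob_space \<nu>" "sets \<nu> = sets borel"
    and eq: "\<And>F. bounded_lipschitz F \<Longrightarrow> (\<integral>x. F x \<partial>\<mu>) = (\<integral>x. F x \<partial>\<nu>)"
  shows "\<mu> = \<nu>"
proof -
  interpret m: prob_space \<mu> by fact
  interpret n: prob_space \<nu> by fact
  have closed_eq: "measure \<mu> S = measure \<nu> S" if S: "closed S" for S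
  proof (cases "S = {}")
    case False
    define g where "g = (\<lambda>(k::nat) x. max 0 (1 - real k * infdist x S))"
    have gb: "\<bar>g k x\<bar> \<le> 1" for k x
      using infdist_nonneg[of x S] by (auto simp: g_def)
    have "\<bar>g k x - g k y\<bar> \<le> real k * dist x y" for k x y
    proof -
      have "\<bar>g k x - g k y\<bar> \<le> \<bar>real k * (infdist x S - infdist y S)\<bar>"
        unfolding g_def right_diff_distrib by linarith
      also have "\<dots> \<le> real k * dist x y"
        using infdist_triangle_abs[of x S y] by (simp add: abs_mult mult_left_mono)
      finally show ?thesis .
    qed
    with gb have gl: "bounded_lipschitz (g k)" for k
      unfolding bounded_lipschitz_def by blast
    have glim: "(\<lambda>k. g k x) \<longlonglongrightarrow> indicator S x" for x
    proof (cases "x \<in> S")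
      case True
      then show ?thesis by (simp add: g_def)
    next
      case out: False
      then have p: "infdist x S > 0" using S False infdist_pos_not_in_closed by blast
      obtain k0 :: nat where k0: "1 / infdist x S \<le> real k0" using real_arch_simple by blast
      have "g k x = 0" if "k0 \<le> k" for k
      proof -
        have "1 \<le> real k0 * infdist x S" using k0 p by (simp add: pos_divide_le_eq)
        also have "\<dots> \<le> real k * infdist x S" using that p by (intro mult_right_mono) auto
        finally show ?thesis by (simp add: g_def)
      qed
      then show ?thesis using out
        by (intro tendsto_eventually eventually_sequentiallyI[of k0]) auto
    qed
    have lim: "(\<lambda>k. \<integral>x. g k x \<partial>\<rho>) \<longlonglongrightarrow> measure \<rho> S"
      if "prob_space \<rho>" "sets \<rho> = sets borel" for \<rho>
    proof -
      interpret prob_space \<rho> by fact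
      have [measurable]: "S \<in> sets \<rho>" using S that by auto
      have "(\<lambda>k. \<integral>x. g k x \<partial>\<rho>) \<longlonglongrightarrow> (\<integral>x. indicator S x \<partial>\<rho>)"
        by (rule integral_dominated_convergence[where w="\<lambda>_. 1"])
          (use glim gb integrable_bounded_lipschitz[OF gl that] in auto)
      then show ?thesis by simp
    qed
    from lim[OF \<mu>] lim[OF \<nu>] eq[OF gl] show ?thesis
      by (simp add: LIMSEQ_unique)
  qed simp
  show ?thesis
  proof (rule measure_eqI_generator_eq[where E="{S. closed S}" and \<Omega>=UNIV and A="\<lambda>_. UNIV"])
    show "Int_stable {S::'a set. closed S}" by (auto simp: Int_stable_def)
    show "emeasure \<mu> X = emeasure \<nu> X" if "X \<in> {S. closed S}" for X
      using closed_eq[of X] that by (simp add: m.emeasure_eq_measure n.emeasure_eq_measure)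
    show "sets \<mu> = sigma_sets UNIV {S. closed S}" "sets \<nu> = sigma_sets UNIV {S. closed S}"
      unfolding \<mu> \<nu> borel_eq_closed by simp_all
  qed auto
qed

section \<open>Brownian paths: Gaussian tail of the norm and uniqueness of the law\<close>

text \<open>Markov's inequality for \<open>exp (X\<^sup>2 / (4 \<sigma>\<^sup>2))\<close>: multiplying the density of \<open>N(0, \<sigma>\<^sup>2)\<close> by this
  function yields \<open>sqrt 2\<close> times the density of \<open>N(0, 2 \<sigma>\<^sup>2)\<close>.\<close>

lemma (in prob_space) gaussian_tail:
  assumes X: "distributed M lborel X (\<lambda>x. ennreal (normal_density 0 \<sigma> x))" and "0 < \<sigma>" "0 \<le> a"
  shows "emeasure M {\<omega>\<in>space M. a < \<bar>X \<omega>\<bar>} \<le> ennreal (2 * exp (- (a\<^sup>2 / (4 * \<sigma>\<^sup>2))))"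
proof -
  have [measurable]: "X \<in> borel_measurable M"
    using distributed_measurable[OF X] by simp
  define u where "u x = exp (x\<^sup>2 / (4 * \<sigma>\<^sup>2))" for x :: real
  have [measurable]: "u \<in> borel_measurable borel" unfolding u_def by measurable
  have u0: "0 \<le> u x" for x unfolding u_def by simp
  have dens: "normal_density 0 \<sigma> x * u x = sqrt 2 * normal_density 0 (sqrt 2 * \<sigma>) x" for x
  proof -
    have "exp (- x\<^sup>2 / (2 * \<sigma>\<^sup>2)) * u x = exp (- x\<^sup>2 / (2 * (sqrt 2 * \<sigma>)\<^sup>2))"
      unfolding u_def exp_add[symmetric] using \<open>0 < \<sigma>\<close>
      by (intro arg_cong[where f=exp]) (simp add: power_mult_distrib field_simps)
    moreover have "sqrt (2 * pi * (sqrt 2 * \<sigma>)\<^sup>2) = sqrt 2 * sqrt (2 * pi * \<sigma>\<^sup>2)"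
      by (simp add: power_mult_distrib real_sqrt_mult)
    ultimately show ?thesis unfolding normal_density_def by (simp add: field_simps)
  qed
  have "(\<integral>\<^sup>+\<omega>. ennreal (u (X \<omega>)) \<partial>M) = (\<integral>\<^sup>+x. ennreal (normal_density 0 \<sigma> x) * ennreal (u x) \<partial>lborel)"
    by (rule distributed_nn_integral[OF X, symmetric]) simp
  also have "\<dots> = (\<integral>\<^sup>+x. ennreal (sqrt 2) * ennreal (normal_density 0 (sqrt 2 * \<sigma>) x) \<partial>lborel)"
    by (intro nn_integral_cong, subst (1 2) ennreal_mult[symmetric]) (simp_all only: dens normal_density_nonneg u0 real_sqrt_ge_zero zero_le_numeral)
  also have "\<dots> = ennreal (sqrt 2) * (\<integral>\<^sup>+x. ennreal (normal_density 0 (sqrt 2 * \<sigma>) x) \<partial>lborel)"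
    by (rule nn_integral_cmult) simp
  also have "(\<integral>\<^sup>+x. ennreal (normal_density 0 (sqrt 2 * \<sigma>) x) \<partial>lborel) = 1"
    using prob_space.emeasure_space_1[OF prob_space_normal_density[of "sqrt 2 * \<sigma>" 0]] \<open>0 < \<sigma>\<close>
    by (simp add: emeasure_density)
  finally have Eu: "(\<integral>\<^sup>+\<omega>. ennreal (u (X \<omega>)) \<partial>M) = ennreal (sqrt 2)" by simp
  define c where "c = exp (- (a\<^sup>2 / (4 * \<sigma>\<^sup>2)))"
  have sub: "1 \<le> ennreal c * ennreal (u y)" if "a < \<bar>y\<bar>" for y
  proof -
    have "a\<^sup>2 \<le> y\<^sup>2" using that \<open>0 \<le> a\<close> by (metis abs_ge_zero less_imp_le power2_abs power_mono)
    then have "0 \<le> - (a\<^sup>2 / (4 * \<sigma>\<^sup>2)) + y\<^sup>2 / (4 * \<sigma>\<^sup>2)" by (simp add: divide_right_mono)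
    then have "1 \<le> c * u y" unfolding c_def u_def exp_add[symmetric] by simp
    then show ?thesis by (simp add: ennreal_mult'[symmetric] c_def)
  qed
  have "emeasure M {\<omega>\<in>space M. a < \<bar>X \<omega>\<bar>} \<le> emeasure M {\<omega>\<in>space M. 1 \<le> ennreal c * ennreal (u (X \<omega>))}"
    by (intro emeasure_mono) (use sub in auto)
  also have "\<dots> \<le> ennreal c * (\<integral>\<^sup>+\<omega>. ennreal (u (X \<omega>)) * indicator (space M) \<omega> \<partial>M)"
    by (rule nn_integral_Markov_inequality) auto
  also have "(\<integral>\<^sup>+\<omega>. ennreal (u (X \<omega>)) * indicator (space M) \<omega> \<partial>M) = ennreal (sqrt 2)"
    unfolding Eu[symmetric] by (intro nn_integral_cong) auto
  also have "ennreal c * ennreal (sqrt 2) \<le> ennreal (2 * c)"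
    by (subst ennreal_mult'[symmetric]) (auto simp: c_def mult.commute real_sqrt_le_iff intro!: ennreal_leI real_le_lsqrt)
  finally show ?thesis unfolding c_def .
qed

text \<open>A Brownian motion \<open>W\<close> on a time set containing \<open>[0,1]\<close> has continuous paths only almost surely; \<open>V\<close>
  is a random element of \<open>C[0,1]\<close> that agrees with it almost surely.\<close>

definition bm_version :: "'a measure \<Rightarrow> (real \<Rightarrow> 'a \<Rightarrow> real) \<Rightarrow> ('a \<Rightarrow> C01) \<Rightarrow> bool" where
  "bm_version M W V \<longleftrightarrow> prob_space M \<and> V \<in> borel_measurable M \<and>
    (\<exists>T. {0..1} \<subseteq> T \<and> standard_brownian_motion M T W) \<and>
    (AE \<omega> in M. \<forall>t\<in>{0..1}. V \<omega> (to_unit t) = W t \<omega>)"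

lemma node_0: "node m 0 = to_unit 0"
  by (simp add: node_def)

lemma node_double: "node (Suc m) (2 * k) = node m k"
  by (simp add: node_def)

text \<open>A dyadic point of level \<open>m\<close> is one of level \<open>m - 1\<close> or a right neighbour of one.\<close>

lemma dyadic_chaining:
  fixes z :: C01
  assumes z0: "z (to_unit 0) = 0" and a: "\<And>m. 0 \<le> a m"
    and inc: "\<And>m k. k < 2 ^ m \<Longrightarrow> \<bar>z (node m (Suc k)) - z (node m k)\<bar> \<le> a m"
  shows "k \<le> 2 ^ m \<Longrightarrow> \<bar>z (node m k)\<bar> \<le> (\<Sum>j\<le>m. a j)"
proof (induction m arbitrary: k)
  case 0
  then consider "k = 0" | "k = 1" by fastforce
  then show ?case
    using inc[of 0 0] z0 a[of 0] by cases (auto simp: node_0)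
next
  case (Suc m)
  show ?case
  proof (cases "even k")
    case True
    then obtain l where l: "k = 2 * l" by blast
    then show ?thesis using Suc.IH[of l] Suc.prems a[of "Suc m"] by (simp add: node_double)
  next
    case False
    then obtain l where l: "k = Suc (2 * l)" using oddE by fastforce
    have "2 * l < 2 ^ Suc m" "l \<le> 2 ^ m" using l Suc.prems by auto
    then show ?thesis
      using inc[of "2 * l" "Suc m"] Suc.IH[of l] l by (simp add: node_double)
  qed
qed

lemma norm_le_nodes:
  fixes z :: C01
  assumes "\<And>m k. k \<le> 2 ^ m \<Longrightarrow> \<bar>z (node m k)\<bar> \<le> u"
  shows "norm z \<le> u"
proof -
  have "z (node m k) \<le> u" "(- z) (node m k) \<le> u" if "k \<le> 2 ^ m" for m k
    using assms[OF that] by (auto simp: abs_le_iff)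
  then have "z t \<le> u" "(- z) t \<le> u" for t
    using node_dense[of z u t] node_dense[of "- z" u t] by blast+
  then show ?thesis
    by (intro norm_bound) (simp add: abs_le_iff minus_le_iff)
qed

text \<open>The ratio \<open>3/4\<close> makes the bounds summable, with total \<open>u\<close>, and yet large compared with the
  standard deviations \<open>(1/2)^(m/2)\<close> of the increments, since \<open>(3/4)\<^sup>2 * 2 = 9/8 > 1\<close>.\<close>

lemma norm_le_of_dyadic_increments:
  fixes z :: C01
  assumes z0: "z (to_unit 0) = 0" and u: "0 \<le> u"
    and inc: "\<And>m k. k < 2 ^ m \<Longrightarrow> \<bar>z (node m (Suc k)) - z (node m k)\<bar> \<le> u / 4 * (3 / 4) ^ m"
  shows "norm z \<le> u"
proof -
  have "\<bar>z (node m k)\<bar> \<le> u" if "k \<le> 2 ^ m" for m k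
  proof -
    have "\<bar>z (node m k)\<bar> \<le> (\<Sum>j\<le>m. u / 4 * (3 / 4) ^ j)"
      by (rule dyadic_chaining[OF z0 _ inc that]) (use u in auto)
    also have "\<dots> = u / 4 * (\<Sum>j<Suc m. (3 / 4) ^ j)"
      by (simp only: sum_distrib_left lessThan_Suc_atMost)
    also have "(\<Sum>j<Suc m. (3 / 4 :: real) ^ j) = 4 - 4 * (3 / 4) ^ Suc m"
      by (subst sum_gp_strict) (simp add: field_simps)
    also have "u / 4 * \<dots> \<le> u / 4 * 4"
      using u by (intro mult_left_mono) auto
    finally show ?thesis by simp
  qed
  then show ?thesis by (rule norm_le_nodes)
qed

lemma node_mem: "k \<le> 2 ^ m \<Longrightarrow> real k / 2 ^ m \<in> {0..1}"
  using real_of_node[of k m] real_of_unit[of "node m k"] by simp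

lemma bm_increment:
  assumes W: "standard_brownian_motion M T W" "{0..1} \<subseteq> T" and k: "k < 2 ^ m"
  shows "distributed M lborel (\<lambda>\<omega>. W (real (Suc k) / 2 ^ m) \<omega> - W (real k / 2 ^ m) \<omega>)
    (\<lambda>x. ennreal (normal_density 0 (sqrt (1 / 2 ^ m)) x))"
proof -
  have "real k / 2 ^ m \<in> T" "real (Suc k) / 2 ^ m \<in> T"
    using node_mem[of k m] node_mem[of "Suc k" m] k W(2) by auto
  moreover have "real k / 2 ^ m < real (Suc k) / 2 ^ m"
    by (simp add: divide_strict_right_mono)
  moreover have "real (Suc k) / 2 ^ m - real k / 2 ^ m = 1 / 2 ^ m"
    by (simp add: diff_divide_distrib[symmetric])
  ultimately show ?thesis
    using W(1) unfolding standard_brownian_motion_def by metis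
qed

text \<open>Chaining: if \<open>u < norm V\<close> then an increment of some level \<open>m\<close> exceeds \<open>a m = u/4 * (3/4)^m\<close>. The
  union bound over the \<open>2^m\<close> increments of that level costs at most
  \<open>2 * 2^m * exp (- u\<^sup>2/64 * (9/8)^m)\<close>, which is summable in \<open>m\<close> with a sum of order
  \<open>exp (- u\<^sup>2/64)\<close>. The threshold \<open>32\<close> ensures \<open>exp (- u\<^sup>2/512) \<le> 1/4\<close>, so that the bounds at least halve
  from each level to the next.\<close>

lemma bm_norm_tail:
  assumes V: "bm_version M W V" and u: "32 \<le> u"
  shows "emeasure M {\<omega>\<in>space M. u < norm (V \<omega>)} \<le> ennreal (4 * exp (- (u\<^sup>2 / 64)))"
proof -
  interpret prob_space M using V by (simp add: bm_version_def)
  have [measurable]: "V \<in> borel_measurable M" using V by (simp add: bm_version_def)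
  obtain T where T: "{0..1} \<subseteq> T" "standard_brownian_motion M T W"
    using V by (auto simp: bm_version_def)
  define a where "a m = u / 4 * (3 / 4) ^ m" for m :: nat
  define D where "D m k \<omega> = W (real (Suc k) / 2 ^ m) \<omega> - W (real k / 2 ^ m) \<omega>" for m k \<omega>
  have Dm: "D m k \<in> borel_measurable M" if "k < 2 ^ m" for m k
    using distributed_measurable[OF bm_increment[OF T(2,1) that]] by (simp add: D_def[abs_def])
  define E where "E m = (\<Union>k\<in>{..<2^m}. {\<omega>\<in>space M. a m < \<bar>D m k \<omega>\<bar>})" for m :: nat
  have Em: "{\<omega>\<in>space M. a m < \<bar>D m k \<omega>\<bar>} \<in> sets M" if "k < 2 ^ m" for m k
    using Dm[OF that] by measurable
  have Es: "E m \<in> sets M" for m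
    unfolding E_def using Em by (intro sets.finite_UN) auto
  have incl: "AE \<omega> in M. u < norm (V \<omega>) \<longrightarrow> \<omega> \<in> (\<Union>m. E m)"
  proof -
    have v: "AE \<omega> in M. \<forall>t\<in>{0..1}. V \<omega> (to_unit t) = W t \<omega>" and w: "AE \<omega> in M. W 0 \<omega> = 0"
      using V T by (auto simp: bm_version_def standard_brownian_motion_def)
    from v w AE_space show ?thesis
    proof eventually_elim
      case (elim \<omega>)
      show ?case
      proof (rule impI, rule ccontr)
        assume nu: "u < norm (V \<omega>)" and n: "\<omega> \<notin> (\<Union>m. E m)"
        have "norm (V \<omega>) \<le> u"
        proof (rule norm_le_of_dyadic_increments)
          show "V \<omega> (to_unit 0) = 0" using elim by simp
          fix m k :: nat assume k: "k < 2 ^ m"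
          have "V \<omega> (node m (Suc k)) - V \<omega> (node m k) = D m k \<omega>"
            unfolding D_def node_def using elim(1) node_mem[of k m] node_mem[of "Suc k" m] k by simp
          moreover have "\<bar>D m k \<omega>\<bar> \<le> a m"
            using n k elim(3) unfolding E_def by (auto simp: not_less)
          ultimately show "\<bar>V \<omega> (node m (Suc k)) - V \<omega> (node m k)\<bar> \<le> u / 4 * (3 / 4) ^ m"
            by (simp add: a_def)
        qed (use u in auto)
        with nu show False by simp
      qed
    qed
  qed
  have e: "exp (- (u\<^sup>2 / 512)) \<le> 1 / 4"
  proof -
    have "(32::real)\<^sup>2 \<le> u\<^sup>2" using u by (intro power_mono) auto
    then have "- (u\<^sup>2 / 512) \<le> - 2" by simp
    then have "exp (- (u\<^sup>2 / 512)) \<le> exp (- 2)" by simp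
    also have "exp (- 2 :: real) = inverse ((exp 1)\<^sup>2)"
      by (simp add: exp_minus exp_double[of 1, simplified, symmetric])
    also have "\<dots> \<le> inverse (2\<^sup>2)"
      using exp_ge_add_one_self[of "1::real"] by (intro le_imp_inverse_le power_mono) auto
    finally show ?thesis by simp
  qed
  have Eb: "emeasure M (E m) \<le> ennreal (2 * exp (- (u\<^sup>2 / 64)) * (1 / 2) ^ m)" for m
  proof -
    have "emeasure M (E m) \<le> (\<Sum>k<2^m. emeasure M {\<omega>\<in>space M. a m < \<bar>D m k \<omega>\<bar>})"
      unfolding E_def by (rule emeasure_subadditive_finite) (use Em in auto)
    also have "\<dots> \<le> (\<Sum>k<(2::nat)^m. ennreal (2 * exp (- ((a m)\<^sup>2 / (4 * (sqrt (1 / 2 ^ m))\<^sup>2)))))"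
    proof (rule sum_mono)
      fix k :: nat assume "k \<in> {..<2^m}"
      then show "emeasure M {\<omega>\<in>space M. a m < \<bar>D m k \<omega>\<bar>}
          \<le> ennreal (2 * exp (- ((a m)\<^sup>2 / (4 * (sqrt (1 / 2 ^ m))\<^sup>2))))"
        unfolding D_def
        by (intro gaussian_tail bm_increment[OF T(2,1)]) (use u in \<open>auto simp: a_def\<close>)
    qed
    also have "\<dots> = ennreal (2 ^ m * (2 * exp (- ((a m)\<^sup>2 / (4 * (sqrt (1 / 2 ^ m))\<^sup>2)))))"
      by (simp add: ennreal_mult'[symmetric] ennreal_of_nat_eq_real_of_nat)
    also have "\<dots> \<le> ennreal (2 * exp (- (u\<^sup>2 / 64)) * (1 / 2) ^ m)"
    proof (rule ennreal_leI)
      have "(a m)\<^sup>2 / (4 * (sqrt (1 / 2 ^ m))\<^sup>2) = u\<^sup>2 / 64 * (9 / 8) ^ m"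
      proof -
        have "((3 / 4 :: real) ^ m)\<^sup>2 * 2 ^ m = (((3 / 4)\<^sup>2) * 2) ^ m"
          by (simp only: power_mult_distrib power_mult[symmetric] mult.commute)
        also have "((3 / 4 :: real)\<^sup>2) * 2 = 9 / 8" by (simp add: power2_eq_square)
        finally show ?thesis by (simp add: a_def power_mult_distrib power_divide field_simps)
      qed
      \<comment> \<open>Bernoulli's inequality turns the double exponential decay into a geometric one.\<close>
      moreover have "1 + real m * (1/8) \<le> (1 + 1 / 8 :: real) ^ m" by (rule Bernoulli_inequality) simp
      then have "u\<^sup>2 / 64 * (1 + real m * (1/8)) \<le> u\<^sup>2 / 64 * (9 / 8) ^ m"
        by (intro mult_left_mono) auto
      ultimately have "exp (- ((a m)\<^sup>2 / (4 * (sqrt (1 / 2 ^ m))\<^sup>2)))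
          \<le> exp (- (u\<^sup>2 / 64) + real m * (- (u\<^sup>2 / 512)))"
        by (simp add: algebra_simps)
      also have "\<dots> = exp (- (u\<^sup>2 / 64)) * exp (- (u\<^sup>2 / 512)) ^ m"
        unfolding exp_add by (simp add: exp_of_nat_mult[symmetric])
      also have "\<dots> \<le> exp (- (u\<^sup>2 / 64)) * (1 / 4) ^ m"
        by (intro mult_left_mono power_mono e) auto
      finally have "2 ^ m * (2 * exp (- ((a m)\<^sup>2 / (4 * (sqrt (1 / 2 ^ m))\<^sup>2))))
        \<le> 2 ^ m * (2 * (exp (- (u\<^sup>2 / 64)) * (1 / 4) ^ m))"
        by simp
      also have "\<dots> = 2 * exp (- (u\<^sup>2 / 64)) * (2 * (1 / 4)) ^ m"
        unfolding power_mult_distrib by simp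
      finally show "2 ^ m * (2 * exp (- ((a m)\<^sup>2 / (4 * (sqrt (1 / 2 ^ m))\<^sup>2))))
        \<le> 2 * exp (- (u\<^sup>2 / 64)) * (1 / 2) ^ m" by simp
    qed
    finally show ?thesis .
  qed
  have "emeasure M {\<omega>\<in>space M. u < norm (V \<omega>)} \<le> emeasure M (\<Union>m. E m)"
    by (rule emeasure_mono_AE) (use incl Es in auto)
  also have "\<dots> \<le> (\<Sum>m. emeasure M (E m))"
    by (rule emeasure_subadditive_countably) (use Es in auto)
  also have "\<dots> \<le> (\<Sum>m. ennreal (2 * exp (- (u\<^sup>2 / 64)) * (1 / 2) ^ m))"
    by (intro suminf_le Eb) auto
  also have "\<dots> = ennreal (2 * exp (- (u\<^sup>2 / 64)) * 2)"
  proof (rule suminf_ennreal_eq)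
    show "(\<lambda>m. 2 * exp (- (u\<^sup>2 / 64)) * (1 / 2) ^ m) sums (2 * exp (- (u\<^sup>2 / 64)) * 2)"
      using geometric_sums[of "1/2::real"] by (intro sums_mult) simp
  qed simp
  finally show ?thesis by simp
qed

lemma bm_exp_norm_finite:
  assumes V: "bm_version M W V"
  shows "(\<integral>\<^sup>+\<omega>. ennreal (exp (norm (V \<omega>))) \<partial>M) < \<infinity>"
proof -
  interpret prob_space M using V by (simp add: bm_version_def)
  have [measurable]: "V \<in> borel_measurable M" using V by (simp add: bm_version_def)
  define A where "A k = {\<omega>\<in>space M. real k < norm (V \<omega>)}" for k :: nat
  have [measurable]: "A k \<in> sets M" for k unfolding A_def by measurable
  define g where "g k = exp (real k + 1) * prob (A k)" for k :: nat
  have "summable g"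
  proof (rule summable_comparison_test_ev)
    show "summable (\<lambda>k. (4 * exp 1) * (exp (- 1 :: real)) ^ k)"
      by (intro summable_mult summable_geometric) simp
    show "\<forall>\<^sub>F k in sequentially. norm (g k) \<le> (4 * exp 1) * (exp (- 1)) ^ k"
    proof (rule eventually_sequentiallyI[of 128])
      fix k :: nat assume k: "128 \<le> k"
      have "emeasure M (A k) \<le> ennreal (4 * exp (- ((real k)\<^sup>2 / 64)))"
        unfolding A_def by (rule bm_norm_tail[OF V]) (use k in simp)
      then have "prob (A k) \<le> 4 * exp (- ((real k)\<^sup>2 / 64))"
        by (simp add: emeasure_eq_measure)
      also have "\<dots> \<le> 4 * exp (- (2 * real k))"
        using k by (simp add: power2_eq_square)
      finally have "g k \<le> exp (real k + 1) * (4 * exp (- (2 * real k)))"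
        unfolding g_def by (intro mult_left_mono) auto
      also have "\<dots> = (4 * exp 1) * exp (real k * (- 1))"
        by (simp add: mult.assoc[symmetric] mult.commute[of _ 4]) (simp add: mult.assoc exp_add[symmetric])
      finally show "norm (g k) \<le> (4 * exp 1) * (exp (- 1)) ^ k"
        unfolding exp_of_nat_mult by (simp add: g_def)
    qed
  qed
  have pt: "ennreal (exp x) \<le> 1 + (\<Sum>k. ennreal (exp (real k + 1)) * indicator {real k<..} x)"
    if "0 \<le> x" for x
  proof (cases "x = 0")
    case False
    define k where "k = nat (\<lceil>x\<rceil> - 1)"
    have k: "real k < x" "x \<le> real k + 1"
      using that False unfolding k_def by linarith+
    define h where "h k = ennreal (exp (real k + 1)) * indicator {real k<..} x" for k
    have "ennreal (exp x) \<le> h k"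
      using k by (simp add: ennreal_leI h_def)
    also have "h k \<le> (\<Sum>k. h k)"
      using sum_le_suminf[of h "{k}"] by simp
    also have "\<dots> = (\<Sum>k. ennreal (exp (real k + 1)) * indicator {real k<..} x)"
      by (simp only: h_def)
    finally show ?thesis by (simp add: add_increasing)
  qed simp
  have "(\<integral>\<^sup>+\<omega>. ennreal (exp (norm (V \<omega>))) \<partial>M)
      \<le> (\<integral>\<^sup>+\<omega>. 1 + (\<Sum>k. ennreal (exp (real k + 1)) * indicator (A k) \<omega>) \<partial>M)"
  proof (rule nn_integral_mono)
    fix \<omega> assume "\<omega> \<in> space M"
    then have "indicator {real k<..} (norm (V \<omega>)) = (indicator (A k) \<omega> :: ennreal)" for k
      by (simp add: A_def indicator_def)
    then show "ennreal (exp (norm (V \<omega>))) \<le> 1 + (\<Sum>k. ennreal (exp (real k + 1)) * indicator (A k) \<omega>)"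
      using pt[of "norm (V \<omega>)"] by simp
  qed
  also have "\<dots> = 1 + (\<Sum>k. ennreal (exp (real k + 1)) * emeasure M (A k))"
    by (simp add: nn_integral_add nn_integral_suminf nn_integral_cmult emeasure_space_1)
  also have "(\<Sum>k. ennreal (exp (real k + 1)) * emeasure M (A k)) = (\<Sum>k. ennreal (g k))"
    by (simp add: g_def ennreal_mult' emeasure_eq_measure)
  also have "1 + \<dots> < \<infinity>"
  proof -
    have "(\<Sum>k. ennreal (g k)) \<noteq> top"
      by (rule ennreal_suminf_neq_top[OF \<open>summable g\<close>]) (simp add: g_def)
    then show ?thesis by (simp only: less_top[symmetric] ennreal_add_eq_top infinity_ennreal_def ennreal_one_neq_top simp_thms)
  qed
  finally show ?thesis .
qed

text \<open>Up to a null set the values at the grid are the partial sums of the increments, and these are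
  independent with known normal laws; so the law of the interpolated path does not depend on the
  probability space.\<close>

lemma bm_grid_law:
  assumes V: "bm_version M W V"
  shows "distr M borel (\<lambda>\<omega>. project m (V \<omega>)) =
    distr (\<Pi>\<^sub>M j\<in>{..<2^m}. density lborel (\<lambda>x. ennreal (normal_density 0 (sqrt (1 / 2 ^ m)) x)))
      borel (\<lambda>x. interp m (\<lambda>k. \<Sum>j<k. x j))"
proof -
  interpret prob_space M using V by (simp add: bm_version_def)
  have Vm [measurable]: "V \<in> borel_measurable M" using V by (simp add: bm_version_def)
  obtain T where T: "{0..1} \<subseteq> T" "standard_brownian_motion M T W"
    using V by (auto simp: bm_version_def)
  define D where "D j \<omega> = W (real (Suc j) / 2 ^ m) \<omega> - W (real j / 2 ^ m) \<omega>" for j \<omega>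
  let ?\<gamma> = "density lborel (\<lambda>x. ennreal (normal_density 0 (sqrt (1 / 2 ^ m)) x))"
  let ?I = "{..<(2::nat)^m}"
  have Dm: "D j \<in> borel_measurable M" if "j \<in> ?I" for j
    using distributed_measurable[OF bm_increment[OF T(2,1), of j m]] that by (simp add: D_def[abs_def])
  have Dlaw: "distr M borel (D j) = ?\<gamma>" if "j \<in> ?I" for j
  proof -
    have "distr M lborel (D j) = ?\<gamma>"
      using distributed_distr_eq_density[OF bm_increment[OF T(2,1), of j m]] that
      by (simp add: D_def[abs_def])
    then show ?thesis by (simp cong: distr_cong)
  qed
  have ind: "indep_vars (\<lambda>_. borel) D ?I"
  proof -
    have incr: "\<forall>k. \<forall>t :: nat \<Rightarrow> real. (\<forall>j\<le>k. t j \<in> T) \<and> (\<forall>j<k. t j \<le> t (Suc j)) \<longrightarrow>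
      indep_vars (\<lambda>_. borel) (\<lambda>j \<omega>. W (t (Suc j)) \<omega> - W (t j) \<omega>) {..<k}"
      using T(2) unfolding standard_brownian_motion_def by (elim conjE)
    have "\<forall>j\<le>2^m. real j / 2 ^ m \<in> T" using node_mem T(1) by blast
    moreover have "\<forall>j<2^m. real j / 2 ^ m \<le> real (Suc j) / 2 ^ m" by (simp add: divide_right_mono)
    ultimately show ?thesis
      unfolding D_def[abs_def] by (intro mp[OF spec[OF spec[OF incr, of "2^m"], of "\<lambda>j. real j / 2 ^ m"]] conjI)
  qed
  have joint: "distr M (\<Pi>\<^sub>M j\<in>?I. borel) (\<lambda>\<omega>. \<lambda>j\<in>?I. D j \<omega>) = (\<Pi>\<^sub>M j\<in>?I. ?\<gamma>)"
  proof -
    have "distr M (\<Pi>\<^sub>M j\<in>?I. borel) (\<lambda>\<omega>. \<lambda>j\<in>?I. D j \<omega>) = (\<Pi>\<^sub>M j\<in>?I. distr M borel (D j))"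
    proof (rule iffD1[OF indep_vars_iff_distr_eq_PiM'[of ?I D "\<lambda>_. borel"], OF _ _ ind])
      show "?I \<noteq> {}" by (simp add: lessThan_empty_iff)
    qed (rule Dm)
    also have "\<dots> = (\<Pi>\<^sub>M j\<in>?I. ?\<gamma>)" by (rule PiM_cong) (use Dlaw in auto)
    finally show ?thesis .
  qed
  have im: "(\<lambda>x. interp m (\<lambda>k. \<Sum>j<k. x j)) \<in> borel_measurable (\<Pi>\<^sub>M j\<in>?I. borel)"
    by (rule measurable_interp, rule borel_measurable_sum) (auto intro!: measurable_component_singleton)
  have v: "AE \<omega> in M. \<forall>t\<in>{0..1}. V \<omega> (to_unit t) = W t \<omega>" and w: "AE \<omega> in M. W 0 \<omega> = 0"
    using V T by (auto simp: bm_version_def standard_brownian_motion_def)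
  have "AE \<omega> in M. project m (V \<omega>) = interp m (\<lambda>k. \<Sum>j<k. (\<lambda>j\<in>?I. D j \<omega>) j)"
    using v w
  proof eventually_elim
    case (elim \<omega>)
    have "V \<omega> (node m k) = (\<Sum>j<k. (\<lambda>j\<in>?I. D j \<omega>) j)" if "k \<le> 2 ^ m" for k
    proof -
      have "(\<Sum>j<k. (\<lambda>j\<in>?I. D j \<omega>) j) = (\<Sum>j<k. W (real (Suc j) / 2 ^ m) \<omega> - W (real j / 2 ^ m) \<omega>)"
        using that by (intro sum.cong) (auto simp: D_def)
      also have "\<dots> = W (real k / 2 ^ m) \<omega>"
        using elim(2) by (subst sum_lessThan_telescope[of "\<lambda>j. W (real j / 2 ^ m) \<omega>"]) simp
      finally show ?thesis using elim(1) node_mem[OF that] by (simp add: node_def)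
    qed
    then show ?case unfolding project_def interp_def by simp
  qed
  then have "distr M borel (\<lambda>\<omega>. project m (V \<omega>)) =
      distr M borel (\<lambda>\<omega>. interp m (\<lambda>k. \<Sum>j<k. (\<lambda>j\<in>?I. D j \<omega>) j))"
    by (intro distr_cong_AE) (auto intro!: measurable_interp borel_measurable_sum Dm)
  also have "\<dots> = distr (distr M (\<Pi>\<^sub>M j\<in>?I. borel) (\<lambda>\<omega>. \<lambda>j\<in>?I. D j \<omega>)) borel
      (\<lambda>x. interp m (\<lambda>k. \<Sum>j<k. x j))"
    by (subst distr_distr[OF im]) (auto simp: comp_def intro!: measurable_restrict Dm)
  also have "\<dots> = distr (\<Pi>\<^sub>M j\<in>?I. ?\<gamma>) borel (\<lambda>x. interp m (\<lambda>k. \<Sum>j<k. x j))"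
    unfolding joint ..
  finally show ?thesis .
qed

text \<open>Let the mesh of the grid tend to zero in \<open>bm_grid_law\<close>.\<close>

theorem bm_law_unique:
  assumes V: "bm_version M W V" and V': "bm_version M' W' V'"
  shows "distr M borel V = distr M' borel V'"
proof (rule measure_eq_by_bounded_lipschitz)
  interpret M: prob_space M using V by (simp add: bm_version_def)
  interpret M': prob_space M' using V' by (simp add: bm_version_def)
  have Vm [measurable]: "V \<in> borel_measurable M" "V' \<in> borel_measurable M'"
    using V V' by (simp_all add: bm_version_def)
  show "prob_space (distr M borel V)" "prob_space (distr M' borel V')"
    by (auto intro: M.prob_space_distr M'.prob_space_distr)
  fix F :: "C01 \<Rightarrow> real" assume F: "bounded_lipschitz F"
  have [measurable]: "F \<in> borel_measurable borel" by (rule bounded_lipschitz_measurable[OF F])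
  obtain b where b: "\<And>x. \<bar>F x\<bar> \<le> b" using bounded_lipschitzE[OF F] by metis
  have lim: "(\<lambda>m. \<integral>z. F z \<partial>distr \<Omega> borel (\<lambda>\<omega>. project m (U \<omega>))) \<longlonglongrightarrow> (\<integral>z. F z \<partial>distr \<Omega> borel U)"
    if "prob_space \<Omega>" and [measurable]: "U \<in> borel_measurable \<Omega>" for \<Omega> :: "'w measure" and U
  proof -
    interpret prob_space \<Omega> by fact
    have "(\<lambda>m. \<integral>\<omega>. F (project m (U \<omega>)) \<partial>\<Omega>) \<longlonglongrightarrow> (\<integral>\<omega>. F (U \<omega>) \<partial>\<Omega>)"
    proof (rule integral_dominated_convergence[where w="\<lambda>_. b"])
      have "(\<lambda>m. F (project m z)) \<longlonglongrightarrow> F z" for z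
        using bounded_lipschitz_continuous[OF F] project_tendsto[of z]
        by (rule continuous_on_tendsto_compose) auto
      then show "AE \<omega> in \<Omega>. (\<lambda>m. F (project m (U \<omega>))) \<longlonglongrightarrow> F (U \<omega>)" by simp
    qed (use b in auto)
    then show ?thesis by (simp add: integral_distr)
  qed
  show "(\<integral>z. F z \<partial>distr M borel V) = (\<integral>z. F z \<partial>distr M' borel V')"
    using lim[OF M.prob_space_axioms Vm(1)] lim[OF M'.prob_space_axioms Vm(2)]
    unfolding bm_grid_law[OF V] bm_grid_law[OF V'] by (rule LIMSEQ_unique)
qed auto

section \<open>The Laplace functional of a Poisson process\<close>

text \<open>The function \<open>exp (- x)\<close> on \<open>[0, \<infinity>]\<close>. With the value \<open>0\<close> at \<open>\<infinity>\<close> it is continuous and turns sums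
  into products, also when infinitely many points or a vanishing factor are involved.\<close>

definition nexp :: "ennreal \<Rightarrow> ennreal" where
  "nexp x = (if x = \<infinity> then 0 else ennreal (exp (- enn2real x)))"

lemma nexp_ennreal: "0 \<le> r \<Longrightarrow> nexp (ennreal r) = ennreal (exp (- r))"
  by (simp add: nexp_def)

lemma nexp_top [simp]: "nexp top = 0" by (simp add: nexp_def)

lemma nexp_0 [simp]: "nexp 0 = 1" by (simp add: nexp_def)

lemma nexp_le_1: "nexp x \<le> 1"
  by (simp add: nexp_def)

lemma nexp_neq_top [simp]: "nexp x \<noteq> top"
  by (simp add: nexp_def)

lemma nexp_add: "nexp (a + b) = nexp a * nexp b"
proof (cases "a = top \<or> b = top")
  case True then show ?thesis by (auto simp: nexp_def)
next
  case False
  then obtain r s where "0 \<le> r" "a = ennreal r" "0 \<le> s" "b = ennreal s"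
    by (metis ennreal_cases)
  moreover have "exp (- (r + s)) = exp (- r) * exp (- s)"
    by (simp add: exp_add[symmetric])
  ultimately show ?thesis
    by (simp add: nexp_ennreal ennreal_plus[symmetric] ennreal_mult[symmetric] del: ennreal_plus)
qed

lemma nexp_sum: "nexp (\<Sum>i\<in>I. f i) = (\<Prod>i\<in>I. nexp (f i))"
  by (induction I rule: infinite_finite_induct) (auto simp: nexp_add)

lemma nexp_antimono: "a \<le> b \<Longrightarrow> nexp b \<le> nexp a"
proof -
  assume "a \<le> b"
  then obtain c where "b = a + c" by (auto simp: le_iff_add)
  then show ?thesis using mult_left_mono[OF nexp_le_1[of c], of "nexp a"] by (simp add: nexp_add)
qed

lemma nexp_tendsto:
  assumes "(f \<longlongrightarrow> l) F"
  shows "((\<lambda>x. nexp (f x)) \<longlongrightarrow> nexp l) F"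
proof (cases "l = top")
  case True
  show ?thesis unfolding True nexp_top
  proof (rule order_tendstoI)
    fix a :: ennreal assume "0 < a"
    then obtain r where r: "0 < r" "ennreal r < a"
      by (metis dense ennreal_cases ennreal_less_zero_iff not_less_zero infinity_ennreal_def top.extremum_strict)
    have "nexp (ennreal (max 0 (- ln r))) \<le> ennreal r"
      using r(1) by (subst nexp_ennreal) (auto simp: max_def intro!: ennreal_leI)
    moreover have "\<forall>\<^sub>F x in F. ennreal (max 0 (- ln r)) < f x"
      using assms by (rule order_tendstoD) (simp add: True)
    ultimately show "\<forall>\<^sub>F x in F. nexp (f x) < a"
      by (auto elim!: eventually_mono) (meson nexp_antimono less_imp_le le_less_trans order_trans r(2))
  qed simp
next
  case False
  have l: "(f \<longlongrightarrow> ennreal (enn2real l)) F" using assms False by (simp add: less_top)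
  have "\<forall>\<^sub>F x in F. f x < top"
    using assms by (rule order_tendstoD) (use False in \<open>simp add: less_top\<close>)
  then have "\<forall>\<^sub>F x in F. ennreal (exp (- enn2real (f x))) = nexp (f x)"
    by eventually_elim (simp add: nexp_def)
  moreover have "((\<lambda>x. ennreal (exp (- enn2real (f x)))) \<longlongrightarrow> ennreal (exp (- enn2real l))) F"
    by (intro tendsto_ennrealI tendsto_exp tendsto_minus tendsto_enn2real l) simp
  ultimately show ?thesis
    using False by (auto simp: nexp_def intro: Lim_transform_eventually)
qed

lemma nexp_measurable [measurable]: "nexp \<in> borel_measurable borel"
  unfolding nexp_def by measurable

text \<open>Every \<open>p \<le> 1\<close> is of the form \<open>nexp h\<close>; hence a product of probabilities is the exponential of a sum.\<close>

lemma nexp_surj: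
  assumes "p \<le> 1"
  shows "nexp (if p = 0 then top else ennreal (- ln (enn2real p))) = p"
proof (cases "p = 0")
  case False
  then obtain r where r: "p = ennreal r" "0 < r" "r \<le> 1"
    using assms by (cases p) (auto simp: top_unique)
  then show ?thesis using False by (simp add: nexp_ennreal)
qed simp

locale poisson_process = prob_space N for N :: "'b measure" +
  fixes \<mu> :: "real measure" and X :: "nat \<Rightarrow> 'b \<Rightarrow> real"
  assumes poisson: "poisson_points N \<mu> X"
    and sets_\<mu>: "sets \<mu> = sets borel"
    and sigma_finite_\<mu>: "sigma_finite_measure \<mu>"
begin

lemma X_measurable [measurable]: "X i \<in> borel_measurable N"
  using poisson by (simp add: poisson_points_def)

lemma space_\<mu>: "space \<mu> = UNIV"
  using sets_eq_imp_space_eq[OF sets_\<mu>] by simp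

lemma measurable_\<mu>: "h \<in> borel_measurable borel \<Longrightarrow> h \<in> borel_measurable \<mu>"
  using measurable_cong_sets[OF sets_\<mu> refl] by blast

lemma point_count_measurable [measurable]:
  "A \<in> sets borel \<Longrightarrow> point_count X A \<in> borel_measurable N"
  unfolding point_count_def[abs_def]
  by (intro borel_measurable_suminf_order measurable_compose[OF X_measurable] borel_measurable_indicator)

lemma count_prob:
  assumes "A \<in> sets borel" "emeasure \<mu> A < \<infinity>"
  shows "emeasure N {\<omega>\<in>space N. point_count X A \<omega> = of_nat k} =
    ennreal (measure \<mu> A ^ k / fact k * exp (- measure \<mu> A))"
  using poisson assms unfolding poisson_points_def by (simp add: emeasure_eq_measure)

text \<open>Up to a null set the count is a natural number, as its point probabilities add up to one.\<close>

lemma count_integral: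
  fixes g :: "ennreal \<Rightarrow> ennreal"
  assumes A: "A \<in> sets borel" "emeasure \<mu> A < \<infinity>"
  shows "(\<integral>\<^sup>+\<omega>. g (point_count X A \<omega>) \<partial>N) =
    (\<Sum>k. g (of_nat k) * ennreal (measure \<mu> A ^ k / fact k * exp (- measure \<mu> A)))"
proof -
  define l where "l = measure \<mu> A"
  define E where "E k = {\<omega>\<in>space N. point_count X A \<omega> = of_nat k}" for k :: nat
  have Es [measurable]: "E k \<in> sets N" for k
    unfolding E_def using A by measurable
  have disj: "disjoint_family E"
    unfolding disjoint_family_on_def E_def by auto
  have "(\<lambda>k. l ^ k / fact k * exp (- l)) sums (exp l * exp (- l))"
    using exp_converges[of l] by (intro sums_mult2) (simp add: field_simps scaleR_conv_of_real)
  then have s: "(\<Sum>k. ennreal (l ^ k / fact k * exp (- l))) = 1"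
    by (subst suminf_ennreal_eq[where x=1]) (auto simp: exp_minus_inverse l_def)
  have "emeasure N (\<Union>k. E k) = (\<Sum>k. emeasure N (E k))"
    by (rule suminf_emeasure[symmetric]) (use disj Es in auto)
  also have "\<dots> = 1"
    unfolding E_def count_prob[OF A] s[unfolded l_def] ..
  finally have "prob (\<Union>k. E k) = 1" by (simp add: emeasure_eq_measure)
  then have "AE \<omega> in N. \<omega> \<in> (\<Union>k. E k)"
    by (subst AE_in_set_eq_1) auto
  then have "(\<integral>\<^sup>+\<omega>. g (point_count X A \<omega>) \<partial>N) = (\<integral>\<^sup>+\<omega>. (\<Sum>k. g (of_nat k) * indicator (E k) \<omega>) \<partial>N)"
  proof (intro nn_integral_cong_AE, eventually_elim)
    fix \<omega> assume "\<omega> \<in> (\<Union>k. E k)"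
    then obtain n where n: "\<omega> \<in> E n" by blast
    have z: "indicator (E k) \<omega> = (0::ennreal)" if "k \<notin> {n}" for k
      using n that by (auto simp: E_def indicator_def)
    have "(\<Sum>k. g (of_nat k) * indicator (E k) \<omega>) = (\<Sum>k\<in>{n}. g (of_nat k) * indicator (E k) \<omega>)"
      by (rule suminf_finite[OF _ _]) (simp, subst z, simp_all)
    also have "\<dots> = g (point_count X A \<omega>)"
      using n by (simp add: E_def)
    finally show "g (point_count X A \<omega>) = (\<Sum>k. g (of_nat k) * indicator (E k) \<omega>)"
      by (rule sym)
  qed
  also have "\<dots> = (\<Sum>k. \<integral>\<^sup>+\<omega>. g (of_nat k) * indicator (E k) \<omega> \<partial>N)"
    by (rule nn_integral_suminf) measurable
  also have "\<dots> = (\<Sum>k. g (of_nat k) * emeasure N (E k))"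
    by (simp only: nn_integral_cmult_indicator Es)
  finally show ?thesis unfolding E_def count_prob[OF A] .
qed

lemma count_mean:
  assumes A: "A \<in> sets borel" "emeasure \<mu> A < \<infinity>"
  shows "(\<integral>\<^sup>+\<omega>. point_count X A \<omega> \<partial>N) = emeasure \<mu> A"
proof -
  define l where "l = measure \<mu> A"
  have l0: "0 \<le> l" by (simp add: l_def)
  have "(\<lambda>k. l ^ k / fact k * (exp (- l) * l)) sums (exp l * (exp (- l) * l))"
    using exp_converges[of l] by (intro sums_mult2) (simp add: field_simps scaleR_conv_of_real)
  moreover have "l ^ k / fact k * (exp (- l) * l) = real (Suc k) * (l ^ Suc k / fact (Suc k) * exp (- l))" for k
  proof -
    have "real (Suc k) / fact (Suc k) = 1 / fact k"
      unfolding fact_Suc of_nat_mult by (rule nonzero_divide_mult_cancel_left) simp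
    then have "real (Suc k) * (l ^ Suc k / fact (Suc k) * exp (- l)) = (1 / fact k) * (l ^ Suc k * exp (- l))"
      by (metis (no_types, lifting) mult.assoc mult.commute times_divide_eq_left)
    then show ?thesis by simp
  qed
  ultimately have "(\<lambda>k. real (Suc k) * (l ^ Suc k / fact (Suc k) * exp (- l))) sums (exp l * (exp (- l) * l))"
    by (simp only:)
  then have "(\<lambda>k. real k * (l ^ k / fact k * exp (- l))) sums
      (exp l * (exp (- l) * l) + real 0 * (l ^ 0 / fact 0 * exp (- l)))"
    by (subst sums_Suc_iff[symmetric]) simp
  also have "exp l * (exp (- l) * l) + real 0 * (l ^ 0 / fact 0 * exp (- l)) = l"
    by (subst mult.assoc[symmetric]) (simp add: exp_minus_inverse)
  finally have "(\<Sum>k. ennreal (real k * (l ^ k / fact k * exp (- l)))) = ennreal l"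
    by (intro suminf_ennreal_eq) (use l0 in auto)
  moreover have "ennreal (real k * (l ^ k / fact k * exp (- l))) = of_nat k * ennreal (l ^ k / fact k * exp (- l))" for k
    by (subst ennreal_mult) (use l0 in \<open>auto simp: ennreal_of_nat_eq_real_of_nat\<close>)
  ultimately have "(\<Sum>k. of_nat k * ennreal (l ^ k / fact k * exp (- l))) = ennreal l"
    by (simp only:)
  then show ?thesis
    using A count_integral[OF A, of "\<lambda>x. x"] emeasure_eq_ennreal_measure[of \<mu> A] unfolding l_def
    by (simp add: less_top)
qed

text \<open>Both sides are measures applied to \<open>h\<close>; for indicators of sets of infinite measure the set is
  exhausted by sets of finite measure.\<close>

lemma campbell:
  assumes "h \<in> borel_measurable borel"
  shows "(\<integral>\<^sup>+\<omega>. (\<Sum>i. h (X i \<omega>)) \<partial>N) = (\<integral>\<^sup>+x. h x \<partial>\<mu>)"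
  using assms
proof (induction rule: borel_measurable_induct)
  case (cong f g)
  then show ?case by (simp add: space_\<mu> fun_eq_iff[symmetric])
next
  case (set A)
  interpret \<mu>: sigma_finite_measure \<mu> by (rule sigma_finite_\<mu>)
  obtain S where S: "range S \<subseteq> sets \<mu>" "(\<Union>i. S i) = space \<mu>" "\<And>i. emeasure \<mu> (S i) \<noteq> \<infinity>" "incseq S"
    using \<mu>.sigma_finite_incseq by blast
  have [measurable]: "A \<in> sets borel" "S k \<in> sets borel" for k using set S(1) sets_\<mu> by auto
  have [measurable]: "A \<in> sets \<mu>" "S k \<in> sets \<mu>" for k using set S(1) sets_\<mu> by auto
  have inc: "incseq (\<lambda>k. indicator (A \<inter> S k) x :: ennreal)" for x
    using S(4) by (auto simp: incseq_def indicator_def)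
  have sup: "(SUP k. indicator (A \<inter> S k) x :: ennreal) = indicator A x" for x
  proof -
    obtain k where "x \<in> S k" using S(2) space_\<mu> by auto
    then have "indicator A x \<le> (SUP k. indicator (A \<inter> S k) x :: ennreal)"
      by (intro SUP_upper2[of k]) (auto simp: indicator_def)
    then show ?thesis by (intro antisym SUP_least) (auto simp: indicator_def)
  qed
  have "(\<integral>\<^sup>+\<omega>. (\<Sum>i. indicator A (X i \<omega>)) \<partial>N) = (\<integral>\<^sup>+\<omega>. (SUP k. point_count X (A \<inter> S k) \<omega>) \<partial>N)"
    unfolding point_count_def sup[symmetric] by (subst ennreal_suminf_SUP_eq) (auto intro: inc)
  also have "\<dots> = (SUP k. \<integral>\<^sup>+\<omega>. point_count X (A \<inter> S k) \<omega> \<partial>N)"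
  proof (rule nn_integral_monotone_convergence_SUP)
    show "incseq (\<lambda>k. point_count X (A \<inter> S k))"
      unfolding point_count_def incseq_def le_fun_def
      using inc by (auto intro!: suminf_le simp: incseq_def)
  qed measurable
  also have "\<dots> = (SUP k. emeasure \<mu> (A \<inter> S k))"
  proof (intro SUP_cong refl count_mean)
    fix k
    have "emeasure \<mu> (A \<inter> S k) \<le> emeasure \<mu> (S k)" by (rule emeasure_mono) auto
    also have "\<dots> < \<infinity>" using S(3)[of k] by (simp add: less_top[symmetric])
    finally show "emeasure \<mu> (A \<inter> S k) < \<infinity>" .
  qed measurable
  also have "\<dots> = emeasure \<mu> (\<Union>k. A \<inter> S k)"
    by (rule SUP_emeasure_incseq) (use S(4) in \<open>auto simp: incseq_def\<close>)
  also have "(\<Union>k. A \<inter> S k) = A" using S(2) space_\<mu> by auto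
  finally show ?case by simp
next
  case (mult u c)
  then have [measurable]: "u \<in> borel_measurable borel" by simp
  have "(\<integral>\<^sup>+\<omega>. (\<Sum>i. c * u (X i \<omega>)) \<partial>N) = c * (\<integral>\<^sup>+\<omega>. (\<Sum>i. u (X i \<omega>)) \<partial>N)"
    using mult(2) by (simp add: nn_integral_cmult)
  also have "\<dots> = (\<integral>\<^sup>+x. c * u x \<partial>\<mu>)"
    unfolding mult(4) by (rule nn_integral_cmult[symmetric]) (rule measurable_\<mu>, measurable)
  finally show ?case .
next
  case (add u v)
  note [measurable] = add.hyps(1,3)
  have "(\<Sum>i. v (X i \<omega>) + u (X i \<omega>)) = (\<Sum>i. v (X i \<omega>)) + (\<Sum>i. u (X i \<omega>))" for \<omega>
    by (rule suminf_add[symmetric]) auto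
  then have "(\<integral>\<^sup>+\<omega>. (\<Sum>i. v (X i \<omega>) + u (X i \<omega>)) \<partial>N) =
      (\<integral>\<^sup>+\<omega>. (\<Sum>i. v (X i \<omega>)) \<partial>N) + (\<integral>\<^sup>+\<omega>. (\<Sum>i. u (X i \<omega>)) \<partial>N)"
    by (simp only:)
      (intro nn_integral_add borel_measurable_suminf_order measurable_compose[OF X_measurable] add.hyps)
  also have "\<dots> = (\<integral>\<^sup>+x. v x + u x \<partial>\<mu>)"
    unfolding add.IH by (rule nn_integral_add[symmetric]) (rule measurable_\<mu>, measurable)+
  finally show ?case .
next
  case (seq U)
  note [measurable] = seq.hyps(1)
  have iU: "incseq (\<lambda>k. U k x)" for x using \<open>incseq U\<close> by (auto simp: incseq_def le_fun_def)
  have "(\<integral>\<^sup>+\<omega>. (\<Sum>i. (SUP k. U k) (X i \<omega>)) \<partial>N) = (\<integral>\<^sup>+\<omega>. (SUP k. \<Sum>i. U k (X i \<omega>)) \<partial>N)"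
    unfolding SUP_apply by (subst ennreal_suminf_SUP_eq) (auto intro: iU)
  also have "\<dots> = (SUP k. \<integral>\<^sup>+\<omega>. (\<Sum>i. U k (X i \<omega>)) \<partial>N)"
  proof (rule nn_integral_monotone_convergence_SUP)
    show "incseq (\<lambda>k \<omega>. \<Sum>i. U k (X i \<omega>))"
      unfolding incseq_def le_fun_def using iU by (auto intro!: suminf_le simp: incseq_def)
  qed measurable
  also have "\<dots> = (SUP k. \<integral>\<^sup>+x. U k x \<partial>\<mu>)" using seq.IH by simp
  also have "\<dots> = (\<integral>\<^sup>+x. (SUP k. U k) x \<partial>\<mu>)"
    unfolding SUP_apply by (rule nn_integral_monotone_convergence_SUP[symmetric]) (use \<open>incseq U\<close> measurable_\<mu>[OF seq.hyps(1)] in auto)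
  finally show ?case .
qed

lemma count_laplace:
  assumes A: "A \<in> sets borel" "emeasure \<mu> A < \<infinity>" and c: "0 \<le> c"
  shows "(\<integral>\<^sup>+\<omega>. nexp (ennreal c * point_count X A \<omega>) \<partial>N) = nexp ((1 - nexp (ennreal c)) * emeasure \<mu> A)"
proof -
  define l where "l = measure \<mu> A"
  have l0: "0 \<le> l" by (simp add: l_def)
  have e1: "exp (- c) \<le> 1" using c by simp
  have nn: "0 \<le> (1 - exp (- c)) * l" using e1 l0 by simp
  have "(\<lambda>k. (exp (- c) * l) ^ k / fact k * exp (- l)) sums (exp (exp (- c) * l) * exp (- l))"
    using exp_converges[of "exp (- c) * l"] by (intro sums_mult2) (simp add: field_simps scaleR_conv_of_real)
  also have "exp (exp (- c) * l) * exp (- l) = exp (- ((1 - exp (- c)) * l))"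
    unfolding exp_add[symmetric] by (simp add: algebra_simps)
  finally have "(\<Sum>k. ennreal ((exp (- c) * l) ^ k / fact k * exp (- l))) = ennreal (exp (- ((1 - exp (- c)) * l)))"
    by (rule suminf_ennreal_eq[rotated]) (use l0 in simp)
  moreover have "ennreal ((exp (- c) * l) ^ k / fact k * exp (- l)) =
      nexp (ennreal c * of_nat k) * ennreal (l ^ k / fact k * exp (- l))" for k
  proof -
    have "nexp (ennreal c * of_nat k) = ennreal (exp (- c) ^ k)"
      using c by (simp add: ennreal_of_nat_eq_real_of_nat ennreal_mult[symmetric] nexp_ennreal
          exp_of_nat_mult[symmetric] mult.commute)
    then show ?thesis
      using l0 by (simp add: ennreal_mult[symmetric] power_mult_distrib)
  qed
  ultimately have "(\<Sum>k. nexp (ennreal c * of_nat k) * ennreal (l ^ k / fact k * exp (- l)))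
      = ennreal (exp (- ((1 - exp (- c)) * l)))" by simp
  also have "\<dots> = nexp (ennreal ((1 - exp (- c)) * l))" by (rule nexp_ennreal[OF nn, symmetric])
  also have "ennreal ((1 - exp (- c)) * l) = (1 - nexp (ennreal c)) * emeasure \<mu> A"
  proof -
    have "1 - nexp (ennreal c) = ennreal (1 - exp (- c))"
      using c by (simp add: nexp_ennreal ennreal_minus[symmetric])
    then show ?thesis
      using A e1 l0 by (simp add: ennreal_mult emeasure_eq_ennreal_measure less_top l_def)
  qed
  finally show ?thesis
    unfolding l_def using count_integral[OF A, of "\<lambda>x. nexp (ennreal c * x)"] by simp
qed

text \<open>For a step function the sum over the points is a linear combination of the independent Poisson
  counts of its level sets.\<close>

lemma laplace_step:
  fixes A :: "nat \<Rightarrow> real set" and c :: "nat \<Rightarrow> real"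
  assumes A: "\<And>j. j < n \<Longrightarrow> A j \<in> sets borel" "\<And>j. j < n \<Longrightarrow> emeasure \<mu> (A j) < \<infinity>"
    and disj: "disjoint_family_on A {..<n}" and c: "\<And>j. j < n \<Longrightarrow> 0 \<le> c j"
  defines "h \<equiv> \<lambda>x. \<Sum>j<n. ennreal (c j) * indicator (A j) x"
  shows "(\<integral>\<^sup>+\<omega>. nexp (\<Sum>i. h (X i \<omega>)) \<partial>N) = nexp (\<integral>\<^sup>+x. 1 - nexp (h x) \<partial>\<mu>)"
proof -
  have "(\<Sum>i. h (X i \<omega>)) = (\<Sum>j<n. ennreal (c j) * point_count X (A j) \<omega>)" for \<omega>
    unfolding h_def point_count_def by (subst suminf_sum) auto
  then have "(\<integral>\<^sup>+\<omega>. nexp (\<Sum>i. h (X i \<omega>)) \<partial>N) =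
      (\<integral>\<^sup>+\<omega>. (\<Prod>j<n. nexp (ennreal (c j) * point_count X (A j) \<omega>)) \<partial>N)"
    by (simp add: nexp_sum)
  also have "\<dots> = (\<Prod>j<n. \<integral>\<^sup>+\<omega>. nexp (ennreal (c j) * point_count X (A j) \<omega>) \<partial>N)"
  proof (rule indep_vars_nn_integral)
    have "\<forall>k. \<forall>A :: nat \<Rightarrow> real set. (\<forall>j<k. A j \<in> sets borel) \<and> disjoint_family_on A {..<k} \<longrightarrow>
      indep_vars (\<lambda>_. borel) (\<lambda>j. point_count X (A j)) {..<k}"
      using poisson unfolding poisson_points_def by (elim conjE)
    then have "indep_vars (\<lambda>_. borel) (\<lambda>j. point_count X (A j)) {..<n}"
      using A(1) disj by simp
    then show "indep_vars (\<lambda>_. borel) (\<lambda>j \<omega>. nexp (ennreal (c j) * point_count X (A j) \<omega>)) {..<n}"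
      by (rule indep_vars_compose2[where Y="\<lambda>j x. nexp (ennreal (c j) * x)"]) measurable
  qed auto
  also have "\<dots> = (\<Prod>j<n. nexp ((1 - nexp (ennreal (c j))) * emeasure \<mu> (A j)))"
    by (intro prod.cong refl count_laplace A c) auto
  also have "\<dots> = nexp (\<Sum>j<n. (1 - nexp (ennreal (c j))) * emeasure \<mu> (A j))"
    by (rule nexp_sum[symmetric])
  also have "(\<Sum>j<n. (1 - nexp (ennreal (c j))) * emeasure \<mu> (A j)) =
      (\<integral>\<^sup>+x. (\<Sum>j<n. (1 - nexp (ennreal (c j))) * indicator (A j) x) \<partial>\<mu>)"
    using A(1) sets_\<mu> by (subst nn_integral_sum) (auto simp: nn_integral_cmult)
  also have "\<dots> = (\<integral>\<^sup>+x. 1 - nexp (h x) \<partial>\<mu>)"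
  proof (intro nn_integral_cong)
    fix x
    show "(\<Sum>j<n. (1 - nexp (ennreal (c j))) * indicator (A j) x) = 1 - nexp (h x)"
    proof (cases "\<exists>j<n. x \<in> A j")
      case True
      then obtain k where k: "k < n" "x \<in> A k" by blast
      have z: "indicator (A j) x = (0::ennreal)" if "j \<in> {..<n} - {k}" for j
        using that k disj by (auto simp: disjoint_family_on_def indicator_def)
      have "(\<Sum>j<n. g j * indicator (A j) x) = g k" for g :: "nat \<Rightarrow> ennreal"
      proof -
        have "(\<Sum>j<n. g j * indicator (A j) x) = (\<Sum>j\<in>{k}. g j * indicator (A j) x)"
          by (rule sum.mono_neutral_right) (use k z in auto)
        then show ?thesis using k by simp
      qed
      then show ?thesis unfolding h_def by simp
    next
      case False
      then have z: "indicator (A j) x = (0::ennreal)" if "j \<in> {..<n}" for j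
        using that by (auto simp: indicator_def)
      have "(\<Sum>j<n. g j * indicator (A j) x) = 0" for g :: "nat \<Rightarrow> ennreal"
        by (rule sum.neutral) (use z in simp)
      then show ?thesis by (simp only: h_def nexp_0) simp
    qed
  qed
  finally show ?thesis .
qed

text \<open>Monotone approximation of \<open>h\<close> by step functions with supports of finite measure. Both sides are
  continuous along increasing sequences because \<open>nexp\<close> is.\<close>

lemma laplace_functional:
  assumes [measurable]: "h \<in> borel_measurable borel"
  shows "(\<integral>\<^sup>+\<omega>. nexp (\<Sum>i. h (X i \<omega>)) \<partial>N) = nexp (\<integral>\<^sup>+x. 1 - nexp (h x) \<partial>\<mu>)"
proof -
  interpret \<mu>: sigma_finite_measure \<mu> by (rule sigma_finite_\<mu>)
  obtain S where S: "range S \<subseteq> sets \<mu>" "(\<Union>i. S i) = space \<mu>" "\<And>i. emeasure \<mu> (S i) \<noteq> \<infinity>" "incseq S"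
    using \<mu>.sigma_finite_incseq by blast
  have [measurable]: "S k \<in> sets borel" for k using S(1) sets_\<mu> by auto
  have S_mono: "x \<in> S m \<Longrightarrow> m \<le> n \<Longrightarrow> x \<in> S n" for x m n using S(4) by (auto simp: incseq_def)
  have S_ex: "\<exists>k. x \<in> S k" for x using S(2) space_\<mu> by auto
  obtain u where u: "\<And>k. simple_function borel (u k)" "incseq u" "\<And>k x. u k x < top" "\<And>x. (SUP k. u k x) = h x"
    using borel_measurable_implies_simple_function_sequence'[OF assms] by blast
  define g where "g k x = u k x * indicator (S k) x" for k x
  have um [measurable]: "u k \<in> borel_measurable borel" for k by (rule borel_measurable_simple_function[OF u(1)])
  have gm [measurable]: "g k \<in> borel_measurable borel" for k
    unfolding g_def[abs_def] by measurable
  have g_inc: "incseq (\<lambda>k. g k x)" for x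
    using u(2) S_mono unfolding g_def incseq_def le_fun_def
    by (intro allI impI mult_mono) (auto split: split_indicator)
  have g_sup: "(SUP k. g k x) = h x" for x
  proof (rule antisym)
    show "(SUP k. g k x) \<le> h x"
      unfolding u(4)[symmetric] by (rule SUP_mono) (auto simp: g_def indicator_def)
    obtain k0 where "x \<in> S k0" using S_ex by blast
    then have "u k x \<le> g (max k k0) x" for k
      using u(2) S(4) by (auto simp: g_def indicator_def incseq_def le_fun_def)
        (meson max.cobounded2 subsetD)
    then show "h x \<le> (SUP k. g k x)"
      unfolding u(4)[symmetric] by (intro SUP_mono) blast
  qed
  have step: "(\<integral>\<^sup>+\<omega>. nexp (\<Sum>i. g k (X i \<omega>)) \<partial>N) = nexp (\<integral>\<^sup>+x. 1 - nexp (g k x) \<partial>\<mu>)" for k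
  proof -
    define V where "V = u k ` UNIV"
    have fin: "finite V" using simple_functionD(1)[OF u(1)[of k]] by (simp add: V_def)
    obtain e where e: "bij_betw e {..<card V} V"
      using ex_bij_betw_nat_finite[OF fin] by (auto simp: atLeast0LessThan)
    define A where "A j = u k -` {e j} \<inter> S k" for j
    have Am: "A j \<in> sets borel" for j
      using measurable_sets[OF um[of k], of "{e j}"] by (auto simp: A_def)
    have Af: "emeasure \<mu> (A j) < \<infinity>" for j
    proof -
      have "emeasure \<mu> (A j) \<le> emeasure \<mu> (S k)"
        by (rule emeasure_mono) (use S(1) in \<open>auto simp: A_def\<close>)
      also have "\<dots> < \<infinity>" using S(3)[of k] by (simp add: less_top[symmetric])
      finally show ?thesis .
    qed
    have d: "disjoint_family_on A {..<card V}"
    proof -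
      have "inj_on e {..<card V}" using e by (simp add: bij_betw_def)
      then have "e i \<noteq> e j" if "i < card V" "j < card V" "i \<noteq> j" for i j
        using that by (auto simp: inj_on_def)
      then show ?thesis unfolding disjoint_family_on_def A_def by (auto; metis)
    qed
    have ef: "ennreal (enn2real (e j)) = e j" if "j < card V" for j
    proof -
      have "e j \<in> V" using e that by (auto simp: bij_betw_def)
      then show ?thesis using u(3)[of k] by (auto simp: V_def less_top[symmetric])
    qed
    have "g k x = (\<Sum>j<card V. ennreal (enn2real (e j)) * indicator (A j) x)" for x
    proof -
      have "(\<Sum>j<card V. ennreal (enn2real (e j)) * indicator (A j) x) =
          (\<Sum>j<card V. e j * indicator (u k -` {e j} \<inter> S k) x)"
        by (intro sum.cong) (auto simp: ef A_def)
      also have "\<dots> = (\<Sum>v\<in>V. v * indicator (u k -` {v} \<inter> S k) x)"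
        by (rule sum.reindex_bij_betw[OF e])
      also have "\<dots> = (\<Sum>v\<in>{u k x}. v * indicator (u k -` {v} \<inter> S k) x)"
        by (rule sum.mono_neutral_right) (use fin in \<open>auto simp: V_def indicator_def\<close>)
      also have "\<dots> = g k x" by (simp add: g_def indicator_def)
      finally show ?thesis by simp
    qed
    then have "g k = (\<lambda>x. \<Sum>j<card V. ennreal (enn2real (e j)) * indicator (A j) x)" by blast
    then show ?thesis
      using laplace_step[of "card V" A "\<lambda>j. enn2real (e j)"] Am Af d by simp
  qed
  have lhs: "(\<lambda>k. \<integral>\<^sup>+\<omega>. nexp (\<Sum>i. g k (X i \<omega>)) \<partial>N) \<longlonglongrightarrow> (\<integral>\<^sup>+\<omega>. nexp (\<Sum>i. h (X i \<omega>)) \<partial>N)"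
  proof (rule nn_integral_dominated_convergence[where w="\<lambda>_. 1"])
    have "(\<lambda>k. \<Sum>i. g k (X i \<omega>)) \<longlonglongrightarrow> (\<Sum>i. h (X i \<omega>))" for \<omega>
    proof -
      have "incseq (\<lambda>k. \<Sum>i. g k (X i \<omega>))"
        using g_inc by (auto simp: incseq_def intro!: suminf_le)
      then have "(\<lambda>k. \<Sum>i. g k (X i \<omega>)) \<longlonglongrightarrow> (SUP k. \<Sum>i. g k (X i \<omega>))" by (rule LIMSEQ_SUP)
      also have "(SUP k. \<Sum>i. g k (X i \<omega>)) = (\<Sum>i. SUP k. g k (X i \<omega>))"
        by (rule ennreal_suminf_SUP_eq[symmetric]) (rule g_inc)
      finally show ?thesis unfolding g_sup .
    qed
    then show "AE \<omega> in N. (\<lambda>k. nexp (\<Sum>i. g k (X i \<omega>))) \<longlonglongrightarrow> nexp (\<Sum>i. h (X i \<omega>))"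
      by (intro AE_I2 nexp_tendsto)
  qed (auto simp: nexp_le_1 emeasure_space_1)
  have "(\<lambda>k. \<integral>\<^sup>+x. 1 - nexp (g k x) \<partial>\<mu>) \<longlonglongrightarrow> (\<integral>\<^sup>+x. 1 - nexp (h x) \<partial>\<mu>)"
  proof (rule nn_integral_LIMSEQ)
    show "incseq (\<lambda>k x. 1 - nexp (g k x))"
      using g_inc by (auto simp: incseq_def le_fun_def intro!: ennreal_minus_mono nexp_antimono)
    show "(\<lambda>x. 1 - nexp (g k x)) \<in> borel_measurable \<mu>" for k
      using sets_\<mu> by (simp cong: measurable_cong_sets)
    have "(\<lambda>k. g k x) \<longlonglongrightarrow> h x" for x
      using LIMSEQ_SUP[OF g_inc[of x]] by (simp add: g_sup)
    then show "(\<lambda>k. 1 - nexp (g k x)) \<longlonglongrightarrow> 1 - nexp (h x)" for x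
      by (intro tendsto_diff_ennreal nexp_tendsto tendsto_const) auto
  qed
  from nexp_tendsto[OF this] lhs show ?thesis
    unfolding step by (metis LIMSEQ_unique)
qed

end

section \<open>The Brown-Resnick process\<close>

lemma (in prob_space) indep_rv_compose:
  assumes UV: "indep_rv M S U T V" and f: "f \<in> measurable S S'" and g: "g \<in> measurable T T'"
  shows "indep_rv M S' (\<lambda>\<omega>. f (U \<omega>)) T' (\<lambda>\<omega>. g (V \<omega>))"
proof -
  have U: "U \<in> measurable M S" and V: "V \<in> measurable M T"
    and ind: "indep_set {U -` A \<inter> space M | A. A \<in> sets S} {V -` A \<inter> space M | A. A \<in> sets T}"
    using UV by (auto simp: indep_rv_def)
  have sub: "{(\<lambda>\<omega>. h (Y \<omega>)) -` A \<inter> space M | A. A \<in> sets K'} \<subseteq> {Y -` A \<inter> space M | A. A \<in> sets K}"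
    if h: "h \<in> measurable K K'" and Y: "Y \<in> measurable M K" for h Y and K :: "'k measure" and K' :: "'l measure"
  proof safe
    fix A assume A: "A \<in> sets K'"
    have "(\<lambda>\<omega>. h (Y \<omega>)) -` A \<inter> space M = Y -` (h -` A \<inter> space K) \<inter> space M"
      using measurable_space[OF Y] by auto
    then show "\<exists>B. (\<lambda>\<omega>. h (Y \<omega>)) -` A \<inter> space M = Y -` B \<inter> space M \<and> B \<in> sets K"
      using measurable_sets[OF h A] by blast
  qed
  have "indep_set {(\<lambda>\<omega>. f (U \<omega>)) -` A \<inter> space M | A. A \<in> sets S'}
      {(\<lambda>\<omega>. g (V \<omega>)) -` A \<inter> space M | A. A \<in> sets T'}"
    using ind unfolding indep_set_def
    by (rule indep_sets_mono_sets) (use sub[OF f U] sub[OF g V] in \<open>auto split: bool.split\<close>)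
  then show ?thesis
    using U V f g by (auto simp: indep_rv_def intro: measurable_compose)
qed

text \<open>Integrate over the first variable last: by independence the second one may be replaced by an
  independent copy.\<close>

lemma (in prob_space) indep_var_fubini:
  assumes UV: "indep_var S U T V" and Q: "Q \<in> sets (S \<Otimes>\<^sub>M T)"
  shows "emeasure M {\<omega>\<in>space M. (U \<omega>, V \<omega>) \<in> Q} =
    (\<integral>\<^sup>+\<omega>. emeasure M {\<omega>'\<in>space M. (U \<omega>, V \<omega>') \<in> Q} \<partial>M)"
proof -
  have U [measurable]: "U \<in> measurable M S" and V [measurable]: "V \<in> measurable M T"
    and J: "distr M S U \<Otimes>\<^sub>M distr M T V = distr M (S \<Otimes>\<^sub>M T) (\<lambda>\<omega>. (U \<omega>, V \<omega>))"
    using UV unfolding indep_var_distribution_eq by auto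
  interpret V: prob_space "distr M T V" by (rule prob_space_distr) measurable
  have Q': "Q \<in> sets (distr M S U \<Otimes>\<^sub>M distr M T V)"
    using Q by (simp cong: sets_pair_measure_cong)
  have "emeasure M {\<omega>\<in>space M. (U \<omega>, V \<omega>) \<in> Q} = emeasure (distr M (S \<Otimes>\<^sub>M T) (\<lambda>\<omega>. (U \<omega>, V \<omega>))) Q"
    using Q by (subst emeasure_distr) (auto intro!: arg_cong[where f="emeasure M"])
  also have "\<dots> = (\<integral>\<^sup>+x. emeasure (distr M T V) (Pair x -` Q) \<partial>distr M S U)"
    unfolding J[symmetric] by (rule V.emeasure_pair_measure_alt[OF Q'])
  also have "\<dots> = (\<integral>\<^sup>+\<omega>. emeasure (distr M T V) (Pair (U \<omega>) -` Q) \<partial>M)"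
    using V.measurable_emeasure_Pair[OF Q'] by (intro nn_integral_distr) auto
  also have "\<dots> = (\<integral>\<^sup>+\<omega>. emeasure M {\<omega>'\<in>space M. (U \<omega>, V \<omega>') \<in> Q} \<partial>M)"
  proof (intro nn_integral_cong)
    fix \<omega>
    have "Pair (U \<omega>) -` Q \<in> sets T" using Q by (rule sets_Pair1)
    then show "emeasure (distr M T V) (Pair (U \<omega>) -` Q) = emeasure M {\<omega>'\<in>space M. (U \<omega>, V \<omega>') \<in> Q}"
      by (subst emeasure_distr) (auto intro!: arg_cong[where f="emeasure M"])
  qed
  finally show ?thesis .
qed

lemma mark_tail_measurable:
  assumes \<tau>: "prob_space \<tau>" "sets \<tau> = sets borel"
  shows "(\<lambda>x::real. emeasure \<tau> {t::real. 0 < x + t}) \<in> borel_measurable borel"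
    and "(\<lambda>x::real. emeasure \<tau> {t::real. x + t \<le> 0}) \<in> borel_measurable borel"
proof -
  interpret \<tau>: prob_space \<tau> by fact
  have s: "sets (borel \<Otimes>\<^sub>M \<tau>) = sets (borel \<Otimes>\<^sub>M borel :: (real \<times> real) measure)"
    using \<tau>(2) by (intro sets_pair_measure_cong) auto
  have "{p \<in> space (borel \<Otimes>\<^sub>M borel). 0 < fst p + (snd p :: real)} \<in> sets (borel \<Otimes>\<^sub>M borel)"
    by measurable
  from \<tau>.measurable_emeasure_Pair[OF this[folded s]]
  show "(\<lambda>x::real. emeasure \<tau> {t::real. 0 < x + t}) \<in> borel_measurable borel"
    by (simp add: space_pair_measure vimage_def)
  have "{p \<in> space (borel \<Otimes>\<^sub>M borel). fst p + (snd p :: real) \<le> 0} \<in> sets (borel \<Otimes>\<^sub>M borel)"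
    by measurable
  from \<tau>.measurable_emeasure_Pair[OF this[folded s]]
  show "(\<lambda>x::real. emeasure \<tau> {t::real. x + t \<le> 0}) \<in> borel_measurable borel"
    by (simp add: space_pair_measure vimage_def)
qed

context poisson_process
begin

text \<open>The expected number of points whose mark lifts them above zero. By independence of points and
  marks it is the integral of \<open>P(x + T > 0)\<close> over the points, to which Campbell's formula applies.\<close>

lemma marked_count:
  assumes T: "\<And>i. distr N borel (T i) = \<tau>"
    and XT: "indep_var (\<Pi>\<^sub>M i\<in>(UNIV::nat set). borel) (\<lambda>\<omega> i. X i \<omega>)
      (\<Pi>\<^sub>M i\<in>(UNIV::nat set). borel) (\<lambda>\<omega> i. T i \<omega> :: real)"
  shows "(\<Sum>i. emeasure N {\<omega>\<in>space N. 0 < X i \<omega> + T i \<omega>}) = (\<integral>\<^sup>+x. emeasure \<tau> {t. 0 < x + t} \<partial>\<mu>)"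
proof -
  have TPm: "(\<lambda>\<omega> i. T i \<omega>) \<in> measurable N (\<Pi>\<^sub>M i\<in>(UNIV::nat set). borel)"
    using XT by (rule indep_var_rv2)
  have Tm [measurable]: "T i \<in> borel_measurable N" for i
    using measurable_compose[OF TPm measurable_component_singleton[of i]] by simp
  have \<tau>: "prob_space \<tau>" "sets \<tau> = sets borel"
    unfolding T[symmetric, of 0] by (auto intro: prob_space_distr)
  note [measurable] = mark_tail_measurable[OF \<tau>]
  have one: "emeasure N {\<omega>\<in>space N. 0 < X i \<omega> + T i \<omega>} = (\<integral>\<^sup>+\<omega>. emeasure \<tau> {t. 0 < X i \<omega> + t} \<partial>N)" for i
  proof -
    have iv: "indep_var borel (X i) borel (T i)"
      using indep_var_compose[OF XT measurable_component_singleton[of i] measurable_component_singleton[of i]]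
      by (simp add: comp_def)
    have Q: "{p. 0 < fst p + snd p} \<in> sets (borel \<Otimes>\<^sub>M borel :: (real \<times> real) measure)"
    proof -
      have "{p \<in> space (borel \<Otimes>\<^sub>M borel). 0 < fst p + (snd p :: real)} \<in> sets (borel \<Otimes>\<^sub>M borel)" by measurable
      then show ?thesis by (simp add: space_pair_measure)
    qed
    have "emeasure N {\<omega>\<in>space N. 0 < X i \<omega> + T i \<omega>} =
        (\<integral>\<^sup>+\<omega>. emeasure N {\<omega>'\<in>space N. 0 < X i \<omega> + T i \<omega>'} \<partial>N)"
      using indep_var_fubini[OF iv Q] by simp
    also have "\<dots> = (\<integral>\<^sup>+\<omega>. emeasure \<tau> {t. 0 < X i \<omega> + t} \<partial>N)"
      unfolding T[symmetric, of i]
      by (intro nn_integral_cong, subst emeasure_distr) (auto intro!: arg_cong[where f="emeasure N"])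
    finally show ?thesis .
  qed
  have "(\<Sum>i. emeasure N {\<omega>\<in>space N. 0 < X i \<omega> + T i \<omega>}) =
      (\<integral>\<^sup>+\<omega>. (\<Sum>i. emeasure \<tau> {t. 0 < X i \<omega> + t}) \<partial>N)"
    unfolding one by (rule nn_integral_suminf[symmetric]) measurable
  also have "\<dots> = (\<integral>\<^sup>+x. emeasure \<tau> {t. 0 < x + t} \<partial>\<mu>)"
    by (rule campbell) measurable
  finally show ?thesis .
qed

text \<open>Given the points, independent marks make the probability that no marked point exceeds zero a
  product \<open>\<Prod> H (X\<^sub>i)\<close> with \<open>H x = P(x + T \<le> 0)\<close>. Its expectation is the Laplace functional of the
  Poisson process at \<open>h = - ln H\<close>, that is, \<open>exp (- \<integral> (1 - H) d\<mu>)\<close>.\<close>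

lemma void_probability:
  assumes T: "\<And>i. distr N borel (T i) = \<tau>" and Tind: "indep_vars (\<lambda>_. borel) T (UNIV :: nat set)"
    and XT: "indep_var (\<Pi>\<^sub>M i\<in>(UNIV::nat set). borel) (\<lambda>\<omega> i. X i \<omega>)
      (\<Pi>\<^sub>M i\<in>(UNIV::nat set). borel) (\<lambda>\<omega> i. T i \<omega> :: real)"
  shows "emeasure N {\<omega>\<in>space N. \<forall>i. X i \<omega> + T i \<omega> \<le> 0} = nexp (\<integral>\<^sup>+x. emeasure \<tau> {t. 0 < x + t} \<partial>\<mu>)"
proof -
  have Tm [measurable]: "T i \<in> borel_measurable N" for i
    using Tind by (simp add: indep_vars_def)
  have \<tau>: "prob_space \<tau>" "sets \<tau> = sets borel"
    unfolding T[symmetric, of 0] by (auto intro: prob_space_distr)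
  interpret \<tau>: prob_space \<tau> by fact
  define H where "H x = emeasure \<tau> {t. x + t \<le> 0}" for x :: real
  have [measurable]: "H \<in> borel_measurable borel"
    unfolding H_def[abs_def] by (rule mark_tail_measurable[OF \<tau>])
  have H1: "H x \<le> 1" for x unfolding H_def by (rule \<tau>.emeasure_le_1)
  define h where "h x = (if H x = 0 then top else ennreal (- ln (enn2real (H x))))" for x
  have [measurable]: "h \<in> borel_measurable borel" unfolding h_def by measurable
  have nh: "nexp (h x) = H x" for x unfolding h_def by (rule nexp_surj[OF H1])
  have cH: "1 - H x = emeasure \<tau> {t. 0 < x + t}" for x
  proof -
    have "{t. 0 < x + t} = space \<tau> - {t. x + t \<le> 0}"
      using sets_eq_imp_space_eq[OF \<tau>(2)] by auto
    moreover have "{t. x + t \<le> 0} \<in> sets \<tau>" unfolding \<tau>(2) by measurable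
    ultimately show ?thesis
      unfolding H_def by (simp add: emeasure_compl \<tau>.emeasure_space_1)
  qed
  define A where "A n = {\<omega>\<in>space N. \<forall>i<n. X i \<omega> + T i \<omega> \<le> 0}" for n
  have [measurable]: "A n \<in> sets N" for n unfolding A_def by measurable
  have fin: "emeasure N (A n) = (\<integral>\<^sup>+\<omega>. nexp (\<Sum>i<n. h (X i \<omega>)) \<partial>N)" for n
  proof -
    let ?P = "\<Pi>\<^sub>M i\<in>(UNIV::nat set). (borel :: real measure)"
    define Q where "Q = {p\<in>space (?P \<Otimes>\<^sub>M ?P). \<forall>i<n. fst p i + snd p i \<le> 0}"
    have Q: "Q \<in> sets (?P \<Otimes>\<^sub>M ?P)" unfolding Q_def by measurable
    have inQ: "(x, y) \<in> Q \<longleftrightarrow> (\<forall>i<n. x i + y i \<le> 0)" for x y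
      by (auto simp: Q_def space_pair_measure space_PiM)
    have "emeasure N (A n) = (\<integral>\<^sup>+\<omega>. emeasure N {\<omega>'\<in>space N. \<forall>i<n. X i \<omega> + T i \<omega>' \<le> 0} \<partial>N)"
      using indep_var_fubini[OF XT Q] unfolding inQ A_def .
    also have "\<dots> = (\<integral>\<^sup>+\<omega>. nexp (\<Sum>i<n. h (X i \<omega>)) \<partial>N)"
    proof (intro nn_integral_cong)
      fix \<omega>
      show "emeasure N {\<omega>'\<in>space N. \<forall>i<n. X i \<omega> + T i \<omega>' \<le> 0} = nexp (\<Sum>i<n. h (X i \<omega>))"
      proof (cases "n = 0")
        case False
        have TH: "ennreal (prob (T i -` {t. X i \<omega> + t \<le> 0} \<inter> space N)) = H (X i \<omega>)" for i
          unfolding H_def T[symmetric, of i]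
          by (subst emeasure_distr) (auto simp: emeasure_eq_measure)
        have "{\<omega>'\<in>space N. \<forall>i<n. X i \<omega> + T i \<omega>' \<le> 0} =
            (\<Inter>i\<in>{..<n}. T i -` {t. X i \<omega> + t \<le> 0} \<inter> space N)"
          using False by auto
        then have "emeasure N {\<omega>'\<in>space N. \<forall>i<n. X i \<omega> + T i \<omega>' \<le> 0} =
            ennreal (\<Prod>i<n. prob (T i -` {t. X i \<omega> + t \<le> 0} \<inter> space N))"
          using indep_varsD[OF Tind, of "{..<n}" "\<lambda>i. {t. X i \<omega> + t \<le> 0}"] False
          by (simp add: emeasure_eq_measure lessThan_empty_iff)
        also have "\<dots> = (\<Prod>i<n. H (X i \<omega>))"
          unfolding TH[symmetric] by (rule prod_ennreal[symmetric]) simp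
        finally show ?thesis by (simp add: nexp_sum nh)
      qed (simp add: emeasure_space_1)
    qed
    finally show ?thesis .
  qed
  have "(\<lambda>n. emeasure N (A n)) \<longlonglongrightarrow> emeasure N (\<Inter>n. A n)"
    by (rule Lim_emeasure_decseq) (auto simp: decseq_def A_def)
  moreover have "(\<Inter>n. A n) = {\<omega>\<in>space N. \<forall>i. X i \<omega> + T i \<omega> \<le> 0}"
    unfolding A_def by auto
  moreover have "(\<lambda>n. \<integral>\<^sup>+\<omega>. nexp (\<Sum>i<n. h (X i \<omega>)) \<partial>N) \<longlonglongrightarrow> (\<integral>\<^sup>+\<omega>. nexp (\<Sum>i. h (X i \<omega>)) \<partial>N)"
  proof (rule nn_integral_dominated_convergence[where w="\<lambda>_. 1"])
    show "AE \<omega> in N. (\<lambda>n. nexp (\<Sum>i<n. h (X i \<omega>))) \<longlonglongrightarrow> nexp (\<Sum>i. h (X i \<omega>))"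
      by (intro AE_I2 nexp_tendsto summable_LIMSEQ) auto
  qed (auto simp: nexp_le_1 emeasure_space_1)
  moreover have "(\<integral>\<^sup>+\<omega>. nexp (\<Sum>i. h (X i \<omega>)) \<partial>N) = nexp (\<integral>\<^sup>+x. emeasure \<tau> {t. 0 < x + t} \<partial>\<mu>)"
    by (subst laplace_functional) (simp_all add: nh cH)
  ultimately show ?thesis
    unfolding fin by (simp add: LIMSEQ_unique)
qed

end

abbreviation exp_intensity :: "real measure" where
  "exp_intensity \<equiv> density lborel (\<lambda>x. ennreal (exp (- x)))"

lemma exp_intensity_tail: "(\<integral>\<^sup>+x. ennreal (exp (- x)) * indicator {a<..} x \<partial>lborel) = ennreal (exp (- a))"
proof -
  have "(\<integral>\<^sup>+x. ennreal (exp (- x)) * indicator {a<..} x \<partial>lborel) =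
      (\<integral>\<^sup>+x. ennreal (exp (- x)) * indicator {a..} x \<partial>lborel)"
    by (intro nn_integral_cong_AE eventually_mono[OF AE_lborel_singleton[of a]]) (auto simp: indicator_def)
  also have "\<dots> = ennreal (0 - (- exp (- a)))"
  proof (rule nn_integral_FTC_atLeast)
    show "((\<lambda>x::real. - exp (- x)) \<longlongrightarrow> 0) at_top"
      using tendsto_minus[OF filterlim_compose[OF exp_at_bot filterlim_uminus_at_bot_at_top]] by simp
  qed (auto intro!: derivative_eq_intros)
  finally show ?thesis by simp
qed

text \<open>By Fubini, since the intensity of \<open>(- t, \<infinity>)\<close> is \<open>exp t\<close>. This is where the exponential intensity
  turns exceedances of \<open>x + T\<close> into exponential moments of the mark.\<close>

lemma exp_intensity_marks:
  assumes \<tau>: "prob_space \<tau>" "sets \<tau> = sets borel"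
  shows "(\<integral>\<^sup>+x. emeasure \<tau> {t. 0 < x + t} \<partial>exp_intensity) = (\<integral>\<^sup>+t. ennreal (exp t) \<partial>\<tau>)"
proof -
  interpret \<tau>: prob_space \<tau> by fact
  interpret pair_sigma_finite lborel \<tau> ..
  have s: "sets (lborel \<Otimes>\<^sub>M \<tau>) = sets (borel \<Otimes>\<^sub>M borel :: (real \<times> real) measure)"
    using \<tau>(2) by (intro sets_pair_measure_cong) auto
  have tm: "{t. 0 < x + t} \<in> sets \<tau>" for x :: real unfolding \<tau>(2) by measurable
  note em = mark_tail_measurable(1)[OF \<tau>]
  have "(\<integral>\<^sup>+x. emeasure \<tau> {t. 0 < x + t} \<partial>exp_intensity) =
      (\<integral>\<^sup>+x. ennreal (exp (- x)) * emeasure \<tau> {t. 0 < x + t} \<partial>lborel)"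
    using em by (subst nn_integral_density) auto
  also have "\<dots> = (\<integral>\<^sup>+x. (\<integral>\<^sup>+t. ennreal (exp (- x)) * indicator {- t<..} x \<partial>\<tau>) \<partial>lborel)"
  proof (intro nn_integral_cong)
    fix x :: real
    have "(\<integral>\<^sup>+t. ennreal (exp (- x)) * indicator {- t<..} x \<partial>\<tau>) =
        (\<integral>\<^sup>+t. ennreal (exp (- x)) * indicator {t. 0 < x + t} t \<partial>\<tau>)"
      by (intro nn_integral_cong) (auto simp: indicator_def)
    then show "ennreal (exp (- x)) * emeasure \<tau> {t. 0 < x + t} =
        (\<integral>\<^sup>+t. ennreal (exp (- x)) * indicator {- t<..} x \<partial>\<tau>)"
      using tm[of x] by (simp add: nn_integral_cmult_indicator)
  qed
  also have "\<dots> = (\<integral>\<^sup>+t. (\<integral>\<^sup>+x. ennreal (exp (- x)) * indicator {- t<..} x \<partial>lborel) \<partial>\<tau>)"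
  proof (rule Fubini'[symmetric])
    have "(\<lambda>(x, t). ennreal (exp (- x)) * indicator {- t<..} x) =
        (\<lambda>p::real \<times> real. ennreal (exp (- fst p)) * indicator {p. 0 < fst p + snd p} p)"
      by (auto simp: fun_eq_iff indicator_def)
    also have "\<dots> \<in> borel_measurable (borel \<Otimes>\<^sub>M borel)"
    proof -
      have "{p \<in> space (borel \<Otimes>\<^sub>M borel). 0 < fst p + (snd p :: real)} \<in> sets (borel \<Otimes>\<^sub>M borel)"
        by measurable
      then have [measurable]: "{p. 0 < fst p + (snd p :: real)} \<in> sets (borel \<Otimes>\<^sub>M borel)"
        by (simp add: space_pair_measure)
      show ?thesis by measurable
    qed
    finally show "(\<lambda>(x, t). ennreal (exp (- x)) * indicator {- t<..} x) \<in> borel_measurable (lborel \<Otimes>\<^sub>M \<tau>)"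
      using measurable_cong_sets[OF s refl] by blast
  qed
  also have "\<dots> = (\<integral>\<^sup>+t. ennreal (exp t) \<partial>\<tau>)"
    by (simp add: exp_intensity_tail)
  finally show ?thesis .
qed

lemma bm_version_exists:
  assumes N: "prob_space N" and W: "standard_brownian_motion N T W" "{0..1} \<subseteq> T"
  shows "\<exists>V. bm_version N W V"
proof -
  interpret prob_space N by fact
  have "AE \<omega> in N. continuous_on T (\<lambda>t. W t \<omega>)"
    using W(1) by (simp add: standard_brownian_motion_def)
  then obtain G where G: "\<And>\<omega>. \<omega> \<in> space N - G \<Longrightarrow> continuous_on T (\<lambda>t. W t \<omega>)" "G \<in> null_sets N"
    by (rule AE_E3) blast
  define V :: "'a \<Rightarrow> C01" where
    "V \<omega> = (if \<omega> \<in> space N - G then Bcontfun (\<lambda>t. W (real_of_unit t) \<omega>) else 0)" for \<omega>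
  have Va: "V \<omega> t = W (real_of_unit t) \<omega>" if "\<omega> \<in> space N - G" for \<omega> t
  proof -
    have "continuous_on UNIV (\<lambda>t. W (real_of_unit t) \<omega>)"
      by (rule continuous_on_compose2[OF G(1)[OF that] continuous_on_real_of_unit])
        (use W(2) real_of_unit in auto)
    then show ?thesis using that by (simp add: V_def Bcontfun_inverse continuous_bcontfun_unit)
  qed
  have "V \<in> borel_measurable N"
  proof (rule measurable_C01I)
    fix t
    have Wt: "W (real_of_unit t) \<in> borel_measurable N"
      using W real_of_unit[of t] by (auto simp: standard_brownian_motion_def)
    have "(\<lambda>\<omega>. if \<omega> \<in> G then 0 else W (real_of_unit t) \<omega>) \<in> borel_measurable N"
      using G(2) Wt by (intro measurable_If_set) auto
    moreover have "V \<omega> t = (if \<omega> \<in> G then 0 else W (real_of_unit t) \<omega>)" if "\<omega> \<in> space N" for \<omega>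
      using that Va[of \<omega> t] by (auto simp: V_def)
    ultimately show "(\<lambda>\<omega>. V \<omega> t) \<in> borel_measurable N" by (simp cong: measurable_cong)
  qed
  moreover have "AE \<omega> in N. \<forall>t\<in>{0..1}. V \<omega> (to_unit t) = W t \<omega>"
    using AE_not_in[OF G(2)] AE_space
    by eventually_elim (auto simp: Va to_unit_inverse)
  ultimately show ?thesis
    unfolding bm_version_def using N W by blast
qed

text \<open>If for every level only finitely many paths reach it, then the supremum is attained, because
  any one path is bounded below and only the finitely many paths that reach its minimum compete.\<close>

lemma max_of_vanishing_family:
  fixes x :: "nat \<Rightarrow> real" and v :: "nat \<Rightarrow> C01"
  assumes fin: "\<And>\<kappa>::nat. finite {i. 0 < x i + norm (v i) + real \<kappa>}"
  obtains z :: C01 where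
    "\<And>t. \<exists>i. z t = x i + v i t - real_of_unit t / 2"
    "\<And>t i. x i + v i t - real_of_unit t / 2 \<le> z t"
    "\<And>t. (\<lambda>n. MAX i\<in>{..n}. x i + v i t - real_of_unit t / 2) \<longlonglongrightarrow> z t"
proof -
  define f where "f i t = x i + v i t - real_of_unit t / 2" for i t
  \<comment> \<open>Path number \<open>0\<close> stays above \<open>- \<kappa>\<close>.\<close>
  obtain \<kappa> :: nat where \<kappa>: "- (x 0 - norm (v 0) - 1) \<le> real \<kappa>" using real_arch_simple by blast
  define F where "F = insert 0 {i. 0 < x i + norm (v i) + real \<kappa>}"
  have F: "finite F" "F \<noteq> {}" "0 \<in> F" using fin by (auto simp: F_def)
  have out: "f i t \<le> f 0 t" if "i \<notin> F" for i t
  proof -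
    have "x i + norm (v i) \<le> - real \<kappa>" using that by (simp add: F_def)
    moreover have "\<bar>v i t\<bar> \<le> norm (v i)" "\<bar>v 0 t\<bar> \<le> norm (v 0)"
      using norm_bounded[of "v i" t] norm_bounded[of "v 0" t] by auto
    ultimately show ?thesis using \<kappa> real_of_unit_range[of t] unfolding f_def by linarith
  qed
  have cont: "continuous_on UNIV (\<lambda>t. MAX i\<in>F. f i t)"
    using F unfolding f_def
    by (intro continuous_on_MAX) (auto intro!: continuous_intros continuous_on_real_of_unit)
  define z :: C01 where "z = Bcontfun (\<lambda>t. MAX i\<in>F. f i t)"
  have zt: "z t = (MAX i\<in>F. f i t)" for t
    unfolding z_def using cont by (simp add: Bcontfun_inverse continuous_bcontfun_unit)
  have ub: "f i t \<le> z t" for i t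
  proof (cases "i \<in> F")
    case True then show ?thesis unfolding zt using F by (intro Max_ge) auto
  next
    case False
    then have "f i t \<le> f 0 t" by (rule out)
    also have "\<dots> \<le> z t" unfolding zt using F by (intro Max_ge) auto
    finally show ?thesis .
  qed
  have at: "\<exists>i\<in>F. z t = f i t" for t
  proof -
    have "z t \<in> (\<lambda>i. f i t) ` F" unfolding zt using F by (intro Max_in) auto
    then show ?thesis by auto
  qed
  have "(MAX i\<in>{..n}. f i t) = z t" if "Max F \<le> n" for n t
  proof (rule antisym)
    show "(MAX i\<in>{..n}. f i t) \<le> z t" using ub by (intro Max.boundedI) auto
    obtain i where i: "i \<in> F" "z t = f i t" using at by blast
    have "i \<le> n" using i that F by (meson Max_ge order_trans)
    then show "z t \<le> (MAX i\<in>{..n}. f i t)" unfolding i(2) by (intro Max_ge) auto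
  qed
  then have "(\<lambda>n. MAX i\<in>{..n}. f i t) \<longlonglongrightarrow> z t" for t
    by (intro tendsto_eventually eventually_sequentiallyI[of "Max F"]) auto
  then show ?thesis
    using that[of z] ub at unfolding f_def by blast
qed

text \<open>The maximum of \<open>x + z t - t/2\<close> over the paths of a family stays below \<open>y k\<close> at all nodes iff
  \<open>x + grid_excess m y z \<le> 0\<close> for each member \<open>(x, z)\<close>.\<close>

definition grid_excess :: "nat \<Rightarrow> (nat \<Rightarrow> real) \<Rightarrow> C01 \<Rightarrow> real" where
  "grid_excess m y z = (MAX k\<in>{..2^m}. z (node m k) - real_of_unit (node m k) / 2 - y k)"

lemma grid_excess_measurable [measurable]: "grid_excess m y \<in> borel_measurable borel"
  unfolding grid_excess_def[abs_def] by measurable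

lemma grid_excess_le_iff:
  "grid_excess m y z \<le> c \<longleftrightarrow> (\<forall>k\<le>2^m. z (node m k) - real_of_unit (node m k) / 2 - y k \<le> c)"
  unfolding grid_excess_def by (subst Max_le_iff) (auto simp: Ball_def)

text \<open>Existence: the expected number of points with \<open>X\<^sub>i + norm V\<^sub>i + \<kappa> > 0\<close> is \<open>E exp (norm V + \<kappa>)\<close>, which
  is finite by the Gaussian tail, so almost surely only finitely many paths reach any given level
  and the supremum is a maximum. Finite-dimensional distributions: the maximum stays below \<open>y\<close> at the
  nodes iff no point, marked with the grid excess of its path, exceeds zero.\<close>

theorem brown_resnick_process:
  assumes ingr: "brown_resnick_ingredients N X B"
  obtains Z V where "brown_resnick_on_unit N X B Z" "bm_version N (B 0) V"
    "\<And>m y. emeasure N {\<omega>\<in>space N. \<forall>k\<le>2^m. Z \<omega> (node m k) \<le> y k} =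
      nexp (\<integral>\<^sup>+\<omega>. ennreal (exp (grid_excess m y (V \<omega>))) \<partial>N)"
proof -
  have N: "prob_space N" and bm: "\<And>i. standard_brownian_motion N {0..} (B i)"
    and Bind: "prob_space.indep_vars N (\<lambda>_. \<Pi>\<^sub>M t\<in>{0..}. borel) (\<lambda>i \<omega>. \<lambda>t\<in>{0..}. B i t \<omega>) UNIV"
    and XB: "indep_rv N (\<Pi>\<^sub>M i\<in>UNIV. borel) (\<lambda>\<omega> i. X i \<omega>)
      (\<Pi>\<^sub>M i\<in>UNIV. \<Pi>\<^sub>M t\<in>{0..}. borel) (\<lambda>\<omega> i. \<lambda>t\<in>{0..}. B i t \<omega>)"
    and pp: "poisson_points N exp_intensity X"
    using ingr by (auto simp: brown_resnick_ingredients_def)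
  have sf: "sigma_finite_measure exp_intensity"
    by (subst sigma_finite_measure.sigma_finite_iff_density_finite[OF sigma_finite_lborel]) auto
  interpret poisson_process N exp_intensity X
    by (intro poisson_process.intro poisson_process_axioms.intro N pp sf) simp
  obtain V where V: "\<And>i. bm_version N (B i) (V i)"
  proof -
    have "\<exists>V. bm_version N (B i) V" for i by (rule bm_version_exists[OF N bm]) auto
    then have "\<exists>V. \<forall>i. bm_version N (B i) (V i)" by (intro choice) blast
    then show ?thesis using that by blast
  qed
  have Vm [measurable]: "V i \<in> borel_measurable N" for i using V[of i] by (simp add: bm_version_def)
  have Vlaw: "distr N borel (V i) = distr N borel (V 0)" for i by (rule bm_law_unique[OF V V])
  have VB: "AE \<omega> in N. \<forall>i. \<forall>t\<in>{0..1}. V i \<omega> (to_unit t) = B i t \<omega>"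
    using V by (auto simp: bm_version_def AE_all_countable)
  let ?\<Omega> = "\<Pi>\<^sub>M t\<in>{0::real..}. (borel :: real measure)"
  \<comment> \<open>Marks must be functions of the processes \<open>B i\<close>, for which independence is known; their laws are
    those of functions of the continuous versions \<open>V i\<close>.\<close>
  have marks: "indep_vars (\<lambda>_. borel) T UNIV \<and> (\<forall>i. distr N borel (T i) = distr N borel (\<lambda>\<omega>. g (V 0 \<omega>))) \<and>
      indep_var (\<Pi>\<^sub>M i\<in>(UNIV::nat set). borel) (\<lambda>\<omega> i. X i \<omega>) (\<Pi>\<^sub>M i\<in>(UNIV::nat set). borel) (\<lambda>\<omega> i. T i \<omega>)"
    if \<theta>: "\<theta> \<in> borel_measurable ?\<Omega>" and T: "\<And>i \<omega>. T i \<omega> = \<theta> (\<lambda>t\<in>{0..}. B i t \<omega>)"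
      and g [measurable]: "g \<in> borel_measurable borel" and Tg: "\<And>i. AE \<omega> in N. T i \<omega> = g (V i \<omega>)"
    for \<theta> :: "(real \<Rightarrow> real) \<Rightarrow> real" and g :: "C01 \<Rightarrow> real" and T
  proof -
    have i1: "indep_vars (\<lambda>_. borel) (\<lambda>i \<omega>. \<theta> (\<lambda>t\<in>{0..}. B i t \<omega>)) UNIV"
      by (rule indep_vars_compose2[OF Bind]) (rule \<theta>)
    then have i1: "indep_vars (\<lambda>_. borel) T UNIV" unfolding T[abs_def, symmetric] .
    have Tm [measurable]: "T i \<in> borel_measurable N" for i using i1 by (simp add: indep_vars_def)
    have "distr N borel (T i) = distr N borel (\<lambda>\<omega>. g (V 0 \<omega>))" for i
    proof -
      have "distr N borel (T i) = distr N borel (\<lambda>\<omega>. g (V i \<omega>))"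
        using Tg[of i] by (intro distr_cong_AE) auto
      also have "\<dots> = distr (distr N borel (V i)) borel g"
        by (subst distr_distr) (auto simp: comp_def)
      also have "\<dots> = distr N borel (\<lambda>\<omega>. g (V 0 \<omega>))"
        unfolding Vlaw[of i] by (subst distr_distr) (auto simp: comp_def)
      finally show ?thesis .
    qed
    moreover have "indep_rv N (\<Pi>\<^sub>M i\<in>(UNIV::nat set). borel) (\<lambda>\<omega> i. X i \<omega>)
        (\<Pi>\<^sub>M i\<in>(UNIV::nat set). borel) (\<lambda>\<omega> i. \<theta> (\<lambda>t\<in>{0..}. B i t \<omega>))"
    proof (rule indep_rv_compose[OF XB measurable_ident, of "\<lambda>b i. \<theta> (b i)", simplified id_def])
      show "(\<lambda>b i. \<theta> (b i)) \<in> measurable (\<Pi>\<^sub>M i\<in>(UNIV::nat set). ?\<Omega>) (\<Pi>\<^sub>M i\<in>(UNIV::nat set). borel)"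
        by (rule measurable_PiM_single') (auto intro!: measurable_compose[OF _ \<theta>] measurable_component_singleton)
    qed
    ultimately show ?thesis
      using i1 unfolding indep_rv_iff_indep_var T[symmetric] by blast
  qed
  \<comment> \<open>The norm of \<open>V i\<close> as a function of the values of \<open>B i\<close> at countably many times.\<close>
  define \<nu> where "\<nu> b = enn2real (SUP m. SUP k\<in>{..2^m}. ennreal \<bar>b (real k / 2 ^ m)\<bar>)" for b :: "real \<Rightarrow> real"
  have \<nu>m: "\<nu> \<in> borel_measurable ?\<Omega>"
  proof -
    have "(\<lambda>b. b (real k / 2 ^ m)) \<in> borel_measurable ?\<Omega>" for k m :: nat
      by (rule measurable_component_singleton) simp
    then have "(\<lambda>b. ennreal \<bar>b (real k / 2 ^ m)\<bar>) \<in> borel_measurable ?\<Omega>" for k m :: nat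
      by measurable
    then have "(\<lambda>b. SUP m. SUP k\<in>{..2^m}. ennreal \<bar>b (real k / 2 ^ m)\<bar>) \<in> borel_measurable ?\<Omega>"
      by (intro borel_measurable_SUP) auto
    then show ?thesis unfolding \<nu>_def[abs_def] by (rule borel_measurable_enn2real)
  qed
  have \<nu>V: "AE \<omega> in N. \<forall>i. \<nu> (\<lambda>t\<in>{0..}. B i t \<omega>) = norm (V i \<omega>)"
    using VB
  proof eventually_elim
    case (elim \<omega>)
    show ?case
    proof
      fix i
      define S where "S = (SUP m. SUP k\<in>{..2^m}. ennreal \<bar>(\<lambda>t\<in>{0..}. B i t \<omega>) (real k / 2 ^ m)\<bar>)"
      have Bn: "B i (real k / 2 ^ m) \<omega> = V i \<omega> (node m k)" if "k \<le> 2 ^ m" for m k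
        using elim node_mem[OF that] by (simp add: node_def)
      have "S \<le> ennreal (norm (V i \<omega>))"
        unfolding S_def using norm_bounded[of "V i \<omega>"]
        by (intro SUP_least) (auto simp: Bn intro!: ennreal_leI)
      then obtain s where s: "S = ennreal s" "0 \<le> s" "s \<le> norm (V i \<omega>)"
        by (cases S) (auto simp: top_unique)
      have "\<bar>V i \<omega> (node m k)\<bar> \<le> s" if "k \<le> 2 ^ m" for m k
      proof -
        have "ennreal \<bar>V i \<omega> (node m k)\<bar> \<le> S"
          unfolding S_def using that Bn[OF that]
          by (intro SUP_upper2[of m] SUP_upper2[of k]) auto
        then show ?thesis using s by (simp add: ennreal_le_iff)
      qed
      then have "norm (V i \<omega>) \<le> s" by (rule norm_le_nodes)
      then show "\<nu> (\<lambda>t\<in>{0..}. B i t \<omega>) = norm (V i \<omega>)"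
        unfolding \<nu>_def S_def[symmetric] using s by simp
    qed
  qed
  have fin: "AE \<omega> in N. \<forall>\<kappa>::nat. finite {i. 0 < X i \<omega> + norm (V i \<omega>) + real \<kappa>}"
    unfolding AE_all_countable
  proof
    fix \<kappa> :: nat
    define T where "T i \<omega> = \<nu> (\<lambda>t\<in>{0..}. B i t \<omega>) + real \<kappa>" for i \<omega>
    define \<tau> where "\<tau> = distr N borel (\<lambda>\<omega>. norm (V 0 \<omega>) + real \<kappa>)"
    have "AE \<omega> in N. T i \<omega> = norm (V i \<omega>) + real \<kappa>" for i
      using \<nu>V by eventually_elim (simp add: T_def)
    then have mk: "indep_vars (\<lambda>_. borel) T UNIV" "\<And>i. distr N borel (T i) = \<tau>"
      "indep_var (\<Pi>\<^sub>M i\<in>(UNIV::nat set). borel) (\<lambda>\<omega> i. X i \<omega>) (\<Pi>\<^sub>M i\<in>(UNIV::nat set). borel) (\<lambda>\<omega> i. T i \<omega>)"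
      using marks[of "\<lambda>b. \<nu> b + real \<kappa>" T "\<lambda>z. norm z + real \<kappa>"] \<nu>m
      by (auto simp: T_def \<tau>_def)
    have Tm [measurable]: "T i \<in> borel_measurable N" for i using mk(1) by (simp add: indep_vars_def)
    have \<tau>: "prob_space \<tau>" "sets \<tau> = sets borel"
      unfolding \<tau>_def by (auto intro!: prob_space_distr)
    define A where "A i = {\<omega>\<in>space N. 0 < X i \<omega> + T i \<omega>}" for i
    have [measurable]: "A i \<in> sets N" for i unfolding A_def by measurable
    have "(\<Sum>i. emeasure N (A i)) = (\<integral>\<^sup>+t. ennreal (exp t) \<partial>\<tau>)"
      unfolding A_def using marked_count[OF mk(2,3)] exp_intensity_marks[OF \<tau>] by simp
    also have "\<dots> = (\<integral>\<^sup>+\<omega>. ennreal (exp (real \<kappa>)) * ennreal (exp (norm (V 0 \<omega>))) \<partial>N)"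
      unfolding \<tau>_def by (subst nn_integral_distr) (auto simp: exp_add ennreal_mult'[symmetric] mult.commute)
    also have "\<dots> = ennreal (exp (real \<kappa>)) * (\<integral>\<^sup>+\<omega>. ennreal (exp (norm (V 0 \<omega>))) \<partial>N)"
      by (rule nn_integral_cmult) measurable
    also have "\<dots> < \<infinity>"
      using bm_exp_norm_finite[OF V[of 0]] by (simp add: ennreal_mult_less_top)
    finally have "(\<Sum>i. ennreal (prob (A i))) \<noteq> top"
      by (simp add: emeasure_eq_measure less_top)
    then have "summable (\<lambda>i. prob (A i))"
      by (intro summable_suminf_not_top) auto
    then have "AE \<omega> in N. \<forall>\<^sub>F i in sequentially. \<omega> \<in> space N - A i"
      by (intro borel_cantelli_AE1) (auto simp: emeasure_eq_measure)
    with \<nu>V show "AE \<omega> in N. finite {i. 0 < X i \<omega> + norm (V i \<omega>) + real \<kappa>}"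
    proof eventually_elim
      case (elim \<omega>)
      then obtain n where n: "\<And>i. n \<le> i \<Longrightarrow> \<omega> \<in> space N - A i"
        by (auto simp: eventually_sequentially)
      have "{i. 0 < X i \<omega> + norm (V i \<omega>) + real \<kappa>} \<subseteq> {..<n}"
      proof (rule subsetI, rule ccontr)
        fix i assume i: "i \<in> {i. 0 < X i \<omega> + norm (V i \<omega>) + real \<kappa>}" "i \<notin> {..<n}"
        then have "\<omega> \<in> space N - A i" by (intro n) simp
        then show False using i(1) elim(1) by (simp add: A_def T_def add.assoc)
      qed
      then show ?case by (rule finite_subset) simp
    qed
  qed
  then obtain G where G: "\<And>\<omega>. \<omega> \<in> space N - G \<Longrightarrow> \<forall>\<kappa>::nat. finite {i. 0 < X i \<omega> + norm (V i \<omega>) + real \<kappa>}"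
      "G \<in> null_sets N"
    by (rule AE_E3) blast
  define f where "f i \<omega> t = X i \<omega> + V i \<omega> t - real_of_unit t / 2" for i \<omega> t
  have ex: "\<exists>z::C01. (\<forall>t. \<exists>i. z t = f i \<omega> t) \<and> (\<forall>t i. f i \<omega> t \<le> z t) \<and>
      (\<forall>t. (\<lambda>n. MAX i\<in>{..n}. f i \<omega> t) \<longlonglongrightarrow> z t)" if "\<omega> \<in> space N - G" for \<omega>
  proof -
    have "finite {i. 0 < X i \<omega> + norm (V i \<omega>) + real \<kappa>}" for \<kappa> :: nat using G(1)[OF that] by blast
    then show ?thesis
      by (rule max_of_vanishing_family[of "\<lambda>i. X i \<omega>" "\<lambda>i. V i \<omega>"]) (unfold f_def, blast)
  qed
  obtain z :: "'a \<Rightarrow> C01" where z: "\<And>\<omega> t. \<omega> \<in> space N - G \<Longrightarrow> \<exists>i. z \<omega> t = f i \<omega> t"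
      "\<And>\<omega> t i. \<omega> \<in> space N - G \<Longrightarrow> f i \<omega> t \<le> z \<omega> t"
      "\<And>\<omega> t. \<omega> \<in> space N - G \<Longrightarrow> (\<lambda>n. MAX i\<in>{..n}. f i \<omega> t) \<longlonglongrightarrow> z \<omega> t"
  proof -
    have "\<exists>z :: 'a \<Rightarrow> C01. \<forall>\<omega>. \<omega> \<in> space N - G \<longrightarrow> (\<forall>t. \<exists>i. z \<omega> t = f i \<omega> t) \<and>
        (\<forall>t i. f i \<omega> t \<le> z \<omega> t) \<and> (\<forall>t. (\<lambda>n. MAX i\<in>{..n}. f i \<omega> t) \<longlonglongrightarrow> z \<omega> t)"
      by (intro choice allI) (use ex in blast)
    then show ?thesis using that by blast
  qed
  \<comment> \<open>The exceptional set \<open>G\<close> is measurable, so redefining the maximum on it does no harm.\<close>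
  define Z where "Z \<omega> = (if \<omega> \<in> G then 0 else z \<omega>)" for \<omega>
  have Zm: "Z \<in> borel_measurable N"
  proof (rule measurable_C01I)
    fix t
    have fm: "(\<lambda>\<omega>. f i \<omega> t) \<in> borel_measurable N" for i unfolding f_def by measurable
    show "(\<lambda>\<omega>. Z \<omega> t) \<in> borel_measurable N"
    proof (rule borel_measurable_LIMSEQ_real)
      show "(\<lambda>\<omega>. if \<omega> \<in> G then 0 else MAX i\<in>{..n}. f i \<omega> t) \<in> borel_measurable N" for n
        using G(2) fm by (intro measurable_If_set borel_measurable_Max) auto
      show "(\<lambda>n. if \<omega> \<in> G then 0 else MAX i\<in>{..n}. f i \<omega> t) \<longlonglongrightarrow> Z \<omega> t" if "\<omega> \<in> space N" for \<omega>
        using that z(3)[of \<omega> t] by (simp add: Z_def)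
    qed
  qed
  have Zprop: "AE \<omega> in N. \<forall>t. (\<exists>i. Z \<omega> t = f i \<omega> t) \<and> (\<forall>i. f i \<omega> t \<le> Z \<omega> t)"
    using AE_not_in[OF G(2)] AE_space by eventually_elim (simp add: Z_def z)
  have "brown_resnick_on_unit N X B Z"
    unfolding brown_resnick_on_unit_def
  proof (intro conjI Zm)
    show "AE \<omega> in N. \<forall>t\<in>{0..1}. (\<exists>i. Z \<omega> (to_unit t) = X i \<omega> + B i t \<omega> - t / 2) \<and>
      (\<forall>i. X i \<omega> + B i t \<omega> - t / 2 \<le> Z \<omega> (to_unit t))"
      using Zprop VB
    proof eventually_elim
      case (elim \<omega>)
      have "f i \<omega> (to_unit t) = X i \<omega> + B i t \<omega> - t / 2" if "t \<in> {0..1}" for i t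
        using elim(2) that by (simp add: f_def to_unit_inverse)
      with elim(1) show ?case by metis
    qed
  qed
  moreover have "emeasure N {\<omega>\<in>space N. \<forall>k\<le>2^m. Z \<omega> (node m k) \<le> y k} =
      nexp (\<integral>\<^sup>+\<omega>. ennreal (exp (grid_excess m y (V 0 \<omega>))) \<partial>N)" for m y
  proof -
    define \<theta> where "\<theta> b = (MAX k\<in>{..2^m}. b (real k / 2 ^ m) - real_of_unit (node m k) / 2 - y k)"
      for b :: "real \<Rightarrow> real"
    define T where "T i \<omega> = \<theta> (\<lambda>t\<in>{0..}. B i t \<omega>)" for i \<omega>
    define \<tau> where "\<tau> = distr N borel (\<lambda>\<omega>. grid_excess m y (V 0 \<omega>))"
    have \<theta>m: "\<theta> \<in> borel_measurable ?\<Omega>"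
      unfolding \<theta>_def
      by (intro borel_measurable_Max borel_measurable_diff borel_measurable_const measurable_component_singleton) auto
    have TV: "AE \<omega> in N. \<forall>i. T i \<omega> = grid_excess m y (V i \<omega>)"
      using VB
    proof eventually_elim
      case (elim \<omega>)
      have "B i (real k / 2 ^ m) \<omega> = V i \<omega> (node m k)" if "k \<le> 2 ^ m" for i k
        using elim node_mem[OF that] by (simp add: node_def)
      then show ?case unfolding T_def \<theta>_def grid_excess_def
        by (intro allI arg_cong[where f=Max] image_cong) auto
    qed
    have mk: "indep_vars (\<lambda>_. borel) T UNIV" "\<And>i. distr N borel (T i) = \<tau>"
      "indep_var (\<Pi>\<^sub>M i\<in>(UNIV::nat set). borel) (\<lambda>\<omega> i. X i \<omega>) (\<Pi>\<^sub>M i\<in>(UNIV::nat set). borel) (\<lambda>\<omega> i. T i \<omega>)"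
    proof -
      have "AE \<omega> in N. T i \<omega> = grid_excess m y (V i \<omega>)" for i
        using TV by eventually_elim blast
      from marks[OF \<theta>m T_def grid_excess_measurable this]
      show "indep_vars (\<lambda>_. borel) T UNIV" "\<And>i. distr N borel (T i) = \<tau>"
        "indep_var (\<Pi>\<^sub>M i\<in>(UNIV::nat set). borel) (\<lambda>\<omega> i. X i \<omega>) (\<Pi>\<^sub>M i\<in>(UNIV::nat set). borel) (\<lambda>\<omega> i. T i \<omega>)"
        unfolding \<tau>_def by blast+
    qed
    have Tm [measurable]: "T i \<in> borel_measurable N" for i using mk(1) by (simp add: indep_vars_def)
    have \<tau>: "prob_space \<tau>" "sets \<tau> = sets borel"
      unfolding \<tau>_def by (auto intro!: prob_space_distr)
    have "emeasure N {\<omega>\<in>space N. \<forall>k\<le>2^m. Z \<omega> (node m k) \<le> y k} =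
        emeasure N {\<omega>\<in>space N. \<forall>i. X i \<omega> + T i \<omega> \<le> 0}"
    proof (rule emeasure_eq_AE)
      show "AE \<omega> in N. (\<omega> \<in> {\<omega>\<in>space N. \<forall>k\<le>2^m. Z \<omega> (node m k) \<le> y k}) =
          (\<omega> \<in> {\<omega>\<in>space N. \<forall>i. X i \<omega> + T i \<omega> \<le> 0})"
        using Zprop TV
      proof eventually_elim
        case (elim \<omega>)
        have "X i \<omega> + T i \<omega> \<le> 0 \<longleftrightarrow> (\<forall>k\<le>2^m. f i \<omega> (node m k) \<le> y k)" for i
        proof -
          have "X i \<omega> + T i \<omega> \<le> 0 \<longleftrightarrow> T i \<omega> \<le> - X i \<omega>" by linarith
          also have "\<dots> \<longleftrightarrow> (\<forall>k\<le>2^m. V i \<omega> (node m k) - real_of_unit (node m k) / 2 - y k \<le> - X i \<omega>)"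
            using elim(2) by (simp add: grid_excess_le_iff)
          finally show ?thesis unfolding f_def by (auto simp: algebra_simps)
        qed
        moreover have "(\<forall>k\<le>2^m. Z \<omega> (node m k) \<le> y k) = (\<forall>i. \<forall>k\<le>2^m. f i \<omega> (node m k) \<le> y k)"
        proof (intro iffI allI impI)
          fix i k :: nat assume "\<forall>k\<le>2^m. Z \<omega> (node m k) \<le> y k" "k \<le> 2^m"
          then have "Z \<omega> (node m k) \<le> y k" by blast
          then show "f i \<omega> (node m k) \<le> y k" using elim(1) order_trans by blast
        next
          fix k :: nat assume a: "\<forall>i. \<forall>k\<le>2^m. f i \<omega> (node m k) \<le> y k" "k \<le> 2^m"
          obtain i where "Z \<omega> (node m k) = f i \<omega> (node m k)" using elim(1) by blast
          then show "Z \<omega> (node m k) \<le> y k" using a by simp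
        qed
        ultimately show ?case by simp
      qed
      show "{\<omega>\<in>space N. \<forall>k\<le>2^m. Z \<omega> (node m k) \<le> y k} \<in> sets N"
        using Zm by measurable
      show "{\<omega>\<in>space N. \<forall>i. X i \<omega> + T i \<omega> \<le> 0} \<in> sets N" by measurable
    qed
    also have "\<dots> = nexp (\<integral>\<^sup>+t. ennreal (exp t) \<partial>\<tau>)"
      unfolding void_probability[OF mk(2,1,3)] exp_intensity_marks[OF \<tau>] ..
    also have "(\<integral>\<^sup>+t. ennreal (exp t) \<partial>\<tau>) = (\<integral>\<^sup>+\<omega>. ennreal (exp (grid_excess m y (V 0 \<omega>))) \<partial>N)"
      unfolding \<tau>_def by (subst nn_integral_distr) auto
    finally show ?thesis .
  qed
  ultimately show thesis using that[of Z "V 0"] V[of 0] by blast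
qed

section \<open>A typical member of a row\<close>

lemma (in prob_space) indep_rv_prob:
  assumes "indep_rv M S U T V" "A \<in> sets S" "B \<in> sets T"
  shows "prob {\<omega>\<in>space M. U \<omega> \<in> A \<and> V \<omega> \<in> B} =
    prob {\<omega>\<in>space M. U \<omega> \<in> A} * prob {\<omega>\<in>space M. V \<omega> \<in> B}"
proof -
  have "prob ((U -` A \<inter> space M) \<inter> (V -` B \<inter> space M)) = prob (U -` A \<inter> space M) * prob (V -` B \<inter> space M)"
    using assms unfolding indep_rv_def by (intro indep_setD) auto
  then show ?thesis by (simp add: vimage_def Int_def conj_ac)
qed

lemma (in prob_space) indep_rv_sym:
  assumes "indep_rv M S U T V"
  shows "indep_rv M T V S U"
proof -
  have m: "U \<in> measurable M S" "V \<in> measurable M T"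
    and i: "indep_set {U -` A \<inter> space M | A. A \<in> sets S} {V -` A \<inter> space M | A. A \<in> sets T}"
    using assms by (auto simp: indep_rv_def)
  have "indep_set {V -` A \<inter> space M | A. A \<in> sets T} {U -` A \<inter> space M | A. A \<in> sets S}"
  proof (rule indep_setI)
    fix a b assume "a \<in> {V -` A \<inter> space M | A. A \<in> sets T}" "b \<in> {U -` A \<inter> space M | A. A \<in> sets S}"
    then show "prob (a \<inter> b) = prob a * prob b"
      using indep_setD[OF i, of b a] by (simp add: Int_commute mult.commute)
  qed (use m in \<open>auto intro: measurable_sets\<close>)
  then show ?thesis using m by (simp add: indep_rv_def)
qed

lemma borel_measurable_add_C01 [measurable (raw)]:
  fixes U V :: "'a \<Rightarrow> C01"
  assumes "U \<in> borel_measurable M" "V \<in> borel_measurable M"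
  shows "(\<lambda>\<omega>. U \<omega> + V \<omega>) \<in> borel_measurable M"
  by (rule measurable_C01I) (use assms in simp)

lemma borel_measurable_scaleR_C01 [measurable (raw)]:
  fixes V :: "'a \<Rightarrow> C01"
  assumes "f \<in> borel_measurable M" "V \<in> borel_measurable M"
  shows "(\<lambda>\<omega>. f \<omega> *\<^sub>R V \<omega>) \<in> borel_measurable M"
  by (rule measurable_C01I) (use assms in simp)

lemma norm_tail_vanishes:
  fixes \<mu> :: "'a::real_normed_vector measure"
  assumes "prob_space \<mu>" and s: "sets \<mu> = sets borel"
  shows "(\<lambda>\<kappa>::nat. measure \<mu> {z. real \<kappa> < norm z}) \<longlonglongrightarrow> 0"
proof -
  interpret w: prob_space \<mu> by fact
  have "(\<lambda>\<kappa>::nat. measure \<mu> {z. real \<kappa> < norm z}) \<longlonglongrightarrow> measure \<mu> (\<Inter>\<kappa>. {z. real \<kappa> < norm z})"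
    by (rule w.finite_Lim_measure_decseq) (auto simp: decseq_def s)
  moreover have "(\<Inter>\<kappa>. {w::'a. real \<kappa> < norm w}) = {}"
  proof (rule equals0I)
    fix w :: 'a assume w: "w \<in> (\<Inter>\<kappa>::nat. {w. real \<kappa> < norm w})"
    obtain k :: nat where "norm w \<le> real k" using real_arch_simple by blast
    moreover have "real k < norm w" using w by blast
    ultimately show False by simp
  qed
  ultimately show ?thesis by simp
qed

text \<open>The modulus of continuity at the dyadic distance \<open>1 / 2^m\<close>.\<close>

definition osc :: "nat \<Rightarrow> C01 \<Rightarrow> real" where
  "osc m z = (SUP p\<in>{p. dist (fst p) (snd p) \<le> 1 / 2 ^ m}. \<bar>z (fst p) - z (snd p)\<bar>)"

lemma osc_bdd: "bdd_above ((\<lambda>p. \<bar>z (fst p) - z (snd p)\<bar>) ` {p. dist (fst p) (snd p) \<le> 1 / 2 ^ m})"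
  for z :: C01
proof (rule bdd_aboveI2)
  fix p
  show "\<bar>z (fst p) - z (snd p)\<bar> \<le> 2 * norm z"
    using norm_bounded[of z "fst p"] norm_bounded[of z "snd p"] by simp
qed

lemma osc_ge:
  fixes z :: C01
  shows "dist s t \<le> 1 / 2 ^ m \<Longrightarrow> \<bar>z s - z t\<bar> \<le> osc m z"
  unfolding osc_def using cSUP_upper[OF _ osc_bdd, of "(s, t)" m z] by simp

lemma osc_le:
  fixes z :: C01
  assumes "\<And>s t. dist s t \<le> 1 / 2 ^ m \<Longrightarrow> \<bar>z s - z t\<bar> \<le> e"
  shows "osc m z \<le> e"
  unfolding osc_def
proof (rule cSUP_least)
  show "{p :: unit_interval \<times> unit_interval. dist (fst p) (snd p) \<le> 1 / 2 ^ m} \<noteq> {}"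
    using dist_self[of undefined] by (metis (mono_tags, lifting) empty_iff fst_conv mem_Collect_eq snd_conv
        zero_le_divide_1_iff zero_le_numeral zero_le_power)
qed (use assms in auto)

lemma osc_lipschitz: "\<bar>osc m z - osc m z'\<bar> \<le> 2 * dist z z'"
proof -
  have "osc m z \<le> osc m z' + 2 * dist z z'" for z z'
  proof (rule osc_le)
    fix s t :: unit_interval assume "dist s t \<le> 1 / 2 ^ m"
    then have "\<bar>z' s - z' t\<bar> \<le> osc m z'" by (rule osc_ge)
    moreover have "\<bar>z s - z' s\<bar> \<le> dist z z'" "\<bar>z t - z' t\<bar> \<le> dist z z'"
      using dist_bounded[of z _ z'] by (auto simp: dist_real_def)
    ultimately show "\<bar>z s - z t\<bar> \<le> osc m z' + 2 * dist z z'" by linarith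
  qed
  from this[of z z'] this[of z' z] show ?thesis by (simp add: dist_commute abs_le_iff)
qed

lemma lipschitz_measurable:
  fixes f :: "'a::metric_space \<Rightarrow> real"
  assumes "\<And>x y. \<bar>f x - f y\<bar> \<le> L * dist x y"
  shows "f \<in> borel_measurable borel"
proof (rule borel_measurable_continuous_onI)
  have "\<bar>L\<bar>-lipschitz_on UNIV f"
  proof (rule lipschitz_onI)
    fix x y show "dist (f x) (f y) \<le> \<bar>L\<bar> * dist x y"
      using assms[of x y] mult_right_mono[OF abs_ge_self[of L], of "dist x y"] by (simp add: dist_real_def)
  qed simp
  then show "continuous_on UNIV f" by (rule lipschitz_on_continuous_on)
qed

lemma osc_measurable [measurable]: "osc m \<in> borel_measurable borel"
  by (rule lipschitz_measurable[OF osc_lipschitz])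

lemma osc_tendsto_0: "(\<lambda>m. osc m z) \<longlonglongrightarrow> 0"
proof (rule tendstoI)
  fix e :: real assume "0 < e"
  then have "0 < e / 2" by simp
  from C01_uniformly_continuous[OF this, of z]
  obtain m0 where "\<And>m s t. m0 \<le> m \<Longrightarrow> dist s t \<le> 1 / 2 ^ m \<Longrightarrow> \<bar>z s - z t\<bar> \<le> e / 2"
    by blast
  then have "osc m z \<le> e / 2" if "m0 \<le> m" for m
    using that by (intro osc_le) auto
  moreover have "0 \<le> osc m z" for m
    using osc_ge[of undefined undefined m z] by simp
  ultimately show "\<forall>\<^sub>F m in sequentially. dist (osc m z) 0 < e"
    using \<open>0 < e\<close> by (intro eventually_sequentiallyI[of m0]) (fastforce simp: dist_real_def)
qed

lemma grid_excess_lipschitz: "\<bar>grid_excess m y z - grid_excess m y z'\<bar> \<le> dist z z'"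
proof -
  have "grid_excess m y z \<le> grid_excess m y z' + dist z z'" for z z'
    unfolding grid_excess_le_iff
  proof (intro allI impI)
    fix k :: nat assume k: "k \<le> 2 ^ m"
    have "z' (node m k) - real_of_unit (node m k) / 2 - y k \<le> grid_excess m y z'"
      using k grid_excess_le_iff[of m y z' "grid_excess m y z'"] by simp
    moreover have "\<bar>z (node m k) - z' (node m k)\<bar> \<le> dist z z'"
      using dist_bounded[of z _ z'] by (auto simp: dist_real_def)
    ultimately show "z (node m k) - real_of_unit (node m k) / 2 - y k \<le> grid_excess m y z' + dist z z'"
      by linarith
  qed
  from this[of z z'] this[of z' z] show ?thesis by (simp add: dist_commute abs_le_iff)
qed

lemma norm_lipschitz_dist: "\<bar>norm z - norm z'\<bar> \<le> dist z (z' :: 'a::real_normed_vector)"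
  by (simp add: dist_norm norm_triangle_ineq3)

text \<open>One member of each row of a triangular array: in row \<open>n\<close>, which has \<open>Suc n\<close> members, the path is
  \<open>X n + R n t - t/2 + \<delta> n t\<close>. The assumption \<open>X_left\<close> bounds Gaussian moments of the whole left tail.\<close>

locale typical_row = prob_space M for M :: "'a measure" +
  fixes X \<phi> :: "nat \<Rightarrow> 'a \<Rightarrow> real" and R \<delta> W :: "nat \<Rightarrow> 'a \<Rightarrow> C01" and q C :: real
  assumes X_m [measurable]: "X n \<in> borel_measurable M"
    and \<phi>_m [measurable]: "\<phi> n \<in> borel_measurable M"
    and R_m [measurable]: "R n \<in> borel_measurable M"
    and \<delta>_m [measurable]: "\<delta> n \<in> borel_measurable M"
    and X_tail: "(\<lambda>n. real (Suc n) * prob {\<omega>\<in>space M. s < X n \<omega>}) \<longlonglongrightarrow> exp (- s)"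
    and X_left: "0 < p \<Longrightarrow> \<exists>r K. \<forall>\<^sub>F n in sequentially.
      real (Suc n) * (\<integral>\<omega>. exp (- ((X n \<omega>)\<^sup>2) / p) * indicator {..- r} (X n \<omega>) \<partial>M) \<le> K"
    and W_bm: "bm_version M (\<lambda>t \<omega>. W n \<omega> (to_unit t)) (W n)"
    and W_X: "indep_rv M borel (W n) borel (X n)"
    and \<phi>_pos: "AE \<omega> in M. 0 < \<phi> n \<omega>"
    and XR_distr: "distr M (borel \<Otimes>\<^sub>M borel) (\<lambda>\<omega>. (X n \<omega>, R n \<omega>)) =
      distr M (borel \<Otimes>\<^sub>M borel) (\<lambda>\<omega>. (X n \<omega>, \<phi> n \<omega> *\<^sub>R W n \<omega>))"
    and q_pos: "0 < q"
    and \<phi>_bound: "(\<lambda>n. real (Suc n) * prob {\<omega>\<in>space M. q < \<phi> n \<omega>}) \<longlonglongrightarrow> 0"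
    and \<phi>_lim: "compact Q \<Longrightarrow> 0 < \<epsilon> \<Longrightarrow>
      (\<lambda>n. \<P>(\<omega> in M. \<bar>1 - \<phi> n \<omega>\<bar> > \<epsilon> \<bar> X n \<omega> \<in> Q)) \<longlonglongrightarrow> 0"
    and \<delta>_X: "indep_rv M borel (\<delta> n) borel (X n)"
    and \<delta>_lim: "0 < \<epsilon> \<Longrightarrow> (\<lambda>n. prob {\<omega>\<in>space M. \<epsilon> < norm (\<delta> n \<omega>)}) \<longlonglongrightarrow> 0"
    and C_pos: "0 < C"
    and \<delta>_bound: "(\<lambda>n. real (Suc n) * prob {\<omega>\<in>space M. C < norm (\<delta> n \<omega>)}) \<longlonglongrightarrow> 0"
begin

text \<open>The expected number of members of row \<open>n\<close> with property \<open>A\<close>.\<close>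

definition rate :: "nat \<Rightarrow> ('a \<Rightarrow> bool) \<Rightarrow> real" where
  "rate n A = real (Suc n) * prob {\<omega>\<in>space M. A \<omega>}"

lemma rate_nonneg: "0 \<le> rate n A"
  by (simp add: rate_def)

lemma rate_mono_AE:
  assumes "AE \<omega> in M. A \<omega> \<longrightarrow> B \<omega>" "Measurable.pred M B"
  shows "rate n A \<le> rate n B"
  unfolding rate_def
proof (intro mult_left_mono finite_measure_mono_AE)
  show "AE \<omega> in M. \<omega> \<in> {\<omega>\<in>space M. A \<omega>} \<longrightarrow> \<omega> \<in> {\<omega>\<in>space M. B \<omega>}"
    using assms(1) by eventually_elim auto
  show "{\<omega>\<in>space M. B \<omega>} \<in> sets M" using assms(2) by measurable
qed simp

lemma rate_subadd_AE:
  assumes "AE \<omega> in M. A \<omega> \<longrightarrow> B \<omega> \<or> D \<omega>" "Measurable.pred M B" "Measurable.pred M D"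
  shows "rate n A \<le> rate n B + rate n D"
proof -
  have s: "{\<omega>\<in>space M. B \<omega>} \<in> sets M" "{\<omega>\<in>space M. D \<omega>} \<in> sets M" using assms(2,3) by measurable
  have "rate n A \<le> rate n (\<lambda>\<omega>. B \<omega> \<or> D \<omega>)"
    by (rule rate_mono_AE[OF assms(1)]) (use assms in measurable)
  also have "\<dots> \<le> real (Suc n) * (prob {\<omega>\<in>space M. B \<omega>} + prob {\<omega>\<in>space M. D \<omega>})"
    unfolding rate_def
  proof (rule mult_left_mono)
    have "{\<omega>\<in>space M. B \<omega> \<or> D \<omega>} = {\<omega>\<in>space M. B \<omega>} \<union> {\<omega>\<in>space M. D \<omega>}" by auto
    then show "prob {\<omega>\<in>space M. B \<omega> \<or> D \<omega>} \<le> prob {\<omega>\<in>space M. B \<omega>} + prob {\<omega>\<in>space M. D \<omega>}"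
      using measure_Un_le[OF s] by simp
  qed simp
  finally show ?thesis by (simp add: rate_def distrib_left)
qed

lemma rate_subadd:
  assumes "\<And>\<omega>. A \<omega> \<Longrightarrow> B \<omega> \<or> D \<omega>" "Measurable.pred M B" "Measurable.pred M D"
  shows "rate n A \<le> rate n B + rate n D"
  by (rule rate_subadd_AE) (use assms in auto)

lemma rate_X: "(\<lambda>n. rate n (\<lambda>\<omega>. s < X n \<omega>)) \<longlonglongrightarrow> exp (- s)"
  unfolding rate_def by (rule X_tail)

definition wiener :: "C01 measure" where
  "wiener = distr M borel (W 0)"

lemma W_m [measurable]: "W n \<in> borel_measurable M"
  using W_bm[of n] by (simp add: bm_version_def)

lemma prob_wiener: "prob_space wiener"
  unfolding wiener_def by (rule prob_space_distr) measurable

lemma sets_wiener [measurable_cong]: "sets wiener = sets borel"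
  by (simp add: wiener_def)

lemma space_wiener: "space wiener = UNIV"
  by (simp add: wiener_def)

lemma W_law: "distr M borel (W n) = wiener"
  unfolding wiener_def by (rule bm_law_unique[OF W_bm W_bm])

lemma prob_W:
  assumes "A \<in> sets borel"
  shows "prob {\<omega>\<in>space M. W n \<omega> \<in> A} = measure wiener A"
  unfolding W_law[symmetric, of n] using assms
  by (subst measure_distr) (auto intro!: arg_cong[where f=prob])

lemma wiener_exp_norm: "integrable wiener (\<lambda>w. exp (norm w))"
proof (rule integrableI_bounded)
  have "(\<integral>\<^sup>+w. ennreal (exp (norm w)) \<partial>wiener) < \<infinity>"
    unfolding wiener_def using bm_exp_norm_finite[OF W_bm[of 0]] by (subst nn_integral_distr) auto
  then show "(\<integral>\<^sup>+w. ennreal (norm (exp (norm w))) \<partial>wiener) < \<infinity>" by simp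
qed measurable

lemmas wiener_norm_small = norm_tail_vanishes[OF prob_wiener sets_wiener]

lemma rate_indep:
  assumes "A \<in> sets borel"
  shows "(\<lambda>n. rate n (\<lambda>\<omega>. - r < X n \<omega> \<and> W n \<omega> \<in> A)) \<longlonglongrightarrow> exp r * measure wiener A"
proof -
  have "rate n (\<lambda>\<omega>. - r < X n \<omega> \<and> W n \<omega> \<in> A) = rate n (\<lambda>\<omega>. - r < X n \<omega>) * measure wiener A" for n
    using indep_rv_prob[OF W_X assms, of "{- r<..}"] prob_W[OF assms, of n]
    unfolding rate_def by (simp add: conj_commute mult.commute)
  then show ?thesis using tendsto_mult[OF rate_X[of "- r"] tendsto_const] by simp
qed

text \<open>Given the Brownian path \<open>w\<close>, the rate at which \<open>X\<close> exceeds the level \<open>max (- r) (c - g w)\<close> tends to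
  \<open>exp (min r (g w - c))\<close>; the truncation at \<open>- r\<close> makes these rates bounded, so that the limit may be
  taken under the integral over \<open>w\<close>.\<close>

lemma rate_excess:
  assumes g [measurable]: "g \<in> borel_measurable borel"
  shows "(\<lambda>n. rate n (\<lambda>\<omega>. - r < X n \<omega> \<and> c < X n \<omega> + g (W n \<omega>)))
    \<longlonglongrightarrow> (\<integral>w. exp (min r (g w - c)) \<partial>wiener)"
proof -
  interpret w: prob_space wiener by (rule prob_wiener)
  define G where "G n s = prob {\<omega>\<in>space M. s < X n \<omega>}" for n s
  have Gmono: "s \<le> t \<Longrightarrow> G n t \<le> G n s" for n s t
    unfolding G_def by (intro finite_measure_mono) auto
  have Gm [measurable]: "G n \<in> borel_measurable borel" for n
  proof -
    have "(\<lambda>s. - G n s) \<in> borel_measurable borel"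
      by (rule borel_measurable_mono) (auto simp: mono_def Gmono)
    then have "(\<lambda>s. - (- G n s)) \<in> borel_measurable borel" by measurable
    then show ?thesis by simp
  qed
  have G1: "G n s \<le> 1" "0 \<le> G n s" for n s unfolding G_def by auto
  have eq: "prob {\<omega>\<in>space M. - r < X n \<omega> \<and> c < X n \<omega> + g (W n \<omega>)} =
      (\<integral>w. G n (max (- r) (c - g w)) \<partial>wiener)" for n
  proof -
    have "indep_rv M borel (\<lambda>\<omega>. g (W n \<omega>)) borel (\<lambda>\<omega>. X n \<omega>)"
      by (rule indep_rv_compose[OF W_X]) (auto simp: measurable_ident)
    then have iv: "indep_var borel (\<lambda>\<omega>. g (W n \<omega>)) borel (\<lambda>\<omega>. X n \<omega>)"
      by (simp add: indep_rv_iff_indep_var)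
    have "{p\<in>space (borel \<Otimes>\<^sub>M borel). - r < (snd p :: real) \<and> c < snd p + (fst p :: real)} \<in> sets (borel \<Otimes>\<^sub>M borel)"
      by measurable
    then have Q: "{p. - r < (snd p :: real) \<and> c < snd p + (fst p :: real)} \<in> sets (borel \<Otimes>\<^sub>M borel)"
      by (simp add: space_pair_measure)
    have "emeasure M {\<omega>\<in>space M. - r < X n \<omega> \<and> c < X n \<omega> + g (W n \<omega>)} =
        (\<integral>\<^sup>+\<omega>. emeasure M {\<omega>'\<in>space M. - r < X n \<omega>' \<and> c < X n \<omega>' + g (W n \<omega>)} \<partial>M)"
      using indep_var_fubini[OF iv Q] by simp
    also have "\<dots> = (\<integral>\<^sup>+\<omega>. ennreal (G n (max (- r) (c - g (W n \<omega>)))) \<partial>M)"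
      unfolding G_def
      by (intro nn_integral_cong) (auto simp: emeasure_eq_measure intro!: arg_cong[where f=prob])
    also have "\<dots> = (\<integral>\<^sup>+w. ennreal (G n (max (- r) (c - g w))) \<partial>wiener)"
      unfolding W_law[symmetric, of n] by (subst nn_integral_distr) auto
    also have "\<dots> = ennreal (\<integral>w. G n (max (- r) (c - g w)) \<partial>wiener)"
      by (rule nn_integral_eq_integral) (auto intro!: w.integrable_const_bound[where B=1] simp: G1)
    finally show ?thesis
      by (simp add: emeasure_eq_measure G1 integral_nonneg_AE)
  qed
  have "Bseq (\<lambda>n. rate n (\<lambda>\<omega>. - r < X n \<omega>))"
    using rate_X convergent_imp_Bseq convergentI by blast
  then obtain K where K: "\<And>n. norm (rate n (\<lambda>\<omega>. - r < X n \<omega>)) \<le> K" unfolding Bseq_def by blast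
  have "(\<lambda>n. \<integral>w. real (Suc n) * G n (max (- r) (c - g w)) \<partial>wiener) \<longlonglongrightarrow>
      (\<integral>w. exp (min r (g w - c)) \<partial>wiener)"
  proof (rule integral_dominated_convergence[where w="\<lambda>_. K"])
    show "AE w in wiener. (\<lambda>n. real (Suc n) * G n (max (- r) (c - g w))) \<longlonglongrightarrow> exp (min r (g w - c))"
    proof (rule AE_I2)
      fix w
      have "- max (- r) (c - g w) = min r (g w - c)" by (simp add: max_def min_def)
      then show "(\<lambda>n. real (Suc n) * G n (max (- r) (c - g w))) \<longlonglongrightarrow> exp (min r (g w - c))"
        using X_tail[of "max (- r) (c - g w)"] unfolding G_def by simp
    qed
    show "AE w in wiener. norm (real (Suc n) * G n (max (- r) (c - g w))) \<le> K" for n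
    proof (rule AE_I2)
      fix w
      have "norm (real (Suc n) * G n (max (- r) (c - g w))) = real (Suc n) * G n (max (- r) (c - g w))"
        using G1 by simp
      also have "\<dots> \<le> real (Suc n) * G n (- r)" by (intro mult_left_mono Gmono) auto
      also have "\<dots> \<le> K" using K[of n] unfolding rate_def G_def by simp
      finally show "norm (real (Suc n) * G n (max (- r) (c - g w))) \<le> K" .
    qed
  qed (auto simp: w.integrable_const)
  then show ?thesis unfolding rate_def eq by simp
qed

text \<open>The rate at which, above level \<open>- r\<close>, the path \<open>R + \<delta>\<close> fails to be close to a Brownian path: in the
  first term because of \<open>\<delta>\<close>, in the second because of the random scaling \<open>\<phi>\<close>.\<close>

definition err :: "real \<Rightarrow> real \<Rightarrow> nat \<Rightarrow> real" where
  "err r \<epsilon> n = rate n (\<lambda>\<omega>. - r < X n \<omega> \<and> \<epsilon> < norm (\<delta> n \<omega>)) +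
    rate n (\<lambda>\<omega>. - r < X n \<omega> \<and> \<epsilon> < norm ((\<phi> n \<omega> - 1) *\<^sub>R W n \<omega>))"

text \<open>Independence of \<open>\<delta>\<close> and \<open>X\<close> settles the first term. In the second one, points above a high level \<open>L\<close>
  and Brownian paths of norm above \<open>\<kappa>\<close> have small rates; on the rest \<open>X\<close> lies in a compact set, and
  there \<open>\<phi>\<close> is close to one.\<close>

lemma err_tendsto_0:
  assumes \<epsilon>: "0 < \<epsilon>"
  shows "err r \<epsilon> \<longlonglongrightarrow> 0"
proof -
  have "rate n (\<lambda>\<omega>. - r < X n \<omega> \<and> \<epsilon> < norm (\<delta> n \<omega>)) =
      rate n (\<lambda>\<omega>. - r < X n \<omega>) * prob {\<omega>\<in>space M. \<epsilon> < norm (\<delta> n \<omega>)}" for n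
  proof -
    have "{z :: C01. \<epsilon> < norm z} \<in> sets borel" by measurable
    from indep_rv_prob[OF \<delta>_X this, of "{- r<..}" n] show ?thesis
      unfolding rate_def by (simp add: conj_commute mult.commute)
  qed
  then have 1: "(\<lambda>n. rate n (\<lambda>\<omega>. - r < X n \<omega> \<and> \<epsilon> < norm (\<delta> n \<omega>))) \<longlonglongrightarrow> 0"
    using tendsto_mult[OF rate_X[of "- r"] \<delta>_lim[OF \<epsilon>]] by simp
  have 2: "(\<lambda>n. rate n (\<lambda>\<omega>. - r < X n \<omega> \<and> \<epsilon> < norm ((\<phi> n \<omega> - 1) *\<^sub>R W n \<omega>))) \<longlonglongrightarrow> 0"
    (is "?A \<longlonglongrightarrow> 0")
  proof (rule order_tendstoI)
    fix \<eta> :: real assume \<eta>: "0 < \<eta>"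
    obtain L where L: "exp (- L) < \<eta> / 3"
      using \<eta> by (metis exp_less_cancel_iff exp_ln gt_ex minus_less_iff zero_less_divide_iff zero_less_numeral)
    have "(\<lambda>\<kappa>::nat. exp r * measure wiener {w. real \<kappa> < norm w}) \<longlonglongrightarrow> exp r * 0"
      by (intro tendsto_mult tendsto_const wiener_norm_small)
    then have "\<forall>\<^sub>F \<kappa> in sequentially. exp r * measure wiener {w. real \<kappa> < norm w} < \<eta> / 3"
      by (rule order_tendstoD) (use \<eta> in simp)
    then obtain \<kappa>0 where "\<And>\<kappa>. \<kappa>0 \<le> \<kappa> \<Longrightarrow> exp r * measure wiener {w. real \<kappa> < norm w} < \<eta> / 3"
      by (auto simp: eventually_sequentially)
    then obtain \<kappa> :: nat where \<kappa>: "0 < \<kappa>" "exp r * measure wiener {w. real \<kappa> < norm w} < \<eta> / 3"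
      by (metis le_add1 zero_less_Suc add_Suc_right less_eq_Suc_le le_SucI)
    define Q where "Q = {- r..L}"
    have Qm [measurable]: "Q \<in> sets borel" by (simp add: Q_def)
    have le: "?A n \<le> rate n (\<lambda>\<omega>. L < X n \<omega>) + rate n (\<lambda>\<omega>. - r < X n \<omega> \<and> W n \<omega> \<in> {w. real \<kappa> < norm w}) +
        rate n (\<lambda>\<omega>. X n \<omega> \<in> Q \<and> \<epsilon> / \<kappa> < \<bar>1 - \<phi> n \<omega>\<bar>)" for n
    proof -
      have "?A n \<le> rate n (\<lambda>\<omega>. L < X n \<omega> \<or> - r < X n \<omega> \<and> W n \<omega> \<in> {w. real \<kappa> < norm w}) +
          rate n (\<lambda>\<omega>. X n \<omega> \<in> Q \<and> \<epsilon> / \<kappa> < \<bar>1 - \<phi> n \<omega>\<bar>)"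
      proof (rule rate_subadd)
        fix \<omega> assume a: "- r < X n \<omega> \<and> \<epsilon> < norm ((\<phi> n \<omega> - 1) *\<^sub>R W n \<omega>)"
        show "(L < X n \<omega> \<or> - r < X n \<omega> \<and> W n \<omega> \<in> {w. real \<kappa> < norm w}) \<or> X n \<omega> \<in> Q \<and> \<epsilon> / \<kappa> < \<bar>1 - \<phi> n \<omega>\<bar>"
        proof (cases "real \<kappa> < norm (W n \<omega>)")
          case False
          have "\<epsilon> < \<bar>\<phi> n \<omega> - 1\<bar> * norm (W n \<omega>)" using a by simp
          also have "\<dots> \<le> \<bar>1 - \<phi> n \<omega>\<bar> * \<kappa>" using False by (simp add: mult_left_mono abs_minus_commute)
          finally have "\<epsilon> / \<kappa> < \<bar>1 - \<phi> n \<omega>\<bar>" using \<kappa> by (simp add: pos_divide_less_eq)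
          then show ?thesis using a by (auto simp: Q_def)
        qed (use a in auto)
      qed measurable
      also have "rate n (\<lambda>\<omega>. L < X n \<omega> \<or> - r < X n \<omega> \<and> W n \<omega> \<in> {w. real \<kappa> < norm w}) \<le>
          rate n (\<lambda>\<omega>. L < X n \<omega>) + rate n (\<lambda>\<omega>. - r < X n \<omega> \<and> W n \<omega> \<in> {w. real \<kappa> < norm w})"
        by (rule rate_subadd) (auto, measurable)
      finally show ?thesis by simp
    qed
    have third: "rate n (\<lambda>\<omega>. X n \<omega> \<in> Q \<and> \<epsilon> / \<kappa> < \<bar>1 - \<phi> n \<omega>\<bar>) \<le>
        rate n (\<lambda>\<omega>. - r - 1 < X n \<omega>) * \<P>(\<omega> in M. \<bar>1 - \<phi> n \<omega>\<bar> > \<epsilon> / \<kappa> \<bar> X n \<omega> \<in> Q)" for n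
    proof -
      let ?c = "\<P>(\<omega> in M. \<bar>1 - \<phi> n \<omega>\<bar> > \<epsilon> / \<kappa> \<bar> X n \<omega> \<in> Q)"
      have sub: "prob {\<omega>\<in>space M. X n \<omega> \<in> Q \<and> \<epsilon> / \<kappa> < \<bar>1 - \<phi> n \<omega>\<bar>} \<le> prob {\<omega>\<in>space M. X n \<omega> \<in> Q}"
        by (rule finite_measure_mono) auto
      have c0: "0 \<le> ?c" by (simp add: cond_prob_def)
      have "prob {\<omega>\<in>space M. X n \<omega> \<in> Q \<and> \<epsilon> / \<kappa> < \<bar>1 - \<phi> n \<omega>\<bar>} = prob {\<omega>\<in>space M. X n \<omega> \<in> Q} * ?c"
      proof (cases "prob {\<omega>\<in>space M. X n \<omega> \<in> Q} = 0")
        case True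
        then show ?thesis using sub measure_nonneg[of M "{\<omega>\<in>space M. X n \<omega> \<in> Q \<and> \<epsilon> / \<kappa> < \<bar>1 - \<phi> n \<omega>\<bar>}"] by simp
      next
        case False
        then show ?thesis by (simp add: cond_prob_def conj_commute)
      qed
      moreover have "prob {\<omega>\<in>space M. X n \<omega> \<in> Q} \<le> prob {\<omega>\<in>space M. - r - 1 < X n \<omega>}"
        by (rule finite_measure_mono) (auto simp: Q_def)
      ultimately show ?thesis
        unfolding rate_def using c0 by (simp add: mult.assoc mult_left_mono mult_right_mono)
    qed
    have l1: "\<forall>\<^sub>F n in sequentially. rate n (\<lambda>\<omega>. L < X n \<omega>) < \<eta> / 3"
      by (rule order_tendstoD[OF rate_X]) (rule L)
    have l2: "\<forall>\<^sub>F n in sequentially. rate n (\<lambda>\<omega>. - r < X n \<omega> \<and> W n \<omega> \<in> {w. real \<kappa> < norm w}) < \<eta> / 3"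
      by (rule order_tendstoD[OF rate_indep]) (use \<kappa> in auto)
    have "(\<lambda>n. rate n (\<lambda>\<omega>. - r - 1 < X n \<omega>) * \<P>(\<omega> in M. \<bar>1 - \<phi> n \<omega>\<bar> > \<epsilon> / \<kappa> \<bar> X n \<omega> \<in> Q)) \<longlonglongrightarrow> exp (- (- r - 1)) * 0"
      using \<epsilon> \<kappa> by (intro tendsto_mult rate_X \<phi>_lim) (auto simp: Q_def)
    then have l3: "\<forall>\<^sub>F n in sequentially. rate n (\<lambda>\<omega>. - r - 1 < X n \<omega>) * \<P>(\<omega> in M. \<bar>1 - \<phi> n \<omega>\<bar> > \<epsilon> / \<kappa> \<bar> X n \<omega> \<in> Q) < \<eta> / 3"
      by (rule order_tendstoD) (use \<eta> in simp)
    from l1 l2 l3 show "\<forall>\<^sub>F n in sequentially. ?A n < \<eta>"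
    proof eventually_elim
      case (elim n)
      then show ?case using le[of n] third[of n] by linarith
    qed
  next
    fix \<eta> :: real assume "\<eta> < 0"
    then show "\<forall>\<^sub>F n in sequentially. \<eta> < ?A n"
      by (intro always_eventually allI less_le_trans[OF _ rate_nonneg])
  qed
  show ?thesis unfolding err_def[abs_def] using tendsto_add[OF 1 2] by simp
qed

end

section \<open>Exceedance rates\<close>

context typical_row
begin

lemma XR_rate:
  assumes S: "S \<in> sets (borel \<Otimes>\<^sub>M borel)"
  shows "rate n (\<lambda>\<omega>. (X n \<omega>, R n \<omega>) \<in> S) = rate n (\<lambda>\<omega>. (X n \<omega>, \<phi> n \<omega> *\<^sub>R W n \<omega>) \<in> S)"
proof -
  have "prob {\<omega>\<in>space M. (X n \<omega>, U \<omega>) \<in> S} =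
      measure (distr M (borel \<Otimes>\<^sub>M borel) (\<lambda>\<omega>. (X n \<omega>, U \<omega>))) S"
    if [measurable]: "U \<in> borel_measurable M" for U :: "'a \<Rightarrow> C01"
    using S by (subst measure_distr) (auto intro!: arg_cong[where f=prob])
  from this[OF R_m] this[of "\<lambda>\<omega>. \<phi> n \<omega> *\<^sub>R W n \<omega>"] show ?thesis
    unfolding rate_def by (simp add: XR_distr)
qed

text \<open>A functional that is Lipschitz in the path distinguishes \<open>R + \<delta>\<close> from a Brownian path only up to a
  shift of its level by \<open>2 * \<epsilon>\<close> and the rate \<open>err\<close>. Since \<open>(X, R)\<close> agrees with \<open>(X, \<phi> W)\<close> only in law, the
  replacement goes in two steps, \<open>R + \<delta> \<rightarrow> R\<close> and \<open>\<phi> W \<rightarrow> W\<close>.\<close>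

lemma sandwich:
  fixes H :: "real \<Rightarrow> C01 \<Rightarrow> real"
  assumes Hm: "(\<lambda>p. H (fst p) (snd p)) \<in> borel_measurable (borel \<Otimes>\<^sub>M borel)"
    and HL: "\<And>x z z'. \<bar>H x z - H x z'\<bar> \<le> dist z z'"
  shows "rate n (\<lambda>\<omega>. - r < X n \<omega> \<and> c < H (X n \<omega>) (R n \<omega> + \<delta> n \<omega>)) \<le>
      rate n (\<lambda>\<omega>. - r < X n \<omega> \<and> c - 2 * \<epsilon> < H (X n \<omega>) (W n \<omega>)) + err r \<epsilon> n" (is ?upper)
    and "rate n (\<lambda>\<omega>. - r < X n \<omega> \<and> c + 2 * \<epsilon> < H (X n \<omega>) (W n \<omega>)) \<le>
      rate n (\<lambda>\<omega>. - r < X n \<omega> \<and> c < H (X n \<omega>) (R n \<omega> + \<delta> n \<omega>)) + err r \<epsilon> n" (is ?lower)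
proof -
  have Hc [measurable]: "(\<lambda>\<omega>. H (X n \<omega>) (U \<omega>)) \<in> borel_measurable M"
    if [measurable]: "U \<in> borel_measurable M" for U
    using measurable_compose[OF _ Hm, of "\<lambda>\<omega>. (X n \<omega>, U \<omega>)" M] by simp
  have close: "H (X n \<omega>) z - norm d \<le> H (X n \<omega>) (z + d)" "H (X n \<omega>) (z + d) \<le> H (X n \<omega>) z + norm d" for \<omega> z d
    using HL[of "X n \<omega>" "z + d" z] by (auto simp: dist_norm abs_le_iff)
  have eqR: "rate n (\<lambda>\<omega>. - r < X n \<omega> \<and> c' < H (X n \<omega>) (R n \<omega>)) =
      rate n (\<lambda>\<omega>. - r < X n \<omega> \<and> c' < H (X n \<omega>) (\<phi> n \<omega> *\<^sub>R W n \<omega>))" for c'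
  proof -
    have "{p\<in>space (borel \<Otimes>\<^sub>M borel). - r < fst p \<and> c' < H (fst p) (snd p)} \<in> sets (borel \<Otimes>\<^sub>M borel)"
      using Hm by measurable
    then have "{p. - r < fst p \<and> c' < H (fst p) (snd p)} \<in> sets (borel \<Otimes>\<^sub>M borel)"
      by (simp add: space_pair_measure)
    from XR_rate[OF this, of n] show ?thesis by simp
  qed
  have W: "W n \<omega> + (\<phi> n \<omega> - 1) *\<^sub>R W n \<omega> = \<phi> n \<omega> *\<^sub>R W n \<omega>" for \<omega>
    by (simp add: algebra_simps)
  have "rate n (\<lambda>\<omega>. - r < X n \<omega> \<and> c < H (X n \<omega>) (R n \<omega> + \<delta> n \<omega>)) \<le>
      rate n (\<lambda>\<omega>. - r < X n \<omega> \<and> \<epsilon> < norm (\<delta> n \<omega>)) + rate n (\<lambda>\<omega>. - r < X n \<omega> \<and> c - \<epsilon> < H (X n \<omega>) (R n \<omega>))"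
  proof (rule rate_subadd)
    fix \<omega> assume "- r < X n \<omega> \<and> c < H (X n \<omega>) (R n \<omega> + \<delta> n \<omega>)"
    then show "(- r < X n \<omega> \<and> \<epsilon> < norm (\<delta> n \<omega>)) \<or> (- r < X n \<omega> \<and> c - \<epsilon> < H (X n \<omega>) (R n \<omega>))"
      using close(2)[of \<omega> "R n \<omega>" "\<delta> n \<omega>"] by linarith
  qed measurable
  moreover have "rate n (\<lambda>\<omega>. - r < X n \<omega> \<and> c - \<epsilon> < H (X n \<omega>) (\<phi> n \<omega> *\<^sub>R W n \<omega>)) \<le>
      rate n (\<lambda>\<omega>. - r < X n \<omega> \<and> \<epsilon> < norm ((\<phi> n \<omega> - 1) *\<^sub>R W n \<omega>)) +
      rate n (\<lambda>\<omega>. - r < X n \<omega> \<and> c - 2 * \<epsilon> < H (X n \<omega>) (W n \<omega>))"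
  proof (rule rate_subadd)
    fix \<omega> assume "- r < X n \<omega> \<and> c - \<epsilon> < H (X n \<omega>) (\<phi> n \<omega> *\<^sub>R W n \<omega>)"
    then show "(- r < X n \<omega> \<and> \<epsilon> < norm ((\<phi> n \<omega> - 1) *\<^sub>R W n \<omega>)) \<or> (- r < X n \<omega> \<and> c - 2 * \<epsilon> < H (X n \<omega>) (W n \<omega>))"
      using close(2)[of \<omega> "W n \<omega>" "(\<phi> n \<omega> - 1) *\<^sub>R W n \<omega>"] unfolding W by linarith
  qed measurable
  ultimately show ?upper unfolding eqR err_def by linarith
  have "rate n (\<lambda>\<omega>. - r < X n \<omega> \<and> c + 2 * \<epsilon> < H (X n \<omega>) (W n \<omega>)) \<le>
      rate n (\<lambda>\<omega>. - r < X n \<omega> \<and> \<epsilon> < norm ((\<phi> n \<omega> - 1) *\<^sub>R W n \<omega>)) +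
      rate n (\<lambda>\<omega>. - r < X n \<omega> \<and> c + \<epsilon> < H (X n \<omega>) (\<phi> n \<omega> *\<^sub>R W n \<omega>))"
  proof (rule rate_subadd)
    fix \<omega> assume "- r < X n \<omega> \<and> c + 2 * \<epsilon> < H (X n \<omega>) (W n \<omega>)"
    then show "(- r < X n \<omega> \<and> \<epsilon> < norm ((\<phi> n \<omega> - 1) *\<^sub>R W n \<omega>)) \<or> (- r < X n \<omega> \<and> c + \<epsilon> < H (X n \<omega>) (\<phi> n \<omega> *\<^sub>R W n \<omega>))"
      using close(1)[of \<omega> "W n \<omega>" "(\<phi> n \<omega> - 1) *\<^sub>R W n \<omega>"] unfolding W by linarith
  qed measurable
  moreover have "rate n (\<lambda>\<omega>. - r < X n \<omega> \<and> c + \<epsilon> < H (X n \<omega>) (R n \<omega>)) \<le>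
      rate n (\<lambda>\<omega>. - r < X n \<omega> \<and> \<epsilon> < norm (\<delta> n \<omega>)) +
      rate n (\<lambda>\<omega>. - r < X n \<omega> \<and> c < H (X n \<omega>) (R n \<omega> + \<delta> n \<omega>))"
  proof (rule rate_subadd)
    fix \<omega> assume "- r < X n \<omega> \<and> c + \<epsilon> < H (X n \<omega>) (R n \<omega>)"
    then show "(- r < X n \<omega> \<and> \<epsilon> < norm (\<delta> n \<omega>)) \<or> (- r < X n \<omega> \<and> c < H (X n \<omega>) (R n \<omega> + \<delta> n \<omega>))"
      using close(1)[of \<omega> "R n \<omega>" "\<delta> n \<omega>"] by linarith
  qed measurable
  ultimately show ?lower unfolding eqR[symmetric] err_def by linarith
qed

text \<open>If \<open>X = x \<le> - r\<close> and \<open>- \<kappa> < x + q * norm W\<close>, then \<open>norm W > - x / (2 * q)\<close>, which has probability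
  at most \<open>4 * exp (- x\<^sup>2 / (256 * q\<^sup>2))\<close>. One half of the exponent is spent on the factor that is
  small in \<open>r\<close>, the other half on the Gaussian moment of the left tail.\<close>

lemma gaussian_left_tail:
  assumes \<kappa>: "0 \<le> \<kappa>" and r: "2 * \<kappa> \<le> r" "64 * q \<le> r"
  shows "prob {\<omega>\<in>space M. X n \<omega> \<le> - r \<and> - \<kappa> < X n \<omega> + q * norm (W n \<omega>)} \<le>
    4 * exp (- (r\<^sup>2 / (512 * q\<^sup>2))) *
      (\<integral>\<omega>. exp (- ((X n \<omega>)\<^sup>2) / (512 * q\<^sup>2)) * indicator {..- r} (X n \<omega>) \<partial>M)"
proof -
  define f where "f x = 4 * exp (- (r\<^sup>2 / (512 * q\<^sup>2))) * (exp (- x\<^sup>2 / (512 * q\<^sup>2)) * indicator {..- r} x)" for x :: real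
  have f0: "0 \<le> f x" for x by (simp add: f_def)
  have fm [measurable]: "f \<in> borel_measurable borel" unfolding f_def[abs_def] by measurable
  have "indep_rv M borel (\<lambda>\<omega>. X n \<omega>) borel (\<lambda>\<omega>. norm (W n \<omega>))"
    by (rule indep_rv_compose[OF indep_rv_sym[OF W_X]]) (auto simp: measurable_ident)
  then have iv: "indep_var borel (\<lambda>\<omega>. X n \<omega>) borel (\<lambda>\<omega>. norm (W n \<omega>))"
    by (simp add: indep_rv_iff_indep_var)
  have "{p\<in>space (borel \<Otimes>\<^sub>M borel). fst p \<le> - r \<and> - \<kappa> < fst p + q * (snd p :: real)} \<in> sets (borel \<Otimes>\<^sub>M borel)"
    by measurable
  then have Q: "{p. fst p \<le> - r \<and> - \<kappa> < fst p + q * (snd p :: real)} \<in> sets (borel \<Otimes>\<^sub>M borel)"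
    by (simp add: space_pair_measure)
  have inner: "emeasure M {\<omega>'\<in>space M. x \<le> - r \<and> - \<kappa> < x + q * norm (W n \<omega>')} \<le> ennreal (f x)" for x
  proof (cases "x \<le> - r")
    case True
    define u where "u = - x / (2 * q)"
    have x0: "0 \<le> - x" using True \<kappa> r by linarith
    have u: "32 \<le> u" unfolding u_def using True r q_pos by (simp add: field_simps)
    have "emeasure M {\<omega>'\<in>space M. x \<le> - r \<and> - \<kappa> < x + q * norm (W n \<omega>')} \<le>
        emeasure M {\<omega>'\<in>space M. u < norm (W n \<omega>')}"
    proof (intro emeasure_mono subsetI)
      fix \<omega>' assume "\<omega>' \<in> {\<omega>'\<in>space M. x \<le> - r \<and> - \<kappa> < x + q * norm (W n \<omega>')}"
      then have "\<omega>' \<in> space M" "- x / 2 < q * norm (W n \<omega>')" using True r by auto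
      then show "\<omega>' \<in> {\<omega>'\<in>space M. u < norm (W n \<omega>')}"
        using q_pos unfolding u_def by (simp add: field_simps)
    qed measurable
    also have "\<dots> \<le> ennreal (4 * exp (- (u\<^sup>2 / 64)))"
      by (rule bm_norm_tail[OF W_bm u])
    also have "\<dots> \<le> ennreal (f x)"
    proof (rule ennreal_leI)
      have "u\<^sup>2 / 64 = x\<^sup>2 / (512 * q\<^sup>2) + x\<^sup>2 / (512 * q\<^sup>2)"
        using q_pos unfolding u_def by (simp add: power_divide power_mult_distrib field_simps)
      moreover have "r\<^sup>2 \<le> x\<^sup>2"
        using True \<kappa> r power_mono[of r "- x" 2] by simp
      then have "r\<^sup>2 / (512 * q\<^sup>2) \<le> x\<^sup>2 / (512 * q\<^sup>2)"
        by (rule divide_right_mono) simp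
      ultimately have "- (u\<^sup>2 / 64) \<le> - (r\<^sup>2 / (512 * q\<^sup>2)) + - x\<^sup>2 / (512 * q\<^sup>2)" by simp
      then have "exp (- (u\<^sup>2 / 64)) \<le> exp (- (r\<^sup>2 / (512 * q\<^sup>2))) * exp (- x\<^sup>2 / (512 * q\<^sup>2))"
        unfolding exp_add[symmetric] exp_le_cancel_iff .
      then show "4 * exp (- (u\<^sup>2 / 64)) \<le> f x" using True by (simp add: f_def)
    qed
    finally show ?thesis .
  qed (simp add: f_def)
  have "emeasure M {\<omega>\<in>space M. X n \<omega> \<le> - r \<and> - \<kappa> < X n \<omega> + q * norm (W n \<omega>)} =
      (\<integral>\<^sup>+\<omega>. emeasure M {\<omega>'\<in>space M. X n \<omega> \<le> - r \<and> - \<kappa> < X n \<omega> + q * norm (W n \<omega>')} \<partial>M)"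
    using indep_var_fubini[OF iv Q] by simp
  also have "\<dots> \<le> (\<integral>\<^sup>+\<omega>. ennreal (f (X n \<omega>)) \<partial>M)"
    by (intro nn_integral_mono inner)
  also have "\<dots> = ennreal (\<integral>\<omega>. f (X n \<omega>) \<partial>M)"
  proof (rule nn_integral_eq_integral)
    have "f x \<le> 4" for x
    proof -
      have "exp (- (r\<^sup>2 / (512 * q\<^sup>2))) \<le> 1" "exp (- x\<^sup>2 / (512 * q\<^sup>2)) \<le> 1" by auto
      then have "exp (- (r\<^sup>2 / (512 * q\<^sup>2))) * (exp (- x\<^sup>2 / (512 * q\<^sup>2)) * indicator {..- r} x) \<le> 1 * (1 * 1)"
        by (intro mult_mono) (auto simp: indicator_def)
      then show ?thesis by (simp add: f_def)
    qed
    then show "integrable M (\<lambda>\<omega>. f (X n \<omega>))"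
      using f0 by (intro integrable_const_bound[where B=4]) auto
  qed (use f0 in auto)
  finally have "prob {\<omega>\<in>space M. X n \<omega> \<le> - r \<and> - \<kappa> < X n \<omega> + q * norm (W n \<omega>)} \<le> (\<integral>\<omega>. f (X n \<omega>) \<partial>M)"
    using f0 by (simp add: emeasure_eq_measure integral_nonneg_AE)
  then show ?thesis unfolding f_def by simp
qed

text \<open>Points below \<open>- r\<close> do not matter for the maximum: unless \<open>\<phi>\<close> exceeds \<open>q\<close> or \<open>norm \<delta>\<close> exceeds \<open>C\<close>, which
  have vanishing rates, the Brownian path would have to climb from \<open>X\<close> to a fixed level.\<close>

lemma left_points_negligible:
  assumes \<kappa>: "0 \<le> \<kappa>" and \<eta>: "0 < \<eta>"
  shows "\<exists>r0. \<forall>r\<ge>r0. \<forall>\<^sub>F n in sequentially.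
    rate n (\<lambda>\<omega>. X n \<omega> \<le> - r \<and> - \<kappa> < X n \<omega> + norm (R n \<omega> + \<delta> n \<omega>)) < \<eta>"
proof -
  define \<kappa>' where "\<kappa>' = \<kappa> + C"
  define p where "p = 512 * q\<^sup>2"
  have p: "0 < p" using q_pos by (simp add: p_def)
  have \<kappa>': "0 \<le> \<kappa>'" using \<kappa> C_pos by (simp add: \<kappa>'_def)
  define I where "I r n = (\<integral>\<omega>. exp (- ((X n \<omega>)\<^sup>2) / p) * indicator {..- r} (X n \<omega>) \<partial>M)" for r n
  obtain r1 K0 where r1: "\<forall>\<^sub>F n in sequentially. real (Suc n) * I r1 n \<le> K0"
    using X_left[OF p] unfolding I_def by blast
  define K where "K = max K0 1"
  have K: "0 < K" "\<forall>\<^sub>F n in sequentially. real (Suc n) * I r1 n \<le> K"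
    using r1 by (auto simp: K_def elim!: eventually_mono)
  have I_mono: "I r n \<le> I r1 n" if "r1 \<le> r" for r n
    unfolding I_def
  proof (rule integral_mono)
    have int: "integrable M (\<lambda>\<omega>. exp (- ((X n \<omega>)\<^sup>2) / p) * indicator {..- r} (X n \<omega>))" for r
    proof (rule integrable_const_bound[where B=1])
      have "exp (- (x\<^sup>2) / p) \<le> 1" for x :: real using p by simp
      then show "AE \<omega> in M. norm (exp (- ((X n \<omega>)\<^sup>2) / p) * indicator {..- r} (X n \<omega>)) \<le> 1"
        by (intro AE_I2) (simp add: indicator_def)
    qed measurable
    show "integrable M (\<lambda>\<omega>. exp (- ((X n \<omega>)\<^sup>2) / p) * indicator {..- r} (X n \<omega>))"
      "integrable M (\<lambda>\<omega>. exp (- ((X n \<omega>)\<^sup>2) / p) * indicator {..- r1} (X n \<omega>))" by (rule int)+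
  qed (use that in \<open>auto simp: indicator_def\<close>)
  have "((\<lambda>r::real. 4 * exp (- (r\<^sup>2 / p)) * K) \<longlongrightarrow> 0) at_top"
    using p by real_asymp
  then have "\<forall>\<^sub>F r in at_top. 4 * exp (- (r\<^sup>2 / p)) * K < \<eta> / 3"
    by (rule order_tendstoD) (use \<eta> in simp)
  then obtain r2 where r2: "\<And>r. r2 \<le> r \<Longrightarrow> 4 * exp (- (r\<^sup>2 / p)) * K < \<eta> / 3"
    by (auto simp: eventually_at_top_linorder)
  show ?thesis
  proof (intro exI allI impI)
    fix r assume r: "Max {r1, r2, 2 * \<kappa>', 64 * q} \<le> r"
    have e1: "\<forall>\<^sub>F n in sequentially. rate n (\<lambda>\<omega>. C < norm (\<delta> n \<omega>)) < \<eta> / 3"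
      unfolding rate_def by (rule order_tendstoD[OF \<delta>_bound]) (use \<eta> in simp)
    have e2: "\<forall>\<^sub>F n in sequentially. rate n (\<lambda>\<omega>. q < \<phi> n \<omega>) < \<eta> / 3"
      unfolding rate_def by (rule order_tendstoD[OF \<phi>_bound]) (use \<eta> in simp)
    have le: "rate n (\<lambda>\<omega>. X n \<omega> \<le> - r \<and> - \<kappa> < X n \<omega> + norm (R n \<omega> + \<delta> n \<omega>)) \<le>
        rate n (\<lambda>\<omega>. C < norm (\<delta> n \<omega>)) + (rate n (\<lambda>\<omega>. q < \<phi> n \<omega>) +
        rate n (\<lambda>\<omega>. X n \<omega> \<le> - r \<and> - \<kappa>' < X n \<omega> + q * norm (W n \<omega>)))" for n
    proof -
      have "rate n (\<lambda>\<omega>. X n \<omega> \<le> - r \<and> - \<kappa> < X n \<omega> + norm (R n \<omega> + \<delta> n \<omega>)) \<le>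
          rate n (\<lambda>\<omega>. C < norm (\<delta> n \<omega>)) + rate n (\<lambda>\<omega>. X n \<omega> \<le> - r \<and> - \<kappa>' < X n \<omega> + norm (R n \<omega>))"
      proof (rule rate_subadd)
        fix \<omega> assume "X n \<omega> \<le> - r \<and> - \<kappa> < X n \<omega> + norm (R n \<omega> + \<delta> n \<omega>)"
        then show "C < norm (\<delta> n \<omega>) \<or> (X n \<omega> \<le> - r \<and> - \<kappa>' < X n \<omega> + norm (R n \<omega>))"
          using norm_triangle_ineq[of "R n \<omega>" "\<delta> n \<omega>"] unfolding \<kappa>'_def by linarith
      qed measurable
      also have "rate n (\<lambda>\<omega>. X n \<omega> \<le> - r \<and> - \<kappa>' < X n \<omega> + norm (R n \<omega>)) =
          rate n (\<lambda>\<omega>. X n \<omega> \<le> - r \<and> - \<kappa>' < X n \<omega> + norm (\<phi> n \<omega> *\<^sub>R W n \<omega>))"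
      proof -
        have "{p\<in>space (borel \<Otimes>\<^sub>M borel). fst p \<le> - r \<and> - \<kappa>' < fst p + norm (snd p :: C01)} \<in> sets (borel \<Otimes>\<^sub>M borel)"
          by measurable
        then have "{p. fst p \<le> - r \<and> - \<kappa>' < fst p + norm (snd p :: C01)} \<in> sets (borel \<Otimes>\<^sub>M borel)"
          by (simp add: space_pair_measure)
        from XR_rate[OF this, of n] show ?thesis by simp
      qed
      also have "\<dots> \<le> rate n (\<lambda>\<omega>. q < \<phi> n \<omega>) +
          rate n (\<lambda>\<omega>. X n \<omega> \<le> - r \<and> - \<kappa>' < X n \<omega> + q * norm (W n \<omega>))"
      proof (rule rate_subadd_AE)
        show "AE \<omega> in M. X n \<omega> \<le> - r \<and> - \<kappa>' < X n \<omega> + norm (\<phi> n \<omega> *\<^sub>R W n \<omega>) \<longrightarrow>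
            q < \<phi> n \<omega> \<or> (X n \<omega> \<le> - r \<and> - \<kappa>' < X n \<omega> + q * norm (W n \<omega>))"
          using \<phi>_pos[of n]
        proof eventually_elim
          case (elim \<omega>)
          show ?case
          proof (cases "q < \<phi> n \<omega>")
            case False
            then have "norm (\<phi> n \<omega> *\<^sub>R W n \<omega>) \<le> q * norm (W n \<omega>)"
              using elim by (simp add: mult_right_mono)
            then show ?thesis by linarith
          qed simp
        qed
      qed measurable
      finally show ?thesis by simp
    qed
    show "\<forall>\<^sub>F n in sequentially. rate n (\<lambda>\<omega>. X n \<omega> \<le> - r \<and> - \<kappa> < X n \<omega> + norm (R n \<omega> + \<delta> n \<omega>)) < \<eta>"
      using e1 e2 K(2)
    proof eventually_elim
      case (elim n)
      have "rate n (\<lambda>\<omega>. X n \<omega> \<le> - r \<and> - \<kappa>' < X n \<omega> + q * norm (W n \<omega>)) \<le>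
          real (Suc n) * (4 * exp (- (r\<^sup>2 / p)) * I r n)"
        unfolding rate_def p_def I_def by (intro mult_left_mono gaussian_left_tail \<kappa>') (use r in auto)
      also have "\<dots> = 4 * exp (- (r\<^sup>2 / p)) * (real (Suc n) * I r n)" by simp
      also have "\<dots> \<le> 4 * exp (- (r\<^sup>2 / p)) * K"
      proof (rule mult_left_mono)
        have "real (Suc n) * I r n \<le> real (Suc n) * I r1 n"
          by (intro mult_left_mono I_mono) (use r in auto)
        then show "real (Suc n) * I r n \<le> K" using elim(3) by linarith
      qed simp
      also have "\<dots> < \<eta> / 3" by (rule r2) (use r in simp)
      finally show ?case using le[of n] elim(1,2) by linarith
    qed
  qed
qed

text \<open>Above \<open>- r\<close> there are about \<open>exp r\<close> points, and their paths oscillate like independent Brownian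
  paths with one common law.\<close>

lemma large_oscillation_negligible:
  assumes \<epsilon>: "0 < \<epsilon>" and \<eta>: "0 < \<eta>"
  shows "\<exists>m0. \<forall>m\<ge>m0. \<forall>\<^sub>F n in sequentially.
    rate n (\<lambda>\<omega>. - r < X n \<omega> \<and> \<epsilon> < osc m (R n \<omega> + \<delta> n \<omega>)) < \<eta>"
proof -
  interpret w: prob_space wiener by (rule prob_wiener)
  have mO: "{w. \<epsilon> / 2 < osc m w} \<in> sets borel" for m by measurable
  have "(\<lambda>m. \<integral>w. indicator {w. \<epsilon> / 2 < osc m w} w \<partial>wiener) \<longlonglongrightarrow> (\<integral>w. (0::real) \<partial>wiener)"
  proof (rule integral_dominated_convergence[where w="\<lambda>_. 1"])
    show "AE w in wiener. (\<lambda>m. indicator {w. \<epsilon> / 2 < osc m w} w :: real) \<longlonglongrightarrow> 0"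
    proof (rule AE_I2)
      fix w
      have "\<forall>\<^sub>F m in sequentially. osc m w < \<epsilon> / 2"
        by (rule order_tendstoD[OF osc_tendsto_0]) (use \<epsilon> in simp)
      then show "(\<lambda>m. indicator {w. \<epsilon> / 2 < osc m w} w :: real) \<longlonglongrightarrow> 0"
        by (intro tendsto_eventually) (auto elim!: eventually_mono)
    qed
    show "(\<lambda>w. indicator {w. \<epsilon> / 2 < osc m w} w :: real) \<in> borel_measurable wiener" for m
      using mO[of m] by (intro borel_measurable_indicator) (simp add: sets_wiener)
  qed (auto simp: w.integrable_const indicator_def)
  then have "(\<lambda>m. exp r * measure wiener {w. \<epsilon> / 2 < osc m w}) \<longlonglongrightarrow> exp r * 0"
    using mO by (intro tendsto_mult tendsto_const) (simp add: sets_wiener space_wiener)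
  then have "\<forall>\<^sub>F m in sequentially. exp r * measure wiener {w. \<epsilon> / 2 < osc m w} < \<eta> / 2"
    by (rule order_tendstoD) (use \<eta> in simp)
  then obtain m0 where m0: "\<And>m. m0 \<le> m \<Longrightarrow> exp r * measure wiener {w. \<epsilon> / 2 < osc m w} < \<eta> / 2"
    by (auto simp: eventually_sequentially)
  show ?thesis
  proof (intro exI allI impI)
    fix m assume m: "m0 \<le> m"
    have e1: "\<forall>\<^sub>F n in sequentially. rate n (\<lambda>\<omega>. - r < X n \<omega> \<and> W n \<omega> \<in> {w. \<epsilon> / 2 < osc m w}) < \<eta> / 2"
      by (rule order_tendstoD(2)[OF rate_indep[OF mO] m0[OF m]])
    have e2: "\<forall>\<^sub>F n in sequentially. err r (\<epsilon> / 8) n < \<eta> / 2"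
      by (rule order_tendstoD[OF err_tendsto_0]) (use \<epsilon> \<eta> in auto)
    show "\<forall>\<^sub>F n in sequentially. rate n (\<lambda>\<omega>. - r < X n \<omega> \<and> \<epsilon> < osc m (R n \<omega> + \<delta> n \<omega>)) < \<eta>"
      using e1 e2
    proof eventually_elim
      case (elim n)
      have "\<bar>osc m z / 2 - osc m z' / 2\<bar> \<le> dist z z'" for z z'
        using osc_lipschitz[of m z z'] by (simp add: abs_le_iff field_simps)
      from sandwich(1)[OF _ this, of n r "\<epsilon> / 2" "\<epsilon> / 8"]
      have "rate n (\<lambda>\<omega>. - r < X n \<omega> \<and> \<epsilon> / 2 < osc m (R n \<omega> + \<delta> n \<omega>) / 2) \<le>
          rate n (\<lambda>\<omega>. - r < X n \<omega> \<and> \<epsilon> / 2 - 2 * (\<epsilon> / 8) < osc m (W n \<omega>) / 2) + err r (\<epsilon> / 8) n"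
        by simp
      moreover have "\<epsilon> / 2 < x / 2 \<longleftrightarrow> \<epsilon> < x" "\<epsilon> / 2 - 2 * (\<epsilon> / 8) < x / 2 \<longleftrightarrow> x \<in> {x. \<epsilon> / 2 < x}" for x
        by auto
      ultimately show ?case using elim by simp
    qed
  qed
qed

text \<open>The left-hand side of the inequality is the probability that no member of the row starts above
  \<open>- L\<close> and stays within distance \<open>\<kappa>\<close> of its start. About \<open>exp L\<close> members start above \<open>- L\<close>, and at least
  a fixed proportion of them stays within \<open>\<kappa>\<close>.\<close>

lemma good_point_exists:
  assumes \<eta>: "0 < \<eta>"
  shows "\<exists>L \<kappa>. 0 \<le> L \<and> 0 \<le> \<kappa> \<and> (\<forall>\<^sub>F n in sequentially.
    (1 - prob {\<omega>\<in>space M. - L < X n \<omega> \<and> norm (R n \<omega> + \<delta> n \<omega>) \<le> \<kappa>}) ^ Suc n < \<eta>)"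
proof -
  \<comment> \<open>About \<open>4 * l\<close> members start above \<open>- L\<close>; more than \<open>l\<close> of them are good, and \<open>exp (- l) \<le> \<eta>\<close>.\<close>
  define l where "l = max 1 (- ln \<eta>)"
  define L where "L = ln (4 * l)"
  have l: "1 \<le> l" "- l \<le> ln \<eta>" by (auto simp: l_def)
  have L: "exp L = 4 * l" using l by (simp add: L_def)
  have L0: "0 \<le> L" using l by (simp add: L_def)
  have "\<forall>\<^sub>F k in sequentially. measure wiener {w. real k < norm w} < 1 / 4"
    by (rule order_tendstoD[OF wiener_norm_small]) simp
  then obtain k :: nat where k: "measure wiener {w. real k < norm w} < 1 / 4"
    by (auto simp: eventually_sequentially)
  define \<kappa> where "\<kappa> = real k + 1"
  have e0: "\<forall>\<^sub>F n in sequentially. 3 * l < rate n (\<lambda>\<omega>. - L < X n \<omega>)"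
    by (rule order_tendstoD[OF rate_X]) (use L l in simp)
  have "{w::C01. real k < norm w} \<in> sets borel" by measurable
  from rate_indep[OF this, of L]
  have e1: "\<forall>\<^sub>F n in sequentially. rate n (\<lambda>\<omega>. - L < X n \<omega> \<and> W n \<omega> \<in> {w. real k < norm w}) < l"
    by (rule order_tendstoD) (use k l L in simp)
  have e2: "\<forall>\<^sub>F n in sequentially. err L (1 / 2) n < l"
    by (rule order_tendstoD[OF err_tendsto_0]) (use l in auto)
  have "\<forall>\<^sub>F n in sequentially.
      (1 - prob {\<omega>\<in>space M. - L < X n \<omega> \<and> norm (R n \<omega> + \<delta> n \<omega>) \<le> \<kappa>}) ^ Suc n < \<eta>"
    using e0 e1 e2
  proof eventually_elim
    case (elim n)
    let ?p = "prob {\<omega>\<in>space M. - L < X n \<omega> \<and> norm (R n \<omega> + \<delta> n \<omega>) \<le> \<kappa>}"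
    have "rate n (\<lambda>\<omega>. - L < X n \<omega> \<and> \<kappa> < norm (R n \<omega> + \<delta> n \<omega>)) \<le>
        rate n (\<lambda>\<omega>. - L < X n \<omega> \<and> \<kappa> - 2 * (1 / 2) < norm (W n \<omega>)) + err L (1 / 2) n"
    proof (rule sandwich(1)[of "\<lambda>x z. norm z"])
      show "(\<lambda>p. norm (snd p)) \<in> borel_measurable (borel \<Otimes>\<^sub>M borel :: (real \<times> C01) measure)" by measurable
    qed (rule norm_lipschitz_dist)
    then have "rate n (\<lambda>\<omega>. - L < X n \<omega> \<and> \<kappa> < norm (R n \<omega> + \<delta> n \<omega>)) < 2 * l"
      using elim by (simp add: \<kappa>_def)
    moreover have "rate n (\<lambda>\<omega>. - L < X n \<omega>) \<le> rate n (\<lambda>\<omega>. - L < X n \<omega> \<and> norm (R n \<omega> + \<delta> n \<omega>) \<le> \<kappa>) +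
        rate n (\<lambda>\<omega>. - L < X n \<omega> \<and> \<kappa> < norm (R n \<omega> + \<delta> n \<omega>))"
      by (rule rate_subadd) (auto, measurable)
    ultimately have np: "l < real (Suc n) * ?p" using elim(1) by (simp add: rate_def)
    have "(1 - ?p) ^ Suc n \<le> exp (- ?p) ^ Suc n"
      using exp_ge_add_one_self[of "- ?p"] by (intro power_mono) auto
    also have "\<dots> = exp (- (real (Suc n) * ?p))"
      by (simp only: exp_of_nat_mult[symmetric] mult_minus_right)
    also have "\<dots> < exp (- l)" using np by simp
    also have "\<dots> \<le> exp (ln \<eta>)" using l by simp
    finally show ?case using \<eta> by simp
  qed
  then show ?thesis using L0 by (intro exI[of _ L] exI[of _ \<kappa>]) (simp add: \<kappa>_def)
qed

lemma wiener_exp_excess: "integrable wiener (\<lambda>w. exp (grid_excess m y w))"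
proof -
  interpret w: prob_space wiener by (rule prob_wiener)
  have "grid_excess m y w \<le> grid_excess m y 0 + norm w" for w
    using grid_excess_lipschitz[of m y w 0] by (simp add: dist_norm abs_le_iff)
  then have "exp (grid_excess m y w) \<le> exp (grid_excess m y 0) * exp (norm w)" for w
    unfolding exp_add[symmetric] by simp
  then show ?thesis
    by (intro Bochner_Integration.integrable_bound[OF integrable_mult_right[OF wiener_exp_norm, of "exp (grid_excess m y 0)"]])
      auto
qed

text \<open>The expected number of members of the row that exceed \<open>y\<close> at some node converges. Truncation at
  \<open>- r\<close> and \<open>sandwich\<close> reduce this to \<open>rate_excess\<close>; shifting the level by \<open>2 * \<epsilon>\<close> changes the limit by
  a factor of at most \<open>exp (2 * \<epsilon>)\<close>.\<close>

theorem excess_rate: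
  "(\<lambda>n. rate n (\<lambda>\<omega>. 0 < X n \<omega> + grid_excess m y (R n \<omega> + \<delta> n \<omega>)))
    \<longlonglongrightarrow> (\<integral>w. exp (grid_excess m y w) \<partial>wiener)"
proof -
  interpret w: prob_space wiener by (rule prob_wiener)
  let ?g = "grid_excess m y"
  define \<Lambda> where "\<Lambda> = (\<integral>w. exp (?g w) \<partial>wiener)"
  define J where "J r c = (\<integral>w. exp (min r (?g w - c)) \<partial>wiener)" for r c
  have \<Lambda>0: "0 \<le> \<Lambda>" unfolding \<Lambda>_def by (intro integral_nonneg_AE) auto
  have intJ: "integrable wiener (\<lambda>w. exp (min r (?g w - c)))" for r c
    by (rule w.integrable_const_bound[where B="exp r"]) auto
  have J_up: "J r (- (2 * \<epsilon>)) \<le> exp (2 * \<epsilon>) * \<Lambda>" for r \<epsilon>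
  proof -
    have "J r (- (2 * \<epsilon>)) \<le> (\<integral>w. exp (2 * \<epsilon>) * exp (?g w) \<partial>wiener)"
      unfolding J_def
    proof (intro integral_mono intJ integrable_mult_right wiener_exp_excess)
      fix w
      show "exp (min r (?g w - - (2 * \<epsilon>))) \<le> exp (2 * \<epsilon>) * exp (?g w)"
        unfolding exp_add[symmetric] by simp
    qed
    then show ?thesis by (simp add: \<Lambda>_def)
  qed
  have J_low: "exp (- (2 * \<epsilon>)) * J r 0 \<le> J r (2 * \<epsilon>)" if "0 \<le> \<epsilon>" for r \<epsilon>
  proof -
    have "(\<integral>w. exp (- (2 * \<epsilon>)) * exp (min r (?g w - 0)) \<partial>wiener) \<le> J r (2 * \<epsilon>)"
      unfolding J_def
    proof (intro integral_mono intJ integrable_mult_right)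
      fix w
      show "exp (- (2 * \<epsilon>)) * exp (min r (?g w - 0)) \<le> exp (min r (?g w - 2 * \<epsilon>))"
        unfolding exp_add[symmetric] using that by (auto simp: min_def)
    qed
    then show ?thesis by (simp add: J_def)
  qed
  have J_lim: "(\<lambda>r::nat. J (real r) 0) \<longlonglongrightarrow> \<Lambda>"
    unfolding J_def \<Lambda>_def
  proof (rule integral_dominated_convergence[where w="\<lambda>w. exp (?g w)"])
    show "AE w in wiener. (\<lambda>r. exp (min (real r) (?g w - 0))) \<longlonglongrightarrow> exp (?g w)"
    proof (rule AE_I2)
      fix w
      obtain r0 :: nat where "?g w \<le> real r0" using real_arch_simple by blast
      then show "(\<lambda>r. exp (min (real r) (?g w - 0))) \<longlonglongrightarrow> exp (?g w)"
        by (intro tendsto_eventually eventually_sequentiallyI[of r0]) (auto simp: min_def)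
    qed
  qed (auto simp: wiener_exp_excess)
  have Hm: "(\<lambda>p. fst p + ?g (snd p)) \<in> borel_measurable (borel \<Otimes>\<^sub>M borel)" by measurable
  have HL: "\<bar>(x + ?g z) - (x + ?g z')\<bar> \<le> dist z z'" for x z z' using grid_excess_lipschitz by simp
  have mainJ: "(\<lambda>n. rate n (\<lambda>\<omega>. - r < X n \<omega> \<and> c < X n \<omega> + ?g (W n \<omega>))) \<longlonglongrightarrow> J r c" for r c
    unfolding J_def by (rule rate_excess) measurable
  show ?thesis
    unfolding \<Lambda>_def[symmetric]
  proof (rule order_tendstoI)
    fix u assume u: "u < \<Lambda>"
    have "((\<lambda>\<epsilon>::real. exp (- (2 * \<epsilon>)) * \<Lambda>) \<longlongrightarrow> exp (- (2 * 0)) * \<Lambda>) (at_right 0)"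
      by (intro tendsto_intros)
    then have "\<forall>\<^sub>F \<epsilon> in at_right (0::real). u < exp (- (2 * \<epsilon>)) * \<Lambda>"
      by (rule order_tendstoD) (use u in simp)
    moreover have "\<forall>\<^sub>F \<epsilon> in at_right (0::real). 0 < \<epsilon>" by (simp add: eventually_at_filter)
    ultimately have "\<forall>\<^sub>F \<epsilon> in at_right (0::real). 0 < \<epsilon> \<and> u < exp (- (2 * \<epsilon>)) * \<Lambda>"
      by (rule eventually_conj[rotated])
    then obtain \<epsilon> where \<epsilon>: "0 < \<epsilon>" "u < exp (- (2 * \<epsilon>)) * \<Lambda>"
      using eventually_happens'[OF trivial_limit_at_right_real] by blast
    have "(\<lambda>r::nat. exp (- (2 * \<epsilon>)) * J (real r) 0) \<longlonglongrightarrow> exp (- (2 * \<epsilon>)) * \<Lambda>"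
      by (intro tendsto_mult tendsto_const J_lim)
    then have "\<forall>\<^sub>F r in sequentially. u < exp (- (2 * \<epsilon>)) * J (real r) 0"
      by (rule order_tendstoD) (rule \<epsilon>)
    then obtain r :: nat where r: "u < exp (- (2 * \<epsilon>)) * J (real r) 0"
      by (auto simp: eventually_sequentially)
    have uJ: "u < J (real r) (2 * \<epsilon>)" using r J_low[of \<epsilon> "real r"] \<epsilon> by linarith
    have "(\<lambda>n. rate n (\<lambda>\<omega>. - real r < X n \<omega> \<and> 2 * \<epsilon> < X n \<omega> + ?g (W n \<omega>)) - err (real r) \<epsilon> n) \<longlonglongrightarrow> J (real r) (2 * \<epsilon>) - 0"
      by (intro tendsto_diff mainJ err_tendsto_0 \<epsilon>)
    then have "\<forall>\<^sub>F n in sequentially. u < rate n (\<lambda>\<omega>. - real r < X n \<omega> \<and> 2 * \<epsilon> < X n \<omega> + ?g (W n \<omega>)) - err (real r) \<epsilon> n"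
      by (rule order_tendstoD) (use uJ in simp)
    then show "\<forall>\<^sub>F n in sequentially. u < rate n (\<lambda>\<omega>. 0 < X n \<omega> + ?g (R n \<omega> + \<delta> n \<omega>))"
    proof eventually_elim
      case (elim n)
      have "rate n (\<lambda>\<omega>. - real r < X n \<omega> \<and> 0 + 2 * \<epsilon> < X n \<omega> + ?g (W n \<omega>)) \<le>
          rate n (\<lambda>\<omega>. - real r < X n \<omega> \<and> 0 < X n \<omega> + ?g (R n \<omega> + \<delta> n \<omega>)) + err (real r) \<epsilon> n"
        by (rule sandwich(2)[of "\<lambda>x z. x + ?g z", OF Hm HL])
      moreover have "rate n (\<lambda>\<omega>. - real r < X n \<omega> \<and> 0 < X n \<omega> + ?g (R n \<omega> + \<delta> n \<omega>)) \<le>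
          rate n (\<lambda>\<omega>. 0 < X n \<omega> + ?g (R n \<omega> + \<delta> n \<omega>))"
        by (rule rate_mono_AE) (auto, measurable)
      ultimately show ?case using elim by simp
    qed
  next
    fix u assume u: "\<Lambda> < u"
    define \<eta> where "\<eta> = (u - \<Lambda>) / 3"
    have \<eta>: "0 < \<eta>" using u by (simp add: \<eta>_def)
    have "((\<lambda>\<epsilon>::real. exp (2 * \<epsilon>) * \<Lambda>) \<longlongrightarrow> exp (2 * 0) * \<Lambda>) (at_right 0)"
      by (intro tendsto_intros)
    then have "\<forall>\<^sub>F \<epsilon> in at_right (0::real). exp (2 * \<epsilon>) * \<Lambda> < \<Lambda> + \<eta>"
      by (rule order_tendstoD) (use \<eta> in simp)
    moreover have "\<forall>\<^sub>F \<epsilon> in at_right (0::real). 0 < \<epsilon>" by (simp add: eventually_at_filter)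
    ultimately have "\<forall>\<^sub>F \<epsilon> in at_right (0::real). 0 < \<epsilon> \<and> exp (2 * \<epsilon>) * \<Lambda> < \<Lambda> + \<eta>"
      by (rule eventually_conj[rotated])
    then obtain \<epsilon> where \<epsilon>: "0 < \<epsilon>" "exp (2 * \<epsilon>) * \<Lambda> < \<Lambda> + \<eta>"
      using eventually_happens'[OF trivial_limit_at_right_real] by blast
    define \<kappa> where "\<kappa> = \<bar>grid_excess m y 0\<bar>"
    obtain r where r: "\<forall>\<^sub>F n in sequentially.
        rate n (\<lambda>\<omega>. X n \<omega> \<le> - r \<and> - \<kappa> < X n \<omega> + norm (R n \<omega> + \<delta> n \<omega>)) < \<eta>"
      using left_points_negligible[of \<kappa> \<eta>] \<eta> unfolding \<kappa>_def by auto
    have "(\<lambda>n. rate n (\<lambda>\<omega>. - r < X n \<omega> \<and> - (2 * \<epsilon>) < X n \<omega> + ?g (W n \<omega>)) + err r \<epsilon> n) \<longlonglongrightarrow> J r (- (2 * \<epsilon>)) + 0"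
      by (intro tendsto_add mainJ err_tendsto_0 \<epsilon>)
    then have "\<forall>\<^sub>F n in sequentially. rate n (\<lambda>\<omega>. - r < X n \<omega> \<and> - (2 * \<epsilon>) < X n \<omega> + ?g (W n \<omega>)) + err r \<epsilon> n < \<Lambda> + \<eta>"
      by (rule order_tendstoD) (use J_up[of r \<epsilon>] \<epsilon> in simp)
    with r show "\<forall>\<^sub>F n in sequentially. rate n (\<lambda>\<omega>. 0 < X n \<omega> + ?g (R n \<omega> + \<delta> n \<omega>)) < u"
    proof eventually_elim
      case (elim n)
      have "rate n (\<lambda>\<omega>. - r < X n \<omega> \<and> 0 < X n \<omega> + ?g (R n \<omega> + \<delta> n \<omega>)) \<le>
          rate n (\<lambda>\<omega>. - r < X n \<omega> \<and> 0 - 2 * \<epsilon> < X n \<omega> + ?g (W n \<omega>)) + err r \<epsilon> n"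
        by (rule sandwich(1)[of "\<lambda>x z. x + ?g z", OF Hm HL])
      moreover have "rate n (\<lambda>\<omega>. 0 < X n \<omega> + ?g (R n \<omega> + \<delta> n \<omega>)) \<le>
          rate n (\<lambda>\<omega>. X n \<omega> \<le> - r \<and> - \<kappa> < X n \<omega> + norm (R n \<omega> + \<delta> n \<omega>)) +
          rate n (\<lambda>\<omega>. - r < X n \<omega> \<and> 0 < X n \<omega> + ?g (R n \<omega> + \<delta> n \<omega>))"
      proof (rule rate_subadd)
        fix \<omega> assume a: "0 < X n \<omega> + ?g (R n \<omega> + \<delta> n \<omega>)"
        have "?g (R n \<omega> + \<delta> n \<omega>) \<le> \<kappa> + norm (R n \<omega> + \<delta> n \<omega>)"
          using grid_excess_lipschitz[of m y "R n \<omega> + \<delta> n \<omega>" 0]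
          unfolding \<kappa>_def dist_norm diff_0_right by linarith
        with a show "X n \<omega> \<le> - r \<and> - \<kappa> < X n \<omega> + norm (R n \<omega> + \<delta> n \<omega>) \<or>
            - r < X n \<omega> \<and> 0 < X n \<omega> + ?g (R n \<omega> + \<delta> n \<omega>)"
          by linarith
      qed measurable
      moreover have "u = \<Lambda> + 3 * \<eta>" by (simp add: \<eta>_def field_simps)
      ultimately show ?case using elim \<eta> unfolding diff_0 by linarith
    qed
  qed
qed

end

section \<open>A criterion for weak convergence of laws on the path space\<close>

text \<open>Paths whose values at the nodes lie in a box that is bounded from below in the first \<open>l\<close>
  coordinates only. This permits an induction on \<open>l\<close> from orthants to bounded half-open boxes.\<close>

definition grid_box :: "nat \<Rightarrow> nat \<Rightarrow> (nat \<Rightarrow> real) \<Rightarrow> (nat \<Rightarrow> real) \<Rightarrow> C01 set" where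
  "grid_box m l a b = {z :: C01. \<forall>k\<le>2^m. z (node m k) \<le> b k \<and> (k < l \<longrightarrow> a k < z (node m k))}"

lemma grid_box_measurable [measurable]: "grid_box m l a b \<in> sets borel"
  unfolding grid_box_def by measurable

text \<open>Bounding one more coordinate from below subtracts the probability of a box of the previous kind.\<close>

lemma grid_box_limit:
  assumes \<mu>: "\<And>n. prob_space (\<mu> n)" "\<And>n. sets (\<mu> n) = sets borel"
    and \<nu>: "prob_space \<nu>" "sets \<nu> = sets borel"
    and cdf: "\<And>y. (\<lambda>n. measure (\<mu> n) {z :: C01. \<forall>k\<le>2^m. z (node m k) \<le> y k}) \<longlonglongrightarrow>
      measure \<nu> {z :: C01. \<forall>k\<le>2^m. z (node m k) \<le> y k}"
    and ab: "\<And>k. a k \<le> b k" and l: "l \<le> Suc (2 ^ m)"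
  shows "(\<lambda>n. measure (\<mu> n) (grid_box m l a b)) \<longlonglongrightarrow> measure \<nu> (grid_box m l a b)"
  using l ab
proof (induction l arbitrary: b)
  case 0
  then show ?case using cdf[of b] by (simp add: grid_box_def)
next
  case (Suc l)
  let ?b = "b(l := a l)"
  have split: "measure \<rho> (grid_box m (Suc l) a b) = measure \<rho> (grid_box m l a b) - measure \<rho> (grid_box m l a ?b)"
    if "prob_space \<rho>" "sets \<rho> = sets borel" for \<rho>
  proof -
    interpret prob_space \<rho> by fact
    have l: "l \<le> 2 ^ m" using Suc.prems(1) by simp
    have up: "grid_box m (Suc l) a b = {z\<in>grid_box m l a b. a l < z (node m l)}"
      unfolding grid_box_def using l by (auto simp: less_Suc_eq)
    have low: "grid_box m l a ?b = {z\<in>grid_box m l a b. z (node m l) \<le> a l}"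
    proof (rule set_eqI)
      fix z :: C01
      have "z (node m k) \<le> ?b k \<longleftrightarrow> z (node m k) \<le> b k \<and> (k = l \<longrightarrow> z (node m l) \<le> a l)" for k
        using Suc.prems(2)[of l] by auto
      then show "z \<in> grid_box m l a ?b \<longleftrightarrow> z \<in> {z\<in>grid_box m l a b. z (node m l) \<le> a l}"
        unfolding grid_box_def mem_Collect_eq using l by (metis (full_types))
    qed
    have "grid_box m (Suc l) a b = grid_box m l a b - grid_box m l a ?b"
      unfolding up low by auto
    moreover have "grid_box m l a ?b \<subseteq> grid_box m l a b"
      unfolding low by blast
    ultimately show ?thesis
      using that(2) by (simp add: finite_measure_Diff)
  qed
  have "(\<lambda>n. measure (\<mu> n) (grid_box m l a b) - measure (\<mu> n) (grid_box m l a ?b)) \<longlonglongrightarrow>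
      measure \<nu> (grid_box m l a b) - measure \<nu> (grid_box m l a ?b)"
    using Suc.prems by (intro tendsto_diff Suc.IH) auto
  then show ?case by (simp only: split[OF \<mu>] split[OF \<nu>])
qed

definition cells :: "nat \<Rightarrow> int \<Rightarrow> (nat \<Rightarrow> int) set" where
  "cells m J = (\<Pi>\<^sub>E k\<in>{..2^m}. {- J..<J})"

lemma finite_cells: "finite (cells m J)"
  unfolding cells_def by (intro finite_PiE) auto

definition cell :: "nat \<Rightarrow> real \<Rightarrow> (nat \<Rightarrow> int) \<Rightarrow> C01 set" where
  "cell m h j = grid_box m (Suc (2 ^ m)) (\<lambda>k. real_of_int (j k) * h) (\<lambda>k. (real_of_int (j k) + 1) * h)"

lemma cell_iff:
  fixes z :: C01
  shows "z \<in> cell m h j \<longleftrightarrow> (\<forall>k\<le>2^m. real_of_int (j k) * h < z (node m k) \<and> z (node m k) \<le> (real_of_int (j k) + 1) * h)"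
  unfolding cell_def grid_box_def by (auto simp: less_Suc_eq_le)

lemma cell_measurable [measurable]: "cell m h j \<in> sets borel"
  unfolding cell_def by measurable

text \<open>The cells with indices in \<open>cells m J\<close> partition the box of half-width \<open>J * h\<close>.\<close>

lemma cell_exists:
  fixes z :: C01
  assumes h: "0 < h" and z: "z \<in> grid_box m (Suc (2 ^ m)) (\<lambda>_. - (real_of_int J * h)) (\<lambda>_. real_of_int J * h)"
  obtains j where "j \<in> cells m J" "z \<in> cell m h j" "\<And>i. i \<in> cells m J \<Longrightarrow> z \<in> cell m h i \<Longrightarrow> i = j"
proof -
  define j where "j = (\<lambda>k\<in>{..2^m}. \<lceil>z (node m k) / h\<rceil> - 1)"
  have fl: "i = \<lceil>z (node m k) / h\<rceil> - 1 \<longleftrightarrow>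
      real_of_int i * h < z (node m k) \<and> z (node m k) \<le> (real_of_int i + 1) * h" for i k
  proof -
    have "i = \<lceil>z (node m k) / h\<rceil> - 1 \<longleftrightarrow> real_of_int i < z (node m k) / h \<and> z (node m k) / h \<le> real_of_int i + 1"
      by linarith
    then show ?thesis using h by (simp add: pos_less_divide_eq pos_divide_le_eq)
  qed
  have "j \<in> cells m J"
    unfolding cells_def
  proof (rule PiE_I)
    fix k :: nat assume k: "k \<in> {..2^m}"
    have "- (real_of_int J * h) < z (node m k)" "z (node m k) \<le> real_of_int J * h"
      using z k by (auto simp: grid_box_def less_Suc_eq_le)
    then have "- real_of_int J < z (node m k) / h" "z (node m k) / h \<le> real_of_int J"
      using h by (auto simp: pos_less_divide_eq pos_divide_le_eq)
    then show "j k \<in> {- J..<J}" using k unfolding j_def by simp linarith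
  qed (simp add: j_def)
  moreover have "z \<in> cell m h j"
    unfolding cell_iff
  proof (intro allI impI)
    fix k :: nat assume "k \<le> 2 ^ m"
    then have "j k = \<lceil>z (node m k) / h\<rceil> - 1" by (simp add: j_def)
    then show "real_of_int (j k) * h < z (node m k) \<and> z (node m k) \<le> (real_of_int (j k) + 1) * h"
      by (rule iffD1[OF fl])
  qed
  moreover have "i = j" if i: "i \<in> cells m J" "z \<in> cell m h i" for i
  proof (rule PiE_ext[OF i(1)[unfolded cells_def] \<open>j \<in> cells m J\<close>[unfolded cells_def]])
    fix k :: nat assume k: "k \<in> {..2^m}"
    then have "i k = \<lceil>z (node m k) / h\<rceil> - 1" using i(2) unfolding cell_iff fl by simp
    then show "i k = j k" using k by (simp add: j_def)
  qed
  ultimately show ?thesis by (rule that)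
qed

text \<open>On the box the integrand is replaced by its value at the upper corner of the cell, off the box by
  zero.\<close>

lemma step_approximation:
  assumes \<mu>: "prob_space \<mu>" "sets \<mu> = sets borel" and h: "0 < h" and L: "0 < L" and b: "0 < b"
    and F: "\<And>x y. \<bar>F x - F y\<bar> \<le> L * dist x y" "\<And>x. \<bar>F x\<bar> \<le> b"
  shows "\<bar>(\<integral>z. F (project m z) \<partial>\<mu>) -
      (\<Sum>j\<in>cells m J. F (interp m (\<lambda>k. (real_of_int (j k) + 1) * h)) * measure \<mu> (cell m h j))\<bar> \<le>
    L * h + b * (1 - measure \<mu> (grid_box m (Suc (2 ^ m)) (\<lambda>_. - (real_of_int J * h)) (\<lambda>_. real_of_int J * h)))"
proof -
  interpret prob_space \<mu> by fact
  let ?B = "grid_box m (Suc (2 ^ m)) (\<lambda>_. - (real_of_int J * h)) (\<lambda>_. real_of_int J * h)"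
  define c where "c j = F (interp m (\<lambda>k. (real_of_int (j k) + 1) * h))" for j :: "nat \<Rightarrow> int"
  define s where "s z = (\<Sum>j\<in>cells m J. c j * indicator (cell m h j) z)" for z
  have sp: "space \<mu> = UNIV" using sets_eq_imp_space_eq[OF \<mu>(2)] by simp
  have cm [measurable]: "cell m h j \<in> sets \<mu>" "?B \<in> sets \<mu>" for j using \<mu>(2) by auto
  have "bounded_lipschitz F" unfolding bounded_lipschitz_def using F by blast
  then have Fm: "F \<in> borel_measurable borel" by (rule bounded_lipschitz_measurable)
  have Gm [measurable]: "(\<lambda>z. F (project m z)) \<in> borel_measurable \<mu>"
    using measurable_compose[OF project_measurable Fm] \<mu>(2) by (simp cong: measurable_cong_sets)
  have Gi: "integrable \<mu> (\<lambda>z. F (project m z))"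
    by (rule integrable_const_bound[where B=b]) (use F in auto)
  have si: "integrable \<mu> s"
    unfolding s_def
    by (intro Bochner_Integration.integrable_sum integrable_mult_right integrable_real_indicator) (auto simp: emeasure_eq_measure)
  have sint: "(\<integral>z. s z \<partial>\<mu>) = (\<Sum>j\<in>cells m J. c j * measure \<mu> (cell m h j))"
    unfolding s_def
    by (subst Bochner_Integration.integral_sum) (auto simp: emeasure_eq_measure intro!: integrable_mult_right integrable_real_indicator)
  have pt: "\<bar>F (project m z) - s z\<bar> \<le> L * h + b * indicator (- ?B) z" for z
  proof (cases "z \<in> ?B")
    case True
    obtain j where j: "j \<in> cells m J" "z \<in> cell m h j" "\<And>i. i \<in> cells m J \<Longrightarrow> z \<in> cell m h i \<Longrightarrow> i = j"
      using cell_exists[OF h True] by blast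
    have z0: "indicator (cell m h i) z = (0::real)" if "i \<in> cells m J - {j}" for i
      using j(3)[of i] that by (cases "z \<in> cell m h i") auto
    have "s z = (\<Sum>i\<in>{j}. c i * indicator (cell m h i) z)"
      unfolding s_def
    proof (rule sum.mono_neutral_right[OF finite_cells])
      show "{j} \<subseteq> cells m J" using j(1) by blast
      show "\<forall>i\<in>cells m J - {j}. c i * indicator (cell m h i) z = 0" using z0 by simp
    qed
    then have "s z = c j" using j(2) by simp
    moreover have "dist (project m z) (interp m (\<lambda>k. (real_of_int (j k) + 1) * h)) \<le> h"
      unfolding project_def
    proof (rule dist_interp_le)
      fix k :: nat assume "k \<le> 2 ^ m"
      then have "real_of_int (j k) * h < z (node m k)" "z (node m k) \<le> (real_of_int (j k) + 1) * h"
        using j(2) by (auto simp: cell_iff)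
      then show "\<bar>z (node m k) - (real_of_int (j k) + 1) * h\<bar> \<le> h"
        by (simp add: abs_le_iff distrib_right)
    qed
    then have "\<bar>F (project m z) - c j\<bar> \<le> L * h"
      unfolding c_def using F(1) L by (meson mult_left_mono order_trans less_imp_le)
    ultimately show ?thesis using True by simp
  next
    case False
    have out: "z \<notin> cell m h j" if "j \<in> cells m J" for j
    proof
      assume zc: "z \<in> cell m h j"
      have "z \<in> ?B"
        unfolding grid_box_def
      proof (intro CollectI allI impI conjI)
        fix k :: nat assume k: "k \<le> 2 ^ m"
        have jk: "- J \<le> j k" "j k + 1 \<le> J" using that k by (auto simp: cells_def PiE_def Pi_def)
        have zk: "real_of_int (j k) * h < z (node m k)" "z (node m k) \<le> (real_of_int (j k) + 1) * h"
          using zc k by (auto simp: cell_iff)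
        have "(real_of_int (j k) + 1) * h \<le> real_of_int J * h" using jk h by (intro mult_right_mono) linarith+
        then show "z (node m k) \<le> real_of_int J * h" using zk by linarith
        have "- real_of_int J * h \<le> real_of_int (j k) * h" using jk h by (intro mult_right_mono) linarith+
        then show "- (real_of_int J * h) < z (node m k)" using zk by simp
      qed
      with False show False by blast
    qed
    then have "s z = 0" unfolding s_def by (intro sum.neutral) simp
    then show ?thesis using F(2)[of "project m z"] False h L by (simp add: add_increasing)
  qed
  have "\<bar>(\<integral>z. F (project m z) \<partial>\<mu>) - (\<integral>z. s z \<partial>\<mu>)\<bar> = \<bar>\<integral>z. F (project m z) - s z \<partial>\<mu>\<bar>"
    using Gi si by simp
  also have "\<dots> \<le> (\<integral>z. \<bar>F (project m z) - s z\<bar> \<partial>\<mu>)" by (rule integral_abs_bound)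
  also have "\<dots> \<le> (\<integral>z. L * h + b * indicator (- ?B) z \<partial>\<mu>)"
  proof (rule integral_mono)
    show "integrable \<mu> (\<lambda>z. L * h + b * indicator (- ?B) z)"
      using \<mu>(2) by (intro Bochner_Integration.integrable_add integrable_const integrable_mult_right integrable_real_indicator)
        (auto simp: emeasure_eq_measure)
  qed (use Gi si pt in auto)
  also have "\<dots> = L * h + b * measure \<mu> (- ?B)"
  proof -
    have "- ?B \<in> sets \<mu>" using \<mu>(2) by auto
    then show ?thesis
      by (subst Bochner_Integration.integral_add)
        (auto simp: prob_space[unfolded sp] emeasure_eq_measure sp intro!: integrable_mult_right integrable_real_indicator)
  qed
  also have "measure \<mu> (- ?B) = 1 - measure \<mu> ?B"
    using prob_compl[OF cm(2)] by (simp add: sp Compl_eq_Diff_UNIV)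
  finally show ?thesis unfolding sint c_def .
qed

lemma dist_project_sets: "{z. \<epsilon> < dist z (project m z)} \<in> sets borel"
proof -
  have "(\<lambda>z. z + (- 1) *\<^sub>R project m z) \<in> borel_measurable borel" by measurable
  then have "(\<lambda>z. norm (z + (- 1) *\<^sub>R project m z)) \<in> borel_measurable borel" by measurable
  then have [measurable]: "(\<lambda>z. dist z (project m z)) \<in> borel_measurable borel" by (simp add: dist_norm)
  show ?thesis by measurable
qed

lemma projection_error:
  assumes \<mu>: "prob_space \<mu>" "sets \<mu> = sets borel" and L: "0 < L" and b: "0 < b" and \<epsilon>: "0 < \<epsilon>"
    and F: "\<And>x y. \<bar>F x - F y\<bar> \<le> L * dist x y" "\<And>x. \<bar>F x\<bar> \<le> b"
  shows "\<bar>(\<integral>z. F z \<partial>\<mu>) - (\<integral>z. F (project m z) \<partial>\<mu>)\<bar> \<le>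
    L * \<epsilon> + 2 * b * measure \<mu> {z. \<epsilon> < dist z (project m z)}"
proof -
  interpret prob_space \<mu> by fact
  let ?A = "{z. \<epsilon> < dist z (project m z)}"
  have sp: "space \<mu> = UNIV" using sets_eq_imp_space_eq[OF \<mu>(2)] by simp
  have bl: "bounded_lipschitz F" unfolding bounded_lipschitz_def using F by blast
  then have Fm: "F \<in> borel_measurable borel" by (rule bounded_lipschitz_measurable)
  have Gi: "integrable \<mu> (\<lambda>z. F (project m z))"
  proof (rule integrable_const_bound[where B=b])
    show "(\<lambda>z. F (project m z)) \<in> borel_measurable \<mu>"
      using measurable_compose[OF project_measurable Fm] \<mu>(2) by (simp cong: measurable_cong_sets)
  qed (use F in auto)
  have Fi: "integrable \<mu> F" by (rule integrable_bounded_lipschitz[OF bl \<mu>])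
  have A\<mu>: "?A \<in> sets \<mu>" using dist_project_sets \<mu>(2) by simp
  have pt: "\<bar>F z - F (project m z)\<bar> \<le> L * \<epsilon> + 2 * b * indicator ?A z" for z
  proof (cases "z \<in> ?A")
    case True
    then show ?thesis using F(2)[of z] F(2)[of "project m z"] L \<epsilon> by (simp add: add_increasing)
  next
    case False
    then have "L * dist z (project m z) \<le> L * \<epsilon>" using L by (intro mult_left_mono) auto
    then show ?thesis using F(1)[of z "project m z"] False by simp
  qed
  have "\<bar>(\<integral>z. F z \<partial>\<mu>) - (\<integral>z. F (project m z) \<partial>\<mu>)\<bar> = \<bar>\<integral>z. F z - F (project m z) \<partial>\<mu>\<bar>"
    using Gi Fi by simp
  also have "\<dots> \<le> (\<integral>z. \<bar>F z - F (project m z)\<bar> \<partial>\<mu>)" by (rule integral_abs_bound)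
  also have "\<dots> \<le> (\<integral>z. L * \<epsilon> + 2 * b * indicator ?A z \<partial>\<mu>)"
  proof (rule integral_mono)
    show "integrable \<mu> (\<lambda>z. L * \<epsilon> + 2 * b * indicator ?A z)"
      using A\<mu> by (intro Bochner_Integration.integrable_add integrable_const integrable_mult_right integrable_real_indicator)
        (auto simp: emeasure_eq_measure)
  qed (use Gi Fi pt in auto)
  also have "\<dots> = L * \<epsilon> + 2 * b * measure \<mu> ?A"
    using A\<mu> by (subst Bochner_Integration.integral_add)
      (auto simp: prob_space[unfolded sp] emeasure_eq_measure sp intro!: integrable_mult_right integrable_real_indicator)
  finally show ?thesis .
qed

text \<open>A Lipschitz function of the path is approximated by the same function of the interpolated path
  (at a cost controlled by the second condition), and then by a step function of the values at the
  nodes, whose integral is a finite combination of probabilities of cells. The latter converge by the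
  first condition.\<close>

theorem weak_convergence_criterion:
  fixes \<mu> :: "nat \<Rightarrow> C01 measure" and \<nu> :: "C01 measure" and f :: "C01 \<Rightarrow>\<^sub>C real"
  assumes \<mu>: "\<And>n. prob_space (\<mu> n)" "\<And>n. sets (\<mu> n) = sets borel"
    and \<nu>: "prob_space \<nu>" "sets \<nu> = sets borel"
    and cdf: "\<And>m y. (\<lambda>n. measure (\<mu> n) {z :: C01. \<forall>k\<le>2^m. z (node m k) \<le> y k}) \<longlonglongrightarrow>
      measure \<nu> {z :: C01. \<forall>k\<le>2^m. z (node m k) \<le> y k}"
    and tight: "\<And>\<epsilon> \<eta>. 0 < \<epsilon> \<Longrightarrow> 0 < \<eta> \<Longrightarrow> \<exists>m0. \<forall>m\<ge>m0. \<forall>\<^sub>F n in sequentially.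
      measure (\<mu> n) {z. \<epsilon> < dist z (project m z)} < \<eta>"
  shows "(\<lambda>n. \<integral>z. f z \<partial>\<mu> n) \<longlonglongrightarrow> (\<integral>z. f z \<partial>\<nu>)"
proof (rule lipschitz_portmanteau[OF \<mu> \<nu>])
  fix F :: "C01 \<Rightarrow> real" assume "bounded_lipschitz F"
  then obtain L b where L: "L > 0" and b: "b > 0" and F: "\<And>x y. \<bar>F x - F y\<bar> \<le> L * dist x y" "\<And>x. \<bar>F x\<bar> \<le> b"
    using bounded_lipschitzE by metis
  note bl = \<open>bounded_lipschitz F\<close>
  interpret n: prob_space \<nu> by fact
  show "(\<lambda>n. \<integral>x. F x \<partial>\<mu> n) \<longlonglongrightarrow> (\<integral>x. F x \<partial>\<nu>)"
  proof (rule tendstoI)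
    fix e :: real assume e: "0 < e"
    \<comment> \<open>The errors below add up to at most \<open>8 * d\<close>.\<close>
    define d where "d = e / 10"
    have d: "0 < d" using e by (simp add: d_def)
    define \<epsilon> where "\<epsilon> = d / L"
    have \<epsilon>: "0 < \<epsilon>" "L * \<epsilon> = d" using d L by (auto simp: \<epsilon>_def)
    have db: "0 < d / (2 * b)" using d b by simp
    obtain m0 where m0: "\<And>m. m0 \<le> m \<Longrightarrow> \<forall>\<^sub>F n in sequentially. measure (\<mu> n) {z. \<epsilon> < dist z (project m z)} < d / (2 * b)"
      using tight[OF \<epsilon>(1) db] by blast
    have limP: "(\<lambda>m. \<integral>z. F (project m z) \<partial>\<nu>) \<longlonglongrightarrow> (\<integral>z. F z \<partial>\<nu>)"
    proof (rule integral_dominated_convergence[where w="\<lambda>_. b"])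
      have "(\<lambda>m. F (project m z)) \<longlonglongrightarrow> F z" for z
        using bounded_lipschitz_continuous[OF bl] project_tendsto[of z]
        by (rule continuous_on_tendsto_compose) auto
      then show "AE z in \<nu>. (\<lambda>m. F (project m z)) \<longlonglongrightarrow> F z" by simp
      show "F \<in> borel_measurable \<nu>" "\<And>m. (\<lambda>z. F (project m z)) \<in> borel_measurable \<nu>"
        using bounded_lipschitz_measurable[OF bl] measurable_compose[OF project_measurable bounded_lipschitz_measurable[OF bl]] \<nu>(2)
        by (auto cong: measurable_cong_sets)
    qed (use F in auto)
    have "\<forall>\<^sub>F m in sequentially. dist (\<integral>z. F (project m z) \<partial>\<nu>) (\<integral>z. F z \<partial>\<nu>) < d"
      by (rule tendstoD[OF limP d])
    then obtain m1 where m1: "\<And>m. m1 \<le> m \<Longrightarrow> dist (\<integral>z. F (project m z) \<partial>\<nu>) (\<integral>z. F z \<partial>\<nu>) < d"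
      by (auto simp: eventually_sequentially)
    define m where "m = max m0 m1"
    have A1: "\<forall>\<^sub>F n in sequentially. measure (\<mu> n) {z. \<epsilon> < dist z (project m z)} < d / (2 * b)"
      by (rule m0) (simp add: m_def)
    have A2: "\<bar>(\<integral>z. F (project m z) \<partial>\<nu>) - (\<integral>z. F z \<partial>\<nu>)\<bar> < d"
      using m1[of m] by (simp add: m_def dist_real_def)
    \<comment> \<open>The mesh of the cells, again with \<open>L * h = d\<close>.\<close>
    define h where "h = \<epsilon>"
    define B where "B J = grid_box m (Suc (2 ^ m)) (\<lambda>_. - (real_of_int J * h)) (\<lambda>_. real_of_int J * h)" for J
    have "\<forall>\<^sub>F k in sequentially. measure \<nu> {z. real k < norm z} < d / b"
      by (rule order_tendstoD(2)[OF norm_tail_vanishes[OF \<nu>]]) (use d b in simp)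
    then obtain k where k: "measure \<nu> {z. real k < norm z} < d / b"
      by (auto simp: eventually_sequentially)
    define J where "J = \<lfloor>real k / h\<rfloor> + 1"
    have J: "real k < real_of_int J * h"
    proof -
      have "real k / h < real_of_int J" unfolding J_def by linarith
      then show ?thesis using \<epsilon> by (simp add: h_def pos_divide_less_eq)
    qed
    have Bm: "B J \<in> sets \<nu>" using \<nu>(2) by (simp add: B_def)
    have spn: "space \<nu> = UNIV" using sets_eq_imp_space_eq[OF \<nu>(2)] by simp
    have "1 - measure \<nu> (B J) = measure \<nu> (space \<nu> - B J)"
      using n.prob_compl[OF Bm] by simp
    also have "\<dots> \<le> measure \<nu> {z. real k < norm z}"
    proof (rule n.finite_measure_mono)
      show "space \<nu> - B J \<subseteq> {z. real k < norm z}"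
      proof (rule subsetI, rule ccontr)
        fix z assume z: "z \<in> space \<nu> - B J" "z \<notin> {z. real k < norm z}"
        have "\<bar>z t\<bar> < real_of_int J * h" for t
          using norm_bounded[of z t] z(2) J by simp
        then have "z \<in> B J" by (auto simp: B_def grid_box_def abs_less_iff intro: less_imp_le minus_less_iff[THEN iffD1])
        with z(1) show False by simp
      qed
      show "{z. real k < norm z} \<in> sets \<nu>" unfolding \<nu>(2) by measurable
    qed
    finally have A3: "1 - measure \<nu> (B J) < d / b" using k by simp
    have limB: "(\<lambda>n. measure (\<mu> n) (B J)) \<longlonglongrightarrow> measure \<nu> (B J)"
      unfolding B_def by (rule grid_box_limit[OF \<mu> \<nu> cdf]) (use J in auto)
    have A4: "\<forall>\<^sub>F n in sequentially. 1 - d / b < measure (\<mu> n) (B J)"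
      by (rule order_tendstoD(1)[OF limB]) (use A3 in simp)
    define c where "c j = F (interp m (\<lambda>k. (real_of_int (j k) + 1) * h))" for j :: "nat \<Rightarrow> int"
    define S where "S \<rho> = (\<Sum>j\<in>cells m J. c j * measure \<rho> (cell m h j))" for \<rho>
    have limS: "(\<lambda>n. S (\<mu> n)) \<longlonglongrightarrow> S \<nu>"
      unfolding S_def cell_def using \<epsilon>
      by (intro tendsto_sum tendsto_mult tendsto_const grid_box_limit[OF \<mu> \<nu> cdf]) (auto simp: h_def)
    have A5: "\<forall>\<^sub>F n in sequentially. dist (S (\<mu> n)) (S \<nu>) < d" by (rule tendstoD[OF limS d])
    have step: "\<bar>(\<integral>z. F (project m z) \<partial>\<rho>) - S \<rho>\<bar> \<le> d + b * (1 - measure \<rho> (B J))"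
      if "prob_space \<rho>" "sets \<rho> = sets borel" for \<rho>
      using step_approximation[OF that \<epsilon>(1)[folded h_def] L b F, of m J] \<epsilon>(2)
      unfolding S_def c_def B_def h_def by simp
    have stepn: "\<bar>(\<integral>z. F (project m z) \<partial>\<nu>) - S \<nu>\<bar> < 2 * d"
      using step[OF \<nu>] A3 b by (simp add: pos_less_divide_eq mult.commute)
    show "\<forall>\<^sub>F n in sequentially. dist (\<integral>x. F x \<partial>\<mu> n) (\<integral>x. F x \<partial>\<nu>) < e"
      using A1 A4 A5
    proof eventually_elim
      case (elim n)
      have "\<bar>(\<integral>z. F z \<partial>\<mu> n) - (\<integral>z. F (project m z) \<partial>\<mu> n)\<bar> \<le>
          d + 2 * b * measure (\<mu> n) {z. \<epsilon> < dist z (project m z)}"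
        using projection_error[OF \<mu> L b \<epsilon>(1) F, of n m] \<epsilon>(2) by simp
      moreover have "2 * b * measure (\<mu> n) {z. \<epsilon> < dist z (project m z)} < d"
        using elim(1) b by (simp add: pos_less_divide_eq mult.commute mult.left_commute)
      moreover have "b * (1 - measure (\<mu> n) (B J)) < d"
      proof -
        have "1 - measure (\<mu> n) (B J) < d / b" using elim(2) by linarith
        then show ?thesis using b by (simp add: pos_less_divide_eq mult.commute)
      qed
      ultimately show ?case
        using step[OF \<mu>, of n] stepn A2 elim(3) unfolding dist_real_def d_def by linarith
    qed
  qed
qed

section \<open>Maxima of independent rows\<close>

lemma power_one_minus_limit:
  fixes p :: "nat \<Rightarrow> real"
  assumes p: "\<And>n. 0 \<le> p n" and lim: "(\<lambda>n. real (Suc n) * p n) \<longlonglongrightarrow> \<Lambda>"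
  shows "(\<lambda>n. (1 - p n) ^ Suc n) \<longlonglongrightarrow> exp (- \<Lambda>)"
proof -
  have "(\<lambda>n. (real (Suc n) * p n) * (1 / real (Suc n))) \<longlonglongrightarrow> \<Lambda> * 0"
    by (intro tendsto_mult lim LIMSEQ_Suc[OF lim_1_over_n])
  then have p0: "p \<longlonglongrightarrow> 0" by simp
  then have small: "\<forall>\<^sub>F n in sequentially. p n < 1" by (rule order_tendstoD) simp
  have "(\<lambda>n. real (Suc n) * ln (1 - p n)) \<longlonglongrightarrow> - \<Lambda>"
  proof (rule tendsto_sandwich)
    show "\<forall>\<^sub>F n in sequentially. - (real (Suc n) * p n) / (1 - p n) \<le> real (Suc n) * ln (1 - p n)"
      using small
    proof eventually_elim
      case (elim n)
      have "ln (1 / (1 - p n)) \<le> 1 / (1 - p n) - 1" using elim by (intro ln_le_minus_one) simp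
      also have "\<dots> = p n / (1 - p n)" using elim by (simp add: field_simps)
      finally have "- (p n / (1 - p n)) \<le> ln (1 - p n)" using elim by (simp add: ln_div)
      then have "real (Suc n) * - (p n / (1 - p n)) \<le> real (Suc n) * ln (1 - p n)"
        by (intro mult_left_mono) auto
      then show ?case by simp
    qed
    show "\<forall>\<^sub>F n in sequentially. real (Suc n) * ln (1 - p n) \<le> - (real (Suc n) * p n)"
      using small
    proof eventually_elim
      case (elim n)
      have "ln (1 - p n) \<le> - p n" using ln_le_minus_one[of "1 - p n"] elim by simp
      then have "real (Suc n) * ln (1 - p n) \<le> real (Suc n) * - p n" by (intro mult_left_mono) auto
      then show ?case by simp
    qed
    have "(\<lambda>n. - (real (Suc n) * p n) / (1 - p n)) \<longlonglongrightarrow> - \<Lambda> / (1 - 0)"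
      by (intro tendsto_divide tendsto_minus lim tendsto_diff tendsto_const p0) simp
    then show "(\<lambda>n. - (real (Suc n) * p n) / (1 - p n)) \<longlonglongrightarrow> - \<Lambda>" by simp
    show "(\<lambda>n. - (real (Suc n) * p n)) \<longlonglongrightarrow> - \<Lambda>" by (intro tendsto_minus lim)
  qed
  then have "(\<lambda>n. exp (real (Suc n) * ln (1 - p n))) \<longlonglongrightarrow> exp (- \<Lambda>)" by (rule tendsto_exp)
  moreover have "\<forall>\<^sub>F n in sequentially. exp (real (Suc n) * ln (1 - p n)) = (1 - p n) ^ Suc n"
    using small by eventually_elim (simp only: exp_of_nat_mult exp_ln diff_gt_0_iff_gt)
  ultimately show ?thesis by (rule Lim_transform_eventually)
qed

text \<open>As some path, number \<open>i0\<close>, stays above \<open>- (L + \<kappa> + 1)\<close>, the maximum is attained by paths that start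
  above \<open>- r\<close>, and the maximum of functions with a common modulus of continuity has this modulus. The
  drift \<open>- t/2\<close> contributes the other \<open>\<epsilon> / 2\<close>.\<close>

lemma max_process_regular:
  fixes x :: "nat \<Rightarrow> real" and d :: "nat \<Rightarrow> C01" and z :: C01
  assumes z: "\<And>t. z t = (MAX i\<in>I. x i + d i t - real_of_unit t / 2)" and I: "finite I"
    and i0: "i0 \<in> I" "- L < x i0" "norm (d i0) \<le> \<kappa>"
    and left: "\<And>i. i \<in> I \<Longrightarrow> x i \<le> - r \<Longrightarrow> x i + norm (d i) \<le> - (L + \<kappa> + 1)"
    and osc: "\<And>i. i \<in> I \<Longrightarrow> - r < x i \<Longrightarrow> osc m (d i) \<le> \<epsilon> / 2" and m: "1 / 2 ^ m \<le> \<epsilon>"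
  shows "dist z (project m z) \<le> \<epsilon>"
proof (rule dist_project_le)
  define f where "f i t = x i + d i t - real_of_unit t / 2" for i t
  have ub: "f i t \<le> z t" if "i \<in> I" for i t
    unfolding z f_def[symmetric] using that I by (intro Max_ge) auto
  have at: "\<exists>i\<in>I. z t = f i t" for t
  proof -
    have "z t \<in> (\<lambda>i. f i t) ` I" unfolding z f_def[symmetric] using i0 I by (intro Max_in) auto
    then show ?thesis by auto
  qed
  have one_sided: "z t - z s \<le> \<epsilon>" if st: "dist s t \<le> 1 / 2 ^ m" for s t
  proof -
    obtain i where i: "i \<in> I" "z t = f i t" using at by blast
    have "- L - \<kappa> - 1 / 2 \<le> f i0 t"
      using i0 norm_bounded[of "d i0" t] real_of_unit_range[of t] unfolding f_def by simp
    then have "- (L + \<kappa> + 1) < f i t" using ub[OF i0(1), of t] i(2) by linarith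
    also have "f i t \<le> x i + norm (d i)"
      using norm_bounded[of "d i" t] real_of_unit_range[of t] unfolding f_def by simp
    finally have "- r < x i" using left[OF i(1)] by linarith
    then have "\<bar>d i t - d i s\<bar> \<le> \<epsilon> / 2"
      using osc[OF i(1)] osc_ge[of t s m "d i"] st by (simp add: dist_commute)
    moreover have "\<bar>real_of_unit s - real_of_unit t\<bar> \<le> \<epsilon>"
      using st m by (simp add: dist_unit_interval_def dist_real_def)
    ultimately have "f i t - f i s \<le> \<epsilon>" unfolding f_def by linarith
    then show ?thesis using ub[OF i(1), of s] i(2) by linarith
  qed
  show "\<bar>z s - z t\<bar> \<le> \<epsilon>" if "dist s t \<le> 1 / 2 ^ m" for s t
    using one_sided[OF that] one_sided[of t s] that by (simp add: dist_commute abs_le_iff)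
qed

context typical_row
begin

definition mark_prob :: "nat \<Rightarrow> (real \<times> C01) set \<Rightarrow> real" where
  "mark_prob n S = prob {\<omega>\<in>space M. (X n \<omega>, R n \<omega> + \<delta> n \<omega>) \<in> S}"

text \<open>The maximum lies below \<open>y\<close> at the nodes iff all \<open>Suc n\<close> independent members do, which has
  probability \<open>(1 - p)^Suc n\<close> with \<open>Suc n * p\<close> converging by \<open>excess_rate\<close>. Regularity of the maximum
  can fail only if there is no good point, if a point far to the left matters, or if a path that starts
  above \<open>- r\<close> oscillates too much.\<close>

theorem rows_converge:
  fixes x :: "nat \<Rightarrow> nat \<Rightarrow> 'a \<Rightarrow> real" and d :: "nat \<Rightarrow> nat \<Rightarrow> 'a \<Rightarrow> C01" and E :: "nat \<Rightarrow> 'a \<Rightarrow> C01"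
    and f :: "C01 \<Rightarrow>\<^sub>C real"
  assumes ind: "\<And>n. indep_vars (\<lambda>_. borel \<Otimes>\<^sub>M borel) (\<lambda>i \<omega>. (x i n \<omega>, d i n \<omega>)) {1..Suc n}"
    and ident: "\<And>n i. i \<in> {1..Suc n} \<Longrightarrow> distr M (borel \<Otimes>\<^sub>M borel) (\<lambda>\<omega>. (x i n \<omega>, d i n \<omega>)) =
      distr M (borel \<Otimes>\<^sub>M borel) (\<lambda>\<omega>. (X n \<omega>, R n \<omega> + \<delta> n \<omega>))"
    and E_m: "\<And>n. E n \<in> borel_measurable M"
    and E: "\<And>n \<omega> t. E n \<omega> t = (MAX i\<in>{1..Suc n}. x i n \<omega> + d i n \<omega> t - real_of_unit t / 2)"
    and \<nu>: "prob_space \<nu>" "sets \<nu> = sets borel"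
    and void: "\<And>m y. measure \<nu> {z::C01. \<forall>k\<le>2^m. z (node m k) \<le> y k} =
      exp (- (\<integral>w. exp (grid_excess m y w) \<partial>wiener))"
  shows "(\<lambda>n. \<integral>z. f z \<partial>distr M borel (E n)) \<longlonglongrightarrow> (\<integral>z. f z \<partial>\<nu>)"
proof -
  let ?S2 = "borel \<Otimes>\<^sub>M borel :: (real \<times> C01) measure"
  have xd: "(\<lambda>\<omega>. (x i n \<omega>, d i n \<omega>)) \<in> measurable M ?S2" if "i \<in> {1..Suc n}" for i n
    using ind[of n] that by (auto simp: indep_vars_def)
  have XRm: "(\<lambda>\<omega>. (X n \<omega>, R n \<omega> + \<delta> n \<omega>)) \<in> measurable M ?S2" for n by measurable
  have ev: "{\<omega>\<in>space M. (x i n \<omega>, d i n \<omega>) \<in> S} \<in> sets M" if "i \<in> {1..Suc n}" "S \<in> sets ?S2" for i n S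
    using measurable_sets[OF xd[OF that(1)] that(2)] by (simp add: vimage_def Int_def conj_commute)
  have single: "prob {\<omega>\<in>space M. (x i n \<omega>, d i n \<omega>) \<in> S} = mark_prob n S"
    if i: "i \<in> {1..Suc n}" and S: "S \<in> sets ?S2" for i n S
  proof -
    have "prob {\<omega>\<in>space M. (x i n \<omega>, d i n \<omega>) \<in> S} = measure (distr M ?S2 (\<lambda>\<omega>. (x i n \<omega>, d i n \<omega>))) S"
      using S xd[OF i] by (subst measure_distr) (auto intro!: arg_cong[where f=prob])
    also have "\<dots> = mark_prob n S"
      unfolding ident[OF i] mark_prob_def using S XRm[of n]
      by (subst measure_distr) (auto intro!: arg_cong[where f=prob])
    finally show ?thesis .
  qed
  have all: "prob {\<omega>\<in>space M. \<forall>i\<in>{1..Suc n}. (x i n \<omega>, d i n \<omega>) \<in> S} = mark_prob n S ^ Suc n"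
    if S: "S \<in> sets ?S2" for n S
  proof -
    have "{\<omega>\<in>space M. \<forall>i\<in>{1..Suc n}. (x i n \<omega>, d i n \<omega>) \<in> S} =
        (\<Inter>i\<in>{1..Suc n}. (\<lambda>\<omega>. (x i n \<omega>, d i n \<omega>)) -` S \<inter> space M)"
      by auto
    then have "prob {\<omega>\<in>space M. \<forall>i\<in>{1..Suc n}. (x i n \<omega>, d i n \<omega>) \<in> S} =
        (\<Prod>i\<in>{1..Suc n}. prob ((\<lambda>\<omega>. (x i n \<omega>, d i n \<omega>)) -` S \<inter> space M))"
      using indep_varsD[OF ind, of "{1..Suc n}" n "\<lambda>_. S"] S by simp
    also have "\<dots> = (\<Prod>i\<in>{1..Suc n}. mark_prob n S)"
      by (intro prod.cong refl) (use single[OF _ S] in \<open>simp add: vimage_def Int_def conj_commute\<close>)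
    finally show ?thesis by simp
  qed
  have ex_m: "{\<omega>\<in>space M. \<exists>i\<in>{1..Suc n}. (x i n \<omega>, d i n \<omega>) \<in> S} \<in> sets M" if "S \<in> sets ?S2" for n S
  proof -
    have "{\<omega>\<in>space M. \<exists>i\<in>{1..Suc n}. (x i n \<omega>, d i n \<omega>) \<in> S} =
        (\<Union>i\<in>{1..Suc n}. {\<omega>\<in>space M. (x i n \<omega>, d i n \<omega>) \<in> S})" by auto
    also have "\<dots> \<in> sets M" by (intro sets.finite_UN ev that) auto
    finally show ?thesis .
  qed
  have ex: "prob {\<omega>\<in>space M. \<exists>i\<in>{1..Suc n}. (x i n \<omega>, d i n \<omega>) \<in> S} \<le>
      rate n (\<lambda>\<omega>. (X n \<omega>, R n \<omega> + \<delta> n \<omega>) \<in> S)" if S: "S \<in> sets ?S2" for n S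
  proof -
    have "{\<omega>\<in>space M. \<exists>i\<in>{1..Suc n}. (x i n \<omega>, d i n \<omega>) \<in> S} =
        (\<Union>i\<in>{1..Suc n}. {\<omega>\<in>space M. (x i n \<omega>, d i n \<omega>) \<in> S})" by auto
    then have "prob {\<omega>\<in>space M. \<exists>i\<in>{1..Suc n}. (x i n \<omega>, d i n \<omega>) \<in> S} \<le>
        (\<Sum>i\<in>{1..Suc n}. prob {\<omega>\<in>space M. (x i n \<omega>, d i n \<omega>) \<in> S})"
      using measure_UNION_le[of "{1..Suc n}" "\<lambda>i. {\<omega>\<in>space M. (x i n \<omega>, d i n \<omega>) \<in> S}" M] ev[OF _ S] by simp
    also have "\<dots> = (\<Sum>i\<in>{1..Suc n}. mark_prob n S)"
      by (intro sum.cong refl single S)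
    finally show ?thesis by (simp add: rate_def mark_prob_def)
  qed
  have compl: "mark_prob n (- S) = 1 - mark_prob n S" if S: "S \<in> sets ?S2" for n S
  proof -
    have "{\<omega>\<in>space M. (X n \<omega>, R n \<omega> + \<delta> n \<omega>) \<in> S} \<in> sets M"
      using measurable_sets[OF XRm S, of n] by (simp add: vimage_def Int_def conj_commute)
    from prob_compl[OF this]
    have "prob (space M - {\<omega>\<in>space M. (X n \<omega>, R n \<omega> + \<delta> n \<omega>) \<in> S}) = 1 - mark_prob n S"
      by (simp only: mark_prob_def)
    moreover have "{\<omega>\<in>space M. (X n \<omega>, R n \<omega> + \<delta> n \<omega>) \<in> - S} =
        space M - {\<omega>\<in>space M. (X n \<omega>, R n \<omega> + \<delta> n \<omega>) \<in> S}" by auto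
    ultimately show ?thesis by (simp only: mark_prob_def)
  qed
  have S2: "{p\<in>space ?S2. P p} \<in> sets ?S2 \<Longrightarrow> {p. P p} \<in> sets ?S2" for P
    by (simp add: space_pair_measure)
  show ?thesis
  proof (rule weak_convergence_criterion[OF _ _ \<nu>])
    show "prob_space (distr M borel (E n))" for n by (rule prob_space_distr[OF E_m])
    show "(\<lambda>n. measure (distr M borel (E n)) {z :: C01. \<forall>k\<le>2 ^ m. z (node m k) \<le> y k}) \<longlonglongrightarrow>
        measure \<nu> {z :: C01. \<forall>k\<le>2 ^ m. z (node m k) \<le> y k}" for m y
    proof -
      define S where "S = {p :: real \<times> C01. 0 < fst p + grid_excess m y (snd p)}"
      have Sm: "S \<in> sets ?S2" unfolding S_def by (rule S2) measurable
      have Cm: "- S \<in> sets ?S2" using sets.compl_sets[OF Sm] by (simp add: space_pair_measure Compl_eq_Diff_UNIV)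
      have Bm: "{z :: C01. \<forall>k\<le>2 ^ m. z (node m k) \<le> y k} \<in> sets borel" by measurable
      have "measure (distr M borel (E n)) {z :: C01. \<forall>k\<le>2 ^ m. z (node m k) \<le> y k} = (1 - mark_prob n S) ^ Suc n" for n
      proof -
        have "measure (distr M borel (E n)) {z :: C01. \<forall>k\<le>2 ^ m. z (node m k) \<le> y k} =
            prob {\<omega>\<in>space M. \<forall>k\<le>2 ^ m. E n \<omega> (node m k) \<le> y k}"
          using Bm E_m by (subst measure_distr) (auto intro!: arg_cong[where f=prob])
        also have "{\<omega>\<in>space M. \<forall>k\<le>2 ^ m. E n \<omega> (node m k) \<le> y k} =
            {\<omega>\<in>space M. \<forall>i\<in>{1..Suc n}. (x i n \<omega>, d i n \<omega>) \<in> - S}"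
        proof (intro Collect_cong conj_cong refl)
          fix \<omega>
          have "(\<forall>k\<le>2 ^ m. E n \<omega> (node m k) \<le> y k) \<longleftrightarrow>
              (\<forall>i\<in>{1..Suc n}. \<forall>k\<le>2 ^ m. x i n \<omega> + d i n \<omega> (node m k) - real_of_unit (node m k) / 2 \<le> y k)"
            unfolding E by (subst Max_le_iff) auto
          moreover have "(x i n \<omega>, d i n \<omega>) \<in> - S \<longleftrightarrow>
              (\<forall>k\<le>2 ^ m. x i n \<omega> + d i n \<omega> (node m k) - real_of_unit (node m k) / 2 \<le> y k)" for i
          proof -
            have "(x i n \<omega>, d i n \<omega>) \<in> - S \<longleftrightarrow> grid_excess m y (d i n \<omega>) \<le> - x i n \<omega>"
              unfolding S_def by auto
            then show ?thesis unfolding grid_excess_le_iff by (simp add: algebra_simps)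
          qed
          ultimately show "(\<forall>k\<le>2 ^ m. E n \<omega> (node m k) \<le> y k) \<longleftrightarrow>
              (\<forall>i\<in>{1..Suc n}. (x i n \<omega>, d i n \<omega>) \<in> - S)" by simp
        qed
        finally show ?thesis by (simp only: all[OF Cm] compl[OF Sm])
      qed
      moreover have "(\<lambda>n. (1 - mark_prob n S) ^ Suc n) \<longlonglongrightarrow> exp (- (\<integral>w. exp (grid_excess m y w) \<partial>wiener))"
      proof (rule power_one_minus_limit)
        show "0 \<le> mark_prob n S" for n by (simp add: mark_prob_def)
        show "(\<lambda>n. real (Suc n) * mark_prob n S) \<longlonglongrightarrow> (\<integral>w. exp (grid_excess m y w) \<partial>wiener)"
          using excess_rate[of m y] unfolding rate_def mark_prob_def S_def by simp
      qed
      ultimately show ?thesis by (simp only: void)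
    qed
    show "\<exists>m0. \<forall>m\<ge>m0. \<forall>\<^sub>F n in sequentially.
        measure (distr M borel (E n)) {z. \<epsilon> < dist z (project m z)} < \<eta>"
      if \<epsilon>: "0 < \<epsilon>" and \<eta>: "0 < \<eta>" for \<epsilon> \<eta> :: real
    proof -
      have \<eta>3: "0 < \<eta> / 3" using \<eta> by simp
      obtain L \<kappa> where L: "0 \<le> L" "0 \<le> \<kappa>" and good: "\<forall>\<^sub>F n in sequentially.
          (1 - prob {\<omega>\<in>space M. - L < X n \<omega> \<and> norm (R n \<omega> + \<delta> n \<omega>) \<le> \<kappa>}) ^ Suc n < \<eta> / 3"
        using good_point_exists[OF \<eta>3] by blast
      have "0 \<le> L + \<kappa> + 1" using L by simp
      from left_points_negligible[OF this \<eta>3] obtain r where left: "\<forall>\<^sub>F n in sequentially.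
          rate n (\<lambda>\<omega>. X n \<omega> \<le> - r \<and> - (L + \<kappa> + 1) < X n \<omega> + norm (R n \<omega> + \<delta> n \<omega>)) < \<eta> / 3"
        by blast
      have \<epsilon>2: "0 < \<epsilon> / 2" using \<epsilon> by simp
      from large_oscillation_negligible[OF \<epsilon>2 \<eta>3, of r] obtain m0 where m0: "\<And>m. m0 \<le> m \<Longrightarrow>
          \<forall>\<^sub>F n in sequentially. rate n (\<lambda>\<omega>. - r < X n \<omega> \<and> \<epsilon> / 2 < osc m (R n \<omega> + \<delta> n \<omega>)) < \<eta> / 3"
        by blast
      obtain m1 where m1: "(1 / 2) ^ m1 < \<epsilon>" using real_arch_pow_inv[OF \<epsilon>, of "1/2"] by auto
      show ?thesis
      proof (intro exI allI impI)
        fix m assume m: "max m0 m1 \<le> m"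
        have "(1 / 2 :: real) ^ m \<le> (1 / 2) ^ m1" using m by (intro power_decreasing) auto
        then have m\<epsilon>: "1 / 2 ^ m \<le> \<epsilon>" using m1 by (simp add: power_divide)
        define G where "G = {p :: real \<times> C01. - L < fst p \<and> norm (snd p) \<le> \<kappa>}"
        define S1 where "S1 = {p :: real \<times> C01. fst p \<le> - r \<and> - (L + \<kappa> + 1) < fst p + norm (snd p)}"
        define S3 where "S3 = {p :: real \<times> C01. - r < fst p \<and> \<epsilon> / 2 < osc m (snd p)}"
        have Gm: "G \<in> sets ?S2" unfolding G_def by (rule S2) measurable
        have S1m: "S1 \<in> sets ?S2" unfolding S1_def by (rule S2) measurable
        have S3m: "S3 \<in> sets ?S2" unfolding S3_def by (rule S2) measurable
        have Cm: "- G \<in> sets ?S2" using sets.compl_sets[OF Gm] by (simp add: space_pair_measure Compl_eq_Diff_UNIV)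
        have e3: "\<forall>\<^sub>F n in sequentially. rate n (\<lambda>\<omega>. - r < X n \<omega> \<and> \<epsilon> / 2 < osc m (R n \<omega> + \<delta> n \<omega>)) < \<eta> / 3"
          by (rule m0) (use m in simp)
        show "\<forall>\<^sub>F n in sequentially. measure (distr M borel (E n)) {z. \<epsilon> < dist z (project m z)} < \<eta>"
          using good left e3
        proof eventually_elim
          case (elim n)
          let ?A = "{\<omega>\<in>space M. \<forall>i\<in>{1..Suc n}. (x i n \<omega>, d i n \<omega>) \<in> - G}"
          let ?B = "{\<omega>\<in>space M. \<exists>i\<in>{1..Suc n}. (x i n \<omega>, d i n \<omega>) \<in> S1}"
          let ?D = "{\<omega>\<in>space M. \<exists>i\<in>{1..Suc n}. (x i n \<omega>, d i n \<omega>) \<in> S3}"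
          have Am: "?A \<in> sets M"
          proof -
            have "?A = space M - {\<omega>\<in>space M. \<exists>i\<in>{1..Suc n}. (x i n \<omega>, d i n \<omega>) \<in> G}" by auto
            then show ?thesis using ex_m[OF Gm, of n] by (simp only:) (rule sets.compl_sets)
          qed
          note Bm = ex_m[OF S1m, of n] and Dm = ex_m[OF S3m, of n]
          have "measure (distr M borel (E n)) {z. \<epsilon> < dist z (project m z)} =
              prob (E n -` {z. \<epsilon> < dist z (project m z)} \<inter> space M)"
            by (rule measure_distr[OF E_m dist_project_sets])
          also have "\<dots> \<le> prob (?A \<union> (?B \<union> ?D))"
          proof (rule finite_measure_mono)
            show "E n -` {z. \<epsilon> < dist z (project m z)} \<inter> space M \<subseteq> ?A \<union> (?B \<union> ?D)"
            proof (rule subsetI, rule ccontr)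
              fix \<omega> assume w: "\<omega> \<in> E n -` {z. \<epsilon> < dist z (project m z)} \<inter> space M" "\<omega> \<notin> ?A \<union> (?B \<union> ?D)"
              then obtain i0 where i0: "i0 \<in> {1..Suc n}" "(x i0 n \<omega>, d i0 n \<omega>) \<in> G" by auto
              have nS: "(x i n \<omega>, d i n \<omega>) \<notin> S1" "(x i n \<omega>, d i n \<omega>) \<notin> S3" if "i \<in> {1..Suc n}" for i
                using w that by auto
              have "dist (E n \<omega>) (project m (E n \<omega>)) \<le> \<epsilon>"
              proof (rule max_process_regular[OF E, of n i0 L \<omega> \<kappa> r m \<epsilon>])
                show "- L < x i0 n \<omega>" "norm (d i0 n \<omega>) \<le> \<kappa>" using i0(2) by (auto simp: G_def)
                show "x i n \<omega> + norm (d i n \<omega>) \<le> - (L + \<kappa> + 1)" if "i \<in> {1..Suc n}" "x i n \<omega> \<le> - r" for i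
                  using nS(1)[OF that(1)] that(2) by (simp add: S1_def)
                show "osc m (d i n \<omega>) \<le> \<epsilon> / 2" if "i \<in> {1..Suc n}" "- r < x i n \<omega>" for i
                  using nS(2)[OF that(1)] that(2) by (simp add: S3_def)
              qed (use i0 m\<epsilon> in auto)
              then show False using w(1) by simp
            qed
          qed (use Am Bm Dm in blast)
          also have "\<dots> \<le> prob ?A + (prob ?B + prob ?D)"
            using measure_Un_le[OF Am, of "?B \<union> ?D"] measure_Un_le[OF Bm Dm] Bm Dm by (simp add: sets.Un)
          finally have le: "measure (distr M borel (E n)) {z. \<epsilon> < dist z (project m z)} \<le>
            prob ?A + (prob ?B + prob ?D)" .
          have g: "mark_prob n G = prob {\<omega>\<in>space M. - L < X n \<omega> \<and> norm (R n \<omega> + \<delta> n \<omega>) \<le> \<kappa>}"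
            by (simp add: mark_prob_def G_def)
          have "prob ?A < \<eta> / 3"
            using elim(1) by (simp only: all[OF Cm] compl[OF Gm] g)
          moreover have "rate n (\<lambda>\<omega>. (X n \<omega>, R n \<omega> + \<delta> n \<omega>) \<in> S1) < \<eta> / 3"
            using elim(2) by (simp add: S1_def)
          moreover have "rate n (\<lambda>\<omega>. (X n \<omega>, R n \<omega> + \<delta> n \<omega>) \<in> S3) < \<eta> / 3"
            using elim(3) by (simp add: S3_def)
          ultimately show ?case using le ex[OF S1m, of n] ex[OF S3m, of n] by linarith
        qed
      qed
    qed
  qed simp
qed

end

section \<open>Normalising constants and the limit theorem\<close>

text \<open>With \<open>l n = ln n / c\<close> one has \<open>exp (- c * (b n + s/c)) = exp (- s) / (n * K * l n powr \<beta>)\<close>, while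
  \<open>b n + s/c\<close> is asymptotically equivalent to \<open>l n\<close>.\<close>

lemma normalising_constants:
  fixes K c \<beta> s :: real
  assumes K: "0 < K" and c: "0 < c"
  defines "b \<equiv> \<lambda>n. (1 / c) * (ln (real n) + \<beta> * ln ((1 / c) * ln (real n)) + ln K)"
  shows "filterlim (\<lambda>n. b n + s / c) at_top sequentially"
    and "(\<lambda>n. real n * (K * (b n + s / c) powr \<beta> * exp (- c * (b n + s / c)))) \<longlonglongrightarrow> exp (- s)"
proof -
  define l where "l n = (1 / c) * ln (real n)" for n :: nat
  define u where "u n = b n + s / c" for n
  have l_top: "filterlim l at_top sequentially"
    unfolding l_def using c by real_asymp
  have r0: "(\<lambda>n. ln (l n) / ln (real n)) \<longlonglongrightarrow> 0"
    unfolding l_def using c by real_asymp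
  have r1: "(\<lambda>n. (ln K + s) / ln (real n)) \<longlonglongrightarrow> 0"
    by real_asymp
  have "(\<lambda>n. 1 + (\<beta> * (ln (l n) / ln (real n)) + (ln K + s) / ln (real n))) \<longlonglongrightarrow> 1 + (\<beta> * 0 + 0)"
    by (intro tendsto_add tendsto_mult tendsto_const r0 r1)
  moreover have "\<forall>\<^sub>F n in sequentially. 1 + (\<beta> * (ln (l n) / ln (real n)) + (ln K + s) / ln (real n)) = u n / l n"
    using eventually_ge_at_top[of 2]
  proof eventually_elim
    case (elim n)
    then have "0 < ln (real n)" by simp
    then show ?case using c unfolding u_def b_def l_def[symmetric] by (simp add: l_def field_simps)
  qed
  ultimately have ratio: "(\<lambda>n. u n / l n) \<longlonglongrightarrow> 1"
    by (auto intro: Lim_transform_eventually)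
  have prod_top: "filterlim (\<lambda>n. (u n / l n) * l n) at_top sequentially"
    by (rule filterlim_tendsto_pos_mult_at_top[OF ratio _ l_top]) simp
  have l_pos: "\<forall>\<^sub>F n in sequentially. 0 < l n"
    using l_top by (simp add: filterlim_at_top_dense)
  then have "\<forall>\<^sub>F n in sequentially. (u n / l n) * l n = u n"
    by eventually_elim simp
  then have u_top: "filterlim u at_top sequentially"
    by (rule iffD1[OF filterlim_cong[OF refl refl] prod_top])
  then show "filterlim (\<lambda>n. b n + s / c) at_top sequentially"
    by (simp add: u_def[abs_def])
  have u_pos: "\<forall>\<^sub>F n in sequentially. 0 < u n"
    using u_top by (simp add: filterlim_at_top_dense)
  have "(\<lambda>n. (u n / l n) powr \<beta> * exp (- s)) \<longlonglongrightarrow> 1 powr \<beta> * exp (- s)"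
    by (intro tendsto_mult tendsto_powr ratio tendsto_const) simp
  moreover have "\<forall>\<^sub>F n in sequentially.
      (u n / l n) powr \<beta> * exp (- s) = real n * (K * u n powr \<beta> * exp (- c * u n))"
    using l_pos u_pos eventually_gt_at_top[of 0]
  proof eventually_elim
    case (elim n)
    have "- c * u n = - ln (real n) + (- (\<beta> * ln (l n)) + (- ln K + - s))"
      using c unfolding u_def b_def l_def by (simp add: field_simps)
    then have "exp (- c * u n) = exp (- ln (real n)) * (exp (- (\<beta> * ln (l n))) * (exp (- ln K) * exp (- s)))"
      by (simp only: exp_add)
    also have "\<dots> = (1 / real n) * ((1 / l n powr \<beta>) * ((1 / K) * exp (- s)))"
      using elim K by (simp add: exp_minus powr_def inverse_eq_divide)
    finally have e: "exp (- c * u n) = (1 / real n) * ((1 / l n powr \<beta>) * ((1 / K) * exp (- s)))" .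
    have "(u n / l n) powr \<beta> = u n powr \<beta> / l n powr \<beta>"
      using elim by (simp add: powr_divide)
    then show ?case unfolding e using elim K by simp
  qed
  ultimately show "(\<lambda>n. real n * (K * (b n + s / c) powr \<beta> * exp (- c * (b n + s / c)))) \<longlonglongrightarrow> exp (- s)"
    unfolding u_def[symmetric] by (auto intro: Lim_transform_eventually)
qed

text \<open>The argument of the square is at least \<open>ln n / 4\<close> eventually, and \<open>exp (- (ln n)\<^sup>2 / (16 * p))\<close> is
  of smaller order than \<open>1/n\<close>.\<close>

lemma far_left_negligible:
  fixes c \<beta> p K :: real
  assumes c: "0 < c" and p: "0 < p"
  shows "(\<lambda>n. real n * exp (- (((ln (real n) + \<beta> * ln ((1 / c) * ln (real n)) + ln K) / 2)\<^sup>2) / p)) \<longlonglongrightarrow> 0"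
proof (rule tendsto_sandwich[OF _ _ tendsto_const])
  have r: "(\<lambda>n. ln ((1 / c) * ln (real n)) / ln (real n)) \<longlonglongrightarrow> 0"
    using c by real_asymp
  have r1: "(\<lambda>n. ln K / ln (real n)) \<longlonglongrightarrow> 0"
    by real_asymp
  have "(\<lambda>n. 1 + (\<beta> * (ln ((1 / c) * ln (real n)) / ln (real n)) + ln K / ln (real n))) \<longlonglongrightarrow> 1 + (\<beta> * 0 + 0)"
    by (intro tendsto_add tendsto_mult tendsto_const r r1)
  then have "\<forall>\<^sub>F n in sequentially. 1 / 2 < 1 + (\<beta> * (ln ((1 / c) * ln (real n)) / ln (real n)) + ln K / ln (real n))"
    by (rule order_tendstoD) simp
  then show "\<forall>\<^sub>F n in sequentially.
      real n * exp (- (((ln (real n) + \<beta> * ln ((1 / c) * ln (real n)) + ln K) / 2)\<^sup>2) / p)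
      \<le> real n * exp (- ((ln (real n) / 4)\<^sup>2) / p)"
    using eventually_ge_at_top[of 2]
  proof eventually_elim
    case (elim n)
    define v where "v = \<beta> * ln ((1 / c) * ln (real n)) + ln K"
    have ln: "0 < ln (real n)" using elim(2) by simp
    have "\<beta> * (ln ((1 / c) * ln (real n)) / ln (real n)) + ln K / ln (real n) = v / ln (real n)"
      by (simp add: v_def add_divide_distrib)
    then have "- 1 / 2 < v / ln (real n)" using elim(1) by linarith
    then have "- ln (real n) / 2 < v" using ln by (simp add: pos_less_divide_eq)
    then have "ln (real n) / 4 \<le> (ln (real n) + v) / 2" by simp
    then have "(ln (real n) / 4)\<^sup>2 \<le> ((ln (real n) + v) / 2)\<^sup>2"
      using ln by (intro power_mono) auto
    then have "- (((ln (real n) + v) / 2)\<^sup>2) / p \<le> - ((ln (real n) / 4)\<^sup>2) / p"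
      using p by (intro divide_right_mono) auto
    then show ?case unfolding v_def by (intro mult_left_mono) (simp_all add: add.assoc)
  qed
  show "(\<lambda>n. real n * exp (- ((ln (real n) / 4)\<^sup>2) / p)) \<longlonglongrightarrow> 0"
    using p by real_asymp
qed auto

theorem lemma3p1:
  fixes M :: "'a measure"
    and Y X \<phi> :: "nat \<Rightarrow> nat \<Rightarrow> 'a \<Rightarrow> real"
    and R \<delta> W :: "nat \<Rightarrow> nat \<Rightarrow> 'a \<Rightarrow> C01"
    and K c \<beta> q C :: real
    and a b :: "nat \<Rightarrow> real"
    and N :: "'b measure"
    and P :: "nat \<Rightarrow> 'b \<Rightarrow> real"
    and B :: "nat \<Rightarrow> real \<Rightarrow> 'b \<Rightarrow> real"
  assumes "prob_space M"
    and iid_indep: "\<And>n. n \<ge> 1 \<Longrightarrow>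
      prob_space.indep_vars M (\<lambda>_. borel \<Otimes>\<^sub>M borel \<Otimes>\<^sub>M borel)
        (\<lambda>i \<omega>. (Y i n \<omega>, R i n \<omega>, \<delta> i n \<omega>)) {1..n}"
    and iid_ident: "\<And>n i. 1 \<le> i \<Longrightarrow> i \<le> n \<Longrightarrow>
      distr M (borel \<Otimes>\<^sub>M borel \<Otimes>\<^sub>M borel) (\<lambda>\<omega>. (Y i n \<omega>, R i n \<omega>, \<delta> i n \<omega>)) =
      distr M (borel \<Otimes>\<^sub>M borel \<Otimes>\<^sub>M borel) (\<lambda>\<omega>. (Y 1 n \<omega>, R 1 n \<omega>, \<delta> 1 n \<omega>))"
    and "K > 0" and "c > 0"
    and Y_ident: "\<And>n i. 1 \<le> i \<Longrightarrow> i \<le> n \<Longrightarrow> distr M borel (Y i n) = distr M borel (Y 1 1)"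
    and Y_tail: "(\<lambda>u. \<P>(\<omega> in M. Y 1 1 \<omega> > u)) \<sim>[at_top] (\<lambda>u. K * u powr \<beta> * exp (- c * u))"
    and a_eq: "\<And>n. a n = 1 / c"
    and b_eq: "\<And>n. b n = (1 / c) * (ln (real n) + \<beta> * ln ((1 / c) * ln (real n)) + ln K)"
    and X_eq: "\<And>i n \<omega>. X i n \<omega> = (Y i n \<omega> - b n) / a n"
    and X_left: "\<forall>\<^sub>F r in at_top. \<forall>p>0.
      limsup (\<lambda>n. of_nat n *
        (\<integral>\<^sup>+x\<in>{- b n / (2 * a n)..- r}. ennreal (exp (- (x^2) / p)) \<partial>distr M borel (X 1 n))) < \<infinity>"
    and W_bm: "\<And>n i. 1 \<le> i \<Longrightarrow> i \<le> n \<Longrightarrow>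
      W i n \<in> borel_measurable M \<and> standard_brownian_motion M {0..1} (\<lambda>t \<omega>. W i n \<omega> (to_unit t))"
    and W_X: "\<And>n i. 1 \<le> i \<Longrightarrow> i \<le> n \<Longrightarrow> indep_rv M borel (W i n) borel (X i n)"
    and \<phi>_pos: "\<And>n i. 1 \<le> i \<Longrightarrow> i \<le> n \<Longrightarrow>
      \<phi> i n \<in> borel_measurable M \<and> (AE \<omega> in M. \<phi> i n \<omega> > 0)"
    and \<phi>_W: "\<And>n i. 1 \<le> i \<Longrightarrow> i \<le> n \<Longrightarrow> indep_rv M borel (\<phi> i n) borel (W i n)"
    and XR_distr: "\<And>n i. 1 \<le> i \<Longrightarrow> i \<le> n \<Longrightarrow>
      distr M (borel \<Otimes>\<^sub>M borel) (\<lambda>\<omega>. (X i n \<omega>, R i n \<omega>)) =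
      distr M (borel \<Otimes>\<^sub>M borel) (\<lambda>\<omega>. (X i n \<omega>, \<phi> i n \<omega> *\<^sub>R W i n \<omega>))"
    and "q > 0"
    and \<phi>_bound: "(\<lambda>n. real n * \<P>(\<omega> in M. \<phi> 1 n \<omega> > q)) \<longlonglongrightarrow> 0"
    and \<phi>_lim: "\<And>Q \<epsilon>. compact Q \<Longrightarrow> \<epsilon> > 0 \<Longrightarrow>
      (\<lambda>n. \<P>(\<omega> in M. \<bar>1 - \<phi> 1 n \<omega>\<bar> > \<epsilon> \<bar> X 1 n \<omega> \<in> Q)) \<longlonglongrightarrow> 0"
    and \<delta>_X: "\<And>n i. 1 \<le> i \<Longrightarrow> i \<le> n \<Longrightarrow> indep_rv M borel (\<delta> i n) borel (X i n)"
    and \<delta>_lim: "\<And>\<epsilon>. \<epsilon> > 0 \<Longrightarrow> (\<lambda>n. \<P>(\<omega> in M. norm (\<delta> 1 n \<omega>) > \<epsilon>)) \<longlonglongrightarrow> 0"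
    and "C > 0"
    and \<delta>_bound: "(\<lambda>n. real n * \<P>(\<omega> in M. norm (\<delta> 1 n \<omega>) > C)) \<longlonglongrightarrow> 0"
    \<comment> \<open>an arbitrary construction of the Brown-Resnick process, with Poisson points \<open>P\<close>\<close>
    and MB: "brown_resnick_ingredients N P B"
  shows "\<exists>M\<^sub>B. brown_resnick_on_unit N P B M\<^sub>B \<and>
    converges_in_distribution M
      (\<lambda>n \<omega>. row_max_process n (\<lambda>i. X i n \<omega>) (\<lambda>i. R i n \<omega>) (\<lambda>i. \<delta> i n \<omega>)) N M\<^sub>B"
proof -
  interpret M: prob_space M by fact
  interpret N: prob_space N using MB by (simp add: brown_resnick_ingredients_def)
  note K = \<open>K > 0\<close> and c = \<open>c > 0\<close>
  have triple: "(\<lambda>\<omega>. (Y i n \<omega>, R i n \<omega>, \<delta> i n \<omega>)) \<in> measurable M (borel \<Otimes>\<^sub>M borel \<Otimes>\<^sub>M borel)"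
    if "1 \<le> i" "i \<le> n" for i n
    using iid_indep[of n] that by (auto simp: M.indep_vars_def)
  have Ym: "Y i n \<in> borel_measurable M" and Rm: "R i n \<in> borel_measurable M"
    and \<delta>m: "\<delta> i n \<in> borel_measurable M" if "1 \<le> i" "i \<le> n" for i n
    using measurable_compose[OF triple[OF that] measurable_fst]
      measurable_compose[OF measurable_compose[OF triple[OF that] measurable_snd] measurable_fst]
      measurable_compose[OF measurable_compose[OF triple[OF that] measurable_snd] measurable_snd]
    by simp_all
  have Xm: "X i n \<in> borel_measurable M" if "1 \<le> i" "i \<le> n" for i n
    unfolding X_eq[abs_def] using Ym[OF that] by measurable
  have X_gt: "s < X i n \<omega> \<longleftrightarrow> b n + s / c < Y i n \<omega>" for s i n \<omega>
  proof -
    have "s < X i n \<omega> \<longleftrightarrow> s < c * (Y i n \<omega> - b n)" using c by (simp add: X_eq a_eq mult.commute)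
    then show ?thesis using c by (simp add: field_simps)
  qed
  define F where "F u = \<P>(\<omega> in M. Y 1 1 \<omega> > u)" for u
  have X_prob: "M.prob {\<omega>\<in>space M. s < X 1 n \<omega>} = F (b n + s / c)" if n: "1 \<le> n" for s n
  proof -
    have YF: "M.prob {\<omega>\<in>space M. u < Y 1 k \<omega>} = measure (distr M borel (Y 1 k)) {u<..}"
      if "1 \<le> k" for u and k :: nat
      using Ym[of 1 k] that by (subst measure_distr) (auto intro!: arg_cong[where f=M.prob])
    show ?thesis
      unfolding X_gt F_def using YF[OF n] YF[of 1] Y_ident[of 1 n] n by simp
  qed
  have X_tail: "(\<lambda>n. real (Suc n) * M.prob {\<omega>\<in>space M. s < X 1 (Suc n) \<omega>}) \<longlonglongrightarrow> exp (- s)" for s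
  proof -
    note nc = normalising_constants[OF K c, of \<beta> s, folded b_eq]
    have "(\<lambda>n. F (b n + s / c)) \<sim>[sequentially] (\<lambda>n. K * (b n + s / c) powr \<beta> * exp (- c * (b n + s / c)))"
      using asymp_equiv_compose'[OF Y_tail nc(1)] by (simp add: F_def)
    then have "(\<lambda>n. real n * F (b n + s / c)) \<sim>[sequentially]
        (\<lambda>n. real n * (K * (b n + s / c) powr \<beta> * exp (- c * (b n + s / c))))"
      by (intro asymp_equiv_intros)
    then have "(\<lambda>n. real n * F (b n + s / c)) \<longlonglongrightarrow> exp (- s)"
      using tendsto_asymp_equiv_cong nc(2) by blast
    then have "(\<lambda>n. real (Suc n) * F (b (Suc n) + s / c)) \<longlonglongrightarrow> exp (- s)"
      by (rule LIMSEQ_Suc)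
    moreover have "1 \<le> Suc n" for n by simp
    ultimately show ?thesis by (simp only: X_prob)
  qed
  \<comment> \<open>The hypothesis on the left tail stops at \<open>- b n / (2 * a n)\<close>; further to the left the integrand
    itself is negligible.\<close>
  have X_left': "\<exists>r K. \<forall>\<^sub>F n in sequentially. real (Suc n) *
      (\<integral>\<omega>. exp (- ((X 1 (Suc n) \<omega>)\<^sup>2) / p) * indicator {..- r} (X 1 (Suc n) \<omega>) \<partial>M) \<le> K" if p: "0 < p" for p
  proof -
    obtain r where r: "limsup (\<lambda>n. of_nat n *
        (\<integral>\<^sup>+x\<in>{- b n / (2 * a n)..- r}. ennreal (exp (- (x^2) / p)) \<partial>distr M borel (X 1 n))) < \<infinity>"
      using eventually_happens'[OF trivial_limit_at_top_linorder X_left] p by auto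
    then obtain D where D: "limsup (\<lambda>n. of_nat n *
        (\<integral>\<^sup>+x\<in>{- b n / (2 * a n)..- r}. ennreal (exp (- (x^2) / p)) \<partial>distr M borel (X 1 n))) < D" "D < \<infinity>"
      using dense by blast
    then obtain k where k: "0 \<le> k" "D = ennreal k" by (cases D) auto
    have e1: "\<forall>\<^sub>F n in sequentially. of_nat n *
        (\<integral>\<^sup>+x\<in>{- b n / (2 * a n)..- r}. ennreal (exp (- (x^2) / p)) \<partial>distr M borel (X 1 n)) < D"
      by (rule Limsup_lessD[OF D(1)])
    have ba: "b n / (2 * a n) = (ln (real n) + \<beta> * ln ((1 / c) * ln (real n)) + ln K) / 2" for n
      using c unfolding b_eq a_eq by (simp add: field_simps)
    have e2: "\<forall>\<^sub>F n in sequentially. real n * exp (- ((b n / (2 * a n))\<^sup>2) / p) < 1"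
      unfolding ba by (rule order_tendstoD(2)[OF far_left_negligible[OF c p]]) simp
    have e3: "\<forall>\<^sub>F n in sequentially. 0 \<le> b n / (2 * a n)"
    proof -
      have "\<forall>\<^sub>F n in sequentially. 0 \<le> b n + 0 / c"
        using normalising_constants(1)[OF K c, of \<beta> 0, folded b_eq] by (simp add: filterlim_at_top)
      then show ?thesis by eventually_elim (use c in \<open>simp add: a_eq\<close>)
    qed
    have "\<forall>\<^sub>F n in sequentially. real n *
        (\<integral>\<omega>. exp (- ((X 1 n \<omega>)\<^sup>2) / p) * indicator {..- r} (X 1 n \<omega>) \<partial>M) \<le> k + 1"
      using e1 e2 e3 eventually_ge_at_top[of 1]
    proof eventually_elim
      case (elim n)
      define Xn where "Xn = X 1 n"
      have [measurable]: "Xn \<in> borel_measurable M"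
        unfolding Xn_def by (rule Xm[OF order_refl elim(4)])
      define t where "t = b n / (2 * a n)"
      define I where "I = (\<integral>\<omega>. exp (- ((Xn \<omega>)\<^sup>2) / p) * indicator {..- r} (Xn \<omega>) \<partial>M)"
      have e_le: "exp (- (x\<^sup>2) / p) \<le> 1" for x :: real using p by simp
      have "integrable M (\<lambda>\<omega>. exp (- ((Xn \<omega>)\<^sup>2) / p) * indicator {..- r} (Xn \<omega>))"
      proof (rule M.integrable_const_bound[where B=1])
        show "AE \<omega> in M. norm (exp (- ((Xn \<omega>)\<^sup>2) / p) * indicator {..- r} (Xn \<omega>)) \<le> 1"
          by (intro AE_I2) (simp add: abs_mult mult_le_one indicator_def p less_imp_le)
      qed measurable
      then have "ennreal I = (\<integral>\<^sup>+\<omega>. ennreal (exp (- ((Xn \<omega>)\<^sup>2) / p) * indicator {..- r} (Xn \<omega>)) \<partial>M)"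
        unfolding I_def by (subst nn_integral_eq_integral) (auto simp: indicator_def)
      also have "\<dots> \<le> (\<integral>\<^sup>+\<omega>. ennreal (exp (- ((Xn \<omega>)\<^sup>2) / p)) * indicator {- t..- r} (Xn \<omega>) +
          ennreal (exp (- (t\<^sup>2) / p)) \<partial>M)"
      proof (rule nn_integral_mono)
        fix \<omega>
        let ?x = "Xn \<omega>"
        show "ennreal (exp (- (?x\<^sup>2) / p) * indicator {..- r} ?x) \<le>
            ennreal (exp (- (?x\<^sup>2) / p)) * indicator {- t..- r} ?x + ennreal (exp (- (t\<^sup>2) / p))"
        proof (cases "?x < - t")
          case True
          then have "t\<^sup>2 \<le> ?x\<^sup>2" using elim(3) power_mono[of t "- ?x" 2] by (simp add: t_def)
          then have "exp (- (?x\<^sup>2) / p) \<le> exp (- (t\<^sup>2) / p)" using p by (simp add: divide_right_mono)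
          then have "exp (- (?x\<^sup>2) / p) * indicator {..- r} ?x \<le> exp (- (t\<^sup>2) / p)"
            by (auto simp: indicator_def)
          then show ?thesis by (intro add_increasing ennreal_leI) auto
        next
          case False
          then show ?thesis by (auto simp: indicator_def)
        qed
      qed
      also have "\<dots> = (\<integral>\<^sup>+\<omega>. ennreal (exp (- ((Xn \<omega>)\<^sup>2) / p)) * indicator {- t..- r} (Xn \<omega>) \<partial>M) +
          ennreal (exp (- (t\<^sup>2) / p))"
        by (subst nn_integral_add) (auto simp: M.emeasure_space_1)
      also have "(\<integral>\<^sup>+\<omega>. ennreal (exp (- ((Xn \<omega>)\<^sup>2) / p)) * indicator {- t..- r} (Xn \<omega>) \<partial>M) =
          (\<integral>\<^sup>+x\<in>{- b n / (2 * a n)..- r}. ennreal (exp (- (x^2) / p)) \<partial>distr M borel (Xn))"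
        by (subst nn_integral_distr) (auto simp: t_def)
      finally have "of_nat n * ennreal I \<le> of_nat n *
          ((\<integral>\<^sup>+x\<in>{- b n / (2 * a n)..- r}. ennreal (exp (- (x^2) / p)) \<partial>distr M borel (Xn)) + ennreal (exp (- (t\<^sup>2) / p)))"
        by (rule mult_left_mono) simp
      also have "\<dots> \<le> ennreal k + ennreal 1"
        unfolding distrib_left
      proof (rule add_mono)
        show "of_nat n * (\<integral>\<^sup>+x\<in>{- b n / (2 * a n)..- r}. ennreal (exp (- (x^2) / p)) \<partial>distr M borel (Xn)) \<le> ennreal k"
          using elim(1) k by (simp add: Xn_def)
        show "of_nat n * ennreal (exp (- (t\<^sup>2) / p)) \<le> ennreal 1"
          using elim(2) unfolding ennreal_of_nat_eq_real_of_nat t_def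
          by (subst ennreal_mult[symmetric]) (auto intro!: ennreal_leI)
      qed
      also have "\<dots> = ennreal (k + 1)" using k by simp
      finally have "ennreal (real n * I) \<le> ennreal (k + 1)"
        by (simp add: ennreal_of_nat_eq_real_of_nat ennreal_mult')
      then have "real n * I \<le> k + 1" using k by (subst (asm) ennreal_le_iff) auto
      then show ?case unfolding Xn_def[symmetric] I_def[symmetric] .
    qed
    then obtain n0 where "\<And>n. n0 \<le> n \<Longrightarrow> real n *
        (\<integral>\<omega>. exp (- ((X 1 n \<omega>)\<^sup>2) / p) * indicator {..- r} (X 1 n \<omega>) \<partial>M) \<le> k + 1"
      by (auto simp: eventually_sequentially)
    then have "\<forall>\<^sub>F n in sequentially. real (Suc n) *
        (\<integral>\<omega>. exp (- ((X 1 (Suc n) \<omega>)\<^sup>2) / p) * indicator {..- r} (X 1 (Suc n) \<omega>) \<partial>M) \<le> k + 1"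
      by (intro eventually_sequentiallyI[of n0]) (meson le_SucI)
    then show ?thesis by blast
  qed
  \<comment> \<open>Rows are renumbered by \<open>Suc\<close>, since the hypotheses concern non-empty rows only.\<close>
  interpret row: typical_row M "\<lambda>n. X 1 (Suc n)" "\<lambda>n. \<phi> 1 (Suc n)" "\<lambda>n. R 1 (Suc n)"
    "\<lambda>n. \<delta> 1 (Suc n)" "\<lambda>n. W 1 (Suc n)" q C
  proof
    fix n :: nat
    have n: "1 \<le> (1::nat)" "1 \<le> Suc n" by auto
    show "X 1 (Suc n) \<in> borel_measurable M" "R 1 (Suc n) \<in> borel_measurable M" "\<delta> 1 (Suc n) \<in> borel_measurable M"
      using Xm[OF n] Rm[OF n] \<delta>m[OF n] by auto
    show "\<phi> 1 (Suc n) \<in> borel_measurable M" "AE \<omega> in M. 0 < \<phi> 1 (Suc n) \<omega>" using \<phi>_pos[OF n] by auto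
    show "bm_version M (\<lambda>t \<omega>. W 1 (Suc n) \<omega> (to_unit t)) (W 1 (Suc n))"
      using W_bm[OF n] M.prob_space_axioms unfolding bm_version_def by auto
    show "indep_rv M borel (W 1 (Suc n)) borel (X 1 (Suc n))" by (rule W_X[OF n])
    show "indep_rv M borel (\<delta> 1 (Suc n)) borel (X 1 (Suc n))" by (rule \<delta>_X[OF n])
    show "distr M (borel \<Otimes>\<^sub>M borel) (\<lambda>\<omega>. (X 1 (Suc n) \<omega>, R 1 (Suc n) \<omega>)) =
      distr M (borel \<Otimes>\<^sub>M borel) (\<lambda>\<omega>. (X 1 (Suc n) \<omega>, \<phi> 1 (Suc n) \<omega> *\<^sub>R W 1 (Suc n) \<omega>))"
      by (rule XR_distr[OF n])
  next
    show "(\<lambda>n. real (Suc n) * M.prob {\<omega>\<in>space M. q < \<phi> 1 (Suc n) \<omega>}) \<longlonglongrightarrow> 0"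
      by (rule LIMSEQ_Suc[OF \<phi>_bound])
    show "(\<lambda>n. real (Suc n) * M.prob {\<omega>\<in>space M. C < norm (\<delta> 1 (Suc n) \<omega>)}) \<longlonglongrightarrow> 0"
      by (rule LIMSEQ_Suc[OF \<delta>_bound])
    show "(\<lambda>n. \<P>(\<omega> in M. \<bar>1 - \<phi> 1 (Suc n) \<omega>\<bar> > \<epsilon> \<bar> X 1 (Suc n) \<omega> \<in> Q)) \<longlonglongrightarrow> 0"
      if "compact Q" "0 < \<epsilon>" for Q \<epsilon> by (rule LIMSEQ_Suc[OF \<phi>_lim[OF that]])
    show "(\<lambda>n. M.prob {\<omega>\<in>space M. \<epsilon> < norm (\<delta> 1 (Suc n) \<omega>)}) \<longlonglongrightarrow> 0"
      if "0 < \<epsilon>" for \<epsilon> by (rule LIMSEQ_Suc[OF \<delta>_lim[OF that]])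
  qed (use X_tail X_left' \<open>q > 0\<close> \<open>C > 0\<close> in auto)
  obtain Z V where Z: "brown_resnick_on_unit N P B Z" and V: "bm_version N (B 0) V"
    and void: "\<And>m y. emeasure N {\<omega>\<in>space N. \<forall>k\<le>2^m. Z \<omega> (node m k) \<le> y k} =
      nexp (\<integral>\<^sup>+\<omega>. ennreal (exp (grid_excess m y (V \<omega>))) \<partial>N)"
    using brown_resnick_process[OF MB] by blast
  have Zm: "Z \<in> borel_measurable N" using Z by (simp add: brown_resnick_on_unit_def)
  have Vm: "V \<in> borel_measurable N" using V by (simp add: bm_version_def)
  have Vlaw: "distr N borel V = row.wiener"
    unfolding row.wiener_def by (rule bm_law_unique[OF V row.W_bm])
  have Z_cdf: "measure (distr N borel Z) {z::C01. \<forall>k\<le>2^m. z (node m k) \<le> y k} =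
      exp (- (\<integral>w. exp (grid_excess m y w) \<partial>row.wiener))" for m y
  proof -
    have L: "0 \<le> (\<integral>w. exp (grid_excess m y w) \<partial>row.wiener)" by (intro integral_nonneg_AE) auto
    have "(\<integral>\<^sup>+\<omega>. ennreal (exp (grid_excess m y (V \<omega>))) \<partial>N) = (\<integral>\<^sup>+w. ennreal (exp (grid_excess m y w)) \<partial>row.wiener)"
      unfolding Vlaw[symmetric] using Vm by (subst nn_integral_distr) auto
    also have "\<dots> = ennreal (\<integral>w. exp (grid_excess m y w) \<partial>row.wiener)"
      by (rule nn_integral_eq_integral[OF row.wiener_exp_excess]) simp
    finally have "N.prob {\<omega>\<in>space N. \<forall>k\<le>2^m. Z \<omega> (node m k) \<le> y k} =
        exp (- (\<integral>w. exp (grid_excess m y w) \<partial>row.wiener))"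
      using void[of m y] L by (simp add: nexp_ennreal N.emeasure_eq_measure)
    moreover have "{z::C01. \<forall>k\<le>2^m. z (node m k) \<le> y k} \<in> sets borel" by measurable
    ultimately show ?thesis
      using Zm by (subst measure_distr) (auto simp: vimage_def Int_def conj_commute)
  qed
  define E where "E n \<omega> = row_max_process n (\<lambda>i. X i n \<omega>) (\<lambda>i. R i n \<omega>) (\<lambda>i. \<delta> i n \<omega>)" for n \<omega>
  have E_apply: "E n \<omega> t = (MAX i\<in>{1..n}. X i n \<omega> + (R i n \<omega> + \<delta> i n \<omega>) t - real_of_unit t / 2)"
    if "1 \<le> n" for n \<omega> t
    unfolding E_def row_max_process_apply[OF that] by (simp add: algebra_simps)
  have E_m: "E n \<in> borel_measurable M" for n
  proof (cases "n = 0")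
    case True
    then have "E n = (\<lambda>\<omega>. E 0 undefined)" by (simp add: E_def[abs_def] row_max_process_def)
    then show ?thesis by (metis borel_measurable_const)
  next
    case False
    show ?thesis
    proof (rule measurable_C01I)
      fix t
      have "(\<lambda>\<omega>. MAX i\<in>{1..n}. X i n \<omega> + (R i n \<omega> + \<delta> i n \<omega>) t - real_of_unit t / 2) \<in> borel_measurable M"
      proof (rule borel_measurable_Max)
        fix i assume "i \<in> {1..n}"
        then have i: "1 \<le> i" "i \<le> n" by auto
        note [measurable] = Xm[OF i] Rm[OF i] \<delta>m[OF i]
        show "(\<lambda>\<omega>. X i n \<omega> + (R i n \<omega> + \<delta> i n \<omega>) t - real_of_unit t / 2) \<in> borel_measurable M"
          by measurable
      qed simp
      then show "(\<lambda>\<omega>. E n \<omega> t) \<in> borel_measurable M" using E_apply False by simp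
    qed
  qed
  have conv: "(\<lambda>n. \<integral>z. f z \<partial>distr M borel (E n)) \<longlonglongrightarrow> (\<integral>z. f z \<partial>distr N borel Z)" for f :: "C01 \<Rightarrow>\<^sub>C real"
  proof (rule LIMSEQ_imp_Suc, rule row.rows_converge[where x="\<lambda>i n. X i (Suc n)" and d="\<lambda>i n \<omega>. R i (Suc n) \<omega> + \<delta> i (Suc n) \<omega>"])
    fix n :: nat
    define g where "g p = ((fst p - b (Suc n)) / a (Suc n), fst (snd p) + snd (snd p))" for p :: "real \<times> C01 \<times> C01"
    have gm: "g \<in> measurable (borel \<Otimes>\<^sub>M borel \<Otimes>\<^sub>M borel) (borel \<Otimes>\<^sub>M borel)"
      unfolding g_def[abs_def] by measurable
    have gX: "g (Y i (Suc n) \<omega>, R i (Suc n) \<omega>, \<delta> i (Suc n) \<omega>) = (X i (Suc n) \<omega>, R i (Suc n) \<omega> + \<delta> i (Suc n) \<omega>)" for i \<omega>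
      by (simp add: g_def X_eq)
    show "M.indep_vars (\<lambda>_. borel \<Otimes>\<^sub>M borel) (\<lambda>i \<omega>. (X i (Suc n) \<omega>, R i (Suc n) \<omega> + \<delta> i (Suc n) \<omega>)) {1..Suc n}"
      using M.indep_vars_compose2[OF iid_indep[of "Suc n"], where Y="\<lambda>_. g", OF _ gm] unfolding gX by simp
    show "distr M (borel \<Otimes>\<^sub>M borel) (\<lambda>\<omega>. (X i (Suc n) \<omega>, R i (Suc n) \<omega> + \<delta> i (Suc n) \<omega>)) =
        distr M (borel \<Otimes>\<^sub>M borel) (\<lambda>\<omega>. (X 1 (Suc n) \<omega>, R 1 (Suc n) \<omega> + \<delta> 1 (Suc n) \<omega>))"
      if "i \<in> {1..Suc n}" for i
    proof -
      have push: "distr M (borel \<Otimes>\<^sub>M borel) (\<lambda>\<omega>. (X i (Suc n) \<omega>, R i (Suc n) \<omega> + \<delta> i (Suc n) \<omega>)) =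
          distr (distr M (borel \<Otimes>\<^sub>M borel \<Otimes>\<^sub>M borel) (\<lambda>\<omega>. (Y i (Suc n) \<omega>, R i (Suc n) \<omega>, \<delta> i (Suc n) \<omega>))) (borel \<Otimes>\<^sub>M borel) g"
        if "1 \<le> i" "i \<le> Suc n" for i
        unfolding distr_distr[OF gm triple[OF that]] comp_def gX ..
      show ?thesis using push[of i] push[of 1] iid_ident[of i "Suc n"] that by simp
    qed
    show "E (Suc n) \<in> borel_measurable M" by (rule E_m)
    show "E (Suc n) \<omega> t = (MAX i\<in>{1..Suc n}. X i (Suc n) \<omega> + (R i (Suc n) \<omega> + \<delta> i (Suc n) \<omega>) t - real_of_unit t / 2)" for \<omega> t
      by (rule E_apply) simp
  next
    show "prob_space (distr N borel Z)" by (rule N.prob_space_distr[OF Zm])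
  qed (use Z_cdf in auto)
  show ?thesis
    unfolding converges_in_distribution_def
    using Z Zm E_m conv unfolding E_def by (intro exI[of _ Z]) auto
qed

end
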